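(* Let $p$ be a prime with $p\ge 53$ and let $A,B$ be subsets of $\mathbb{Z}/p\mathbb{Z}$ with $|A|\ge 4$ and $|B|\ge 5$. If $$|A+B|\le |A|+|B|+1\le p-5,$$ then there is $r\in\mathbb{Z}/p\mathbb{Z}$ such that $\ell_r(A)\le |A|+2$ and $\ell_r(B)\le |B|+2$.
   Context: $A+B=\{a+b: a\in A, b\in B\}$. For a subset $X$ of $\mathbb{Z}/p\mathbb{Z}$ and $r\in\mathbb{Z}/p\mathbb{Z}$, $\ell_r(X)$ denotes (when it exists) the cardinality of the smallest arithmetic progression with difference $r$ containing $X$. *)

theory Defs
  imports
    "Berlekamp_Zassenhaus.Finite_Field"
    "HOL-Library.Set_Algebras"
    "HOL-Library.Extended_Nat"
begin

text \<open>
  For a prime \<open>p\<close>, the ring \<open>\<int>/p\<int>\<close> is the type \<open>'p mod_ring\<close>, where \<open>'p\<close> has class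
  \<open>prime_card\<close> and \<open>p = CARD('p)\<close>. The sumset \<open>A + B\<close> is that of \<open>HOL-Library.Set_Algebras\<close>.
\<close>

definition is_AP :: "'a::comm_ring_1 \<Rightarrow> 'a set \<Rightarrow> bool" where
  "is_AP r P \<longleftrightarrow> (\<exists>a n. P = {a + of_nat i * r | i. i < n})"

text \<open>
  \<open>\<ell>\<^sub>r(X)\<close> takes its value in \<open>enat\<close> because no progression of difference \<open>r\<close> need contain
  \<open>X\<close> (take \<open>r = 0\<close> and \<open>X\<close> with two elements). The infimum is then over the empty set and
  equals \<open>\<infinity>\<close>, so a bound \<open>\<ell>\<^sub>r(X) \<le> enat k\<close> includes the existence of \<open>\<ell>\<^sub>r(X)\<close>.
\<close>

definition ap_length :: "'a::comm_ring_1 \<Rightarrow> 'a set \<Rightarrow> enat" where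
  "ap_length r X = (INF P \<in> {P. is_AP r P \<and> X \<subseteq> P}. enat (card P))"

end

(*
Over the integers, if B lies in an interval of length |B| + 2 and |A + B| <= |A| + |B| + 1, then A lies in an
interval of length |A| + 2. Deleting the maximum of B reduces this to small sets, where it is checked
by exhaustion. It carries over to Z/p whenever A misses an interval at least as long as B, since then
no sum wraps around. The pairs formed from A, B and C = -(complement of A + B) satisfy the same
hypotheses, and a difference set of two almost progressions contains a long interval. Hence in a
counterexample that minimises first |A + B| - |A| - |B| and then |A| + |B|, neither A nor B is almost a
progression for any difference, and the complement of A + B is large.

Minimality then limits how A meets its translates (by submodularity applied to the intersection and the
union of A and A + g), bounds |A| and |B| by 10, and makes every sum have two representations unless
(|A|, |B|) = (4, 5). For a direction g call x in X an end if x + g is not in X. Ends of A + B are sums of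
ends only, so A and B have at least three ends in every direction. If both have exactly three in a
common direction g, comparing the sums of all ends for g and for -g gives |A + B| = |A| + |B| - 3,
against Cauchy-Davenport. Counting representations produces such a g unless |A| = 4, |B| = 5 and A has
two equal differences. Then A is a parallelogram or contains a three-term progression, and a study of
rows in the directions involved shows that A or B is almost a progression.
*)
theory Submission
  imports Defs
begin

section \<open>Sets of integers\<close>

text \<open>Sizes (4, 4) are a true exception: A = B = {0, 1, a, a + 1} has at most 9 sums and for
  most a lies in no short progression. This shapes the proof. Every deletion must stop before (4,
  4), so the integer induction ends at (4, 5) and (5, 4), conditions 9 <= |X| + |Y| accompany all
  pairs, and at (4, 5) minimality no longer yields second representations; there the parallelogram
  has to be met directly. The ends matter because a set is its overlap with a translate plus its
  ends, for g as well as for -g. Comparing the two sums of elements turns a cardinality into a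
  multiple of g, so an identity between sums of ends becomes one between cardinalities modulo p.
  With three ends on each side and every end of A + B represented twice, that identity almost always
  holds. The number 53 enters twice: it makes the complement of A + B have at least 18 elements, and
  it exceeds 48, the largest coefficient met when the exceptional configuration of ends is excluded
  for |A + B| <= 13.\<close>

declare finite_set_plus [simp]

section \<open>Cardinalities of integer sumsets\<close>

definition width :: "int set \<Rightarrow> int" where
  "width X = Max X - Min X + 1"

text \<open>\<open>Max A + Max B\<close> has only one representation, so it is lost together with
  \<open>Max A\<close>.\<close>

lemma card_set_plus_drop_Max:
  fixes A B :: "int set"
  assumes "finite A" "finite B" "A \<noteq> {}" "B \<noteq> {}"
  shows "card (A - {Max A} + B) < card (A + B)"
proof (rule psubset_card_mono)
  show "finite (A + B)" using assms by (simp add: finite_set_plus)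
  have "Max A + Max B \<in> A + B" by (rule set_plus_intro) (use assms in auto)
  moreover have "Max A + Max B \<notin> A - {Max A} + B"
  proof
    assume "Max A + Max B \<in> A - {Max A} + B"
    then obtain x y where xy: "x \<in> A" "x \<noteq> Max A" "y \<in> B" "Max A + Max B = x + y"
      by (auto simp: set_plus_def)
    have "x \<le> Max A" "y \<le> Max B" using assms xy by auto
    then show False using xy by linarith
  qed
  moreover have "A - {Max A} + B \<subseteq> A + B" by (rule set_plus_mono2) auto
  ultimately show "A - {Max A} + B \<subset> A + B" by blast
qed

lemma card_set_plus_drop_Min:
  fixes A B :: "int set"
  assumes "finite A" "finite B" "A \<noteq> {}" "B \<noteq> {}"
  shows "card (A - {Min A} + B) < card (A + B)"
proof (rule psubset_card_mono)
  show "finite (A + B)" using assms by (simp add: finite_set_plus)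
  have "Min A + Min B \<in> A + B" by (rule set_plus_intro) (use assms in auto)
  moreover have "Min A + Min B \<notin> A - {Min A} + B"
  proof
    assume "Min A + Min B \<in> A - {Min A} + B"
    then obtain x y where xy: "x \<in> A" "x \<noteq> Min A" "y \<in> B" "Min A + Min B = x + y"
      by (auto simp: set_plus_def)
    have "Min A \<le> x" "Min B \<le> y" using assms xy by auto
    then show False using xy by linarith
  qed
  moreover have "A - {Min A} + B \<subseteq> A + B" by (rule set_plus_mono2) auto
  ultimately show "A - {Min A} + B \<subset> A + B" by blast
qed

lemma card_set_plus_int:
  fixes A B :: "int set"
  assumes "finite A" "finite B" "A \<noteq> {}" "B \<noteq> {}"
  shows "card A + card B \<le> card (A + B) + 1"
  using assms
proof (induction "card A" arbitrary: A rule: less_induct)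
  case less
  show ?case
  proof (cases "card A = 1")
    case True
    then obtain x where "A = {x}" using card_1_singletonE by blast
    then have "A + B = (+) x ` B" by (auto simp: set_plus_def)
    then show ?thesis using True by (simp add: card_image)
  next
    case False
    let ?A = "A - {Max A}"
    have c: "card ?A = card A - 1" "card A > 1" using less.prems False
      by (auto simp: Suc_lessI card_gt_0_iff)
    then have "?A \<noteq> {}" using card.empty by fastforce
    with less.hyps[of ?A] less.prems c have "card ?A + card B \<le> card (?A + B) + 1" by auto
    with card_set_plus_drop_Max[of A B] less.prems c show ?thesis by linarith
  qed
qed

text \<open>The gap separates the sums coming from the two halves of \<open>A\<close>, and each half
  pays \<open>card B - 1\<close> on its own. With at most \<open>card A + card B + 1\<close> sums
  and \<open>card B \<ge> 4\<close> this is too much, which bounds the gaps in the search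
  below.\<close>

lemma card_set_plus_gap:
  fixes A B :: "int set"
  assumes "finite A" "finite B" "B \<noteq> {}" "x \<in> A" "y \<in> A"
    and gap: "\<And>z. z \<in> A \<Longrightarrow> z \<le> x \<or> y \<le> z" and "x + width B \<le> y"
  shows "card A + 2 * card B \<le> card (A + B) + 2"
proof -
  let ?L = "{z \<in> A. z \<le> x}" and ?R = "{z \<in> A. y \<le> z}"
  have Bm: "Min B \<le> b" "b \<le> Max B" if "b \<in> B" for b using assms that by auto
  obtain b where "b \<in> B" using assms by blast
  then have "x < y" using Bm[of b] assms(7) unfolding width_def by linarith
  have A: "A = ?L \<union> ?R" using gap by auto
  have "card A = card ?L + card ?R"
    by (subst A, rule card_Un_disjoint) (use assms \<open>x < y\<close> in auto)
  moreover have "card (A + B) = card (?L + B) + card (?R + B)"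
  proof -
    have "A + B = (?L + B) \<union> (?R + B)" by (subst A) (auto simp: set_plus_def)
    moreover have "(?L + B) \<inter> (?R + B) = {}"
    proof -
      have "u + v \<noteq> u' + v'" if "u \<le> x" "y \<le> u'" "v \<in> B" "v' \<in> B" for u v u' v'
        using Bm[OF that(3)] Bm[OF that(4)] that(1,2) assms(7) unfolding width_def by linarith
      then show ?thesis by (auto simp: set_plus_def)
    qed
    ultimately show ?thesis using assms by (auto intro!: card_Un_disjoint simp: finite_set_plus)
  qed
  moreover have "card ?L + card B \<le> card (?L + B) + 1" "card ?R + card B \<le> card (?R + B) + 1"
    by (rule card_set_plus_int; use assms in auto)+
  ultimately show ?thesis by linarith
qed

section \<open>Exhaustive search for the sizes (5, 4) and (4, 5)\<close>

definition sumset_size :: "int list \<Rightarrow> int list \<Rightarrow> nat" where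
  "sumset_size xs ys = length (remdups (concat (map (\<lambda>x. map ((+) x) ys) xs)))"

lemma sumset_size: "sumset_size xs ys = card (set xs + set ys)"
proof -
  have "set (concat (map (\<lambda>x. map ((+) x) ys) xs)) = set xs + set ys"
    by (auto simp: set_plus_def)
  then show ?thesis by (simp add: sumset_size_def length_remdups_card_conv)
qed

text \<open>\<open>P\<close> lists the elements of a partial set in decreasing order. The search adds \<open>n\<close> further
  elements above, with gaps from \<open>Ds\<close>. The bound \<open>k\<close> on the sumset grows by one per element because
  each later maximum adds at least one new sum.\<close>

fun extensions_near :: "nat \<Rightarrow> int list \<Rightarrow> int list \<Rightarrow> int list \<Rightarrow> nat \<Rightarrow> int \<Rightarrow> bool" where
  "extensions_near 0 Ds B P k h = (hd P < h)"
| "extensions_near (Suc n) Ds B P k h =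
     list_all (\<lambda>d. if sumset_size ((hd P + d) # P) B \<le> k
       then extensions_near n Ds B ((hd P + d) # P) (Suc k) h else True) Ds"

text \<open>The ten lists are the 4-element sets with minimum 0 in an interval of length 6. Gaps of
  \<open>A\<close> are at most 5. Its two lowest elements have at most 10 - 3 = 7 sums, since three
  maxima follow, and the final 7 encodes a width of at most |A| + 2.\<close>

lemma near_5_4: "list_all (\<lambda>B. extensions_near 4 [1,2,3,4,5] B [0] 7 7)
  [[0,1,2,3],[0,1,2,4],[0,1,3,4],[0,2,3,4],[0,1,2,5],[0,1,3,5],[0,1,4,5],[0,2,3,5],[0,2,4,5],[0,3,4,5]]"
  by code_simp

text \<open>Fifteen 5-element sets fit into length 7, gaps are at most 6, and two elements of
  \<open>A\<close> are allowed 10 - 2 = 8 sums.\<close>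

lemma near_4_5: "list_all (\<lambda>B. extensions_near 3 [1,2,3,4,5,6] B [0] 8 6)
  [[0,1,2,3,4],[0,1,2,3,5],[0,1,2,4,5],[0,1,3,4,5],[0,2,3,4,5],
   [0,1,2,3,6],[0,1,2,4,6],[0,1,3,4,6],[0,2,3,4,6],[0,1,2,5,6],[0,1,3,5,6],[0,2,3,5,6],
   [0,1,4,5,6],[0,2,4,5,6],[0,3,4,5,6]]"
  by code_simp



text \<open>One step of the search, followed along the actual gaps of \<open>A\<close>. The
  recursion equations leave the simplifier afterwards, so that a search with symbolic gaps is not
  unfolded.\<close>

lemma extensions_nearD:
  assumes "extensions_near m Ds B P k h" "m = Suc n" "d \<in> set Ds" "sumset_size (P' # P) B \<le> k" "P' = hd P + d"
  shows "extensions_near n Ds B (P' # P) (Suc k) h"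
  using assms by (auto simp: list_all_iff split: if_splits)

declare extensions_near.simps [simp del]

lemma set_plus_translate:
  fixes X Y :: "'a::ab_group_add set"
  shows "(+) u ` X + (+) v ` Y = (+) (u + v) ` (X + Y)"
proof -
  have "\<exists>x\<in>X. \<exists>y\<in>Y. u + x' + (v + y') = u + v + (x + y)" if "x' \<in> X" "y' \<in> Y" for x' y'
    using that by (intro bexI[of _ x'] bexI[of _ y']) (auto simp: algebra_simps)
  moreover have "\<exists>x'\<in>X. \<exists>y'\<in>Y. u + v + (x + y) = u + x' + (v + y')" if "x \<in> X" "y \<in> Y" for x y
    using that by (intro bexI[of _ x] bexI[of _ y]) (auto simp: algebra_simps)
  ultimately show ?thesis by (auto simp: set_plus_def image_iff)
qed

lemma card_set_plus_translate:
  fixes X Y :: "'a::ab_group_add set"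
  shows "card ((+) u ` X + (+) v ` Y) = card (X + Y)"
  by (simp add: set_plus_translate card_image)

lemma card_set_plus_insert_above:
  fixes A B :: "int set"
  assumes "finite A" "finite B" "B \<noteq> {}" "\<And>y. y \<in> A \<Longrightarrow> y < x"
  shows "card (A + B) < card (insert x A + B)"
proof -
  have "Max (insert x A) = x" using assms by (intro Max_eqI) (auto intro: less_imp_le)
  moreover have "insert x A - {x} = A" using assms by auto
  ultimately show ?thesis using card_set_plus_drop_Max[of "insert x A" B] assms by auto
qed

lemma sorted_list_of_int_set:
  assumes "finite (A :: int set)" "card A = n"
  obtains xs where "sorted_wrt (<) xs" "set xs = A" "length xs = n"
  using assms by (metis length_sorted_list_of_set set_sorted_list_of_set strict_sorted_list_of_set)

lemma int_set_4:
  assumes "finite (A :: int set)" "card A = 4"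
  obtains x0 x1 x2 x3 where "A = {x0,x1,x2,x3}" "x0 < x1" "x1 < x2" "x2 < x3"
proof -
  obtain xs where "sorted_wrt (<) xs" "set xs = A" "length xs = 4"
    using sorted_list_of_int_set[OF assms] .
  then show ?thesis using that by (auto simp: length_Suc_conv numeral_eq_Suc)
qed

lemma int_set_5:
  assumes "finite (A :: int set)" "card A = 5"
  obtains x0 x1 x2 x3 x4 where "A = {x0,x1,x2,x3,x4}" "x0 < x1" "x1 < x2" "x2 < x3" "x3 < x4"
proof -
  obtain xs where "sorted_wrt (<) xs" "set xs = A" "length xs = 5"
    using sorted_list_of_int_set[OF assms] .
  then show ?thesis using that by (auto simp: length_Suc_conv numeral_eq_Suc)
qed

lemma width_4: "x0 < x1 \<Longrightarrow> x1 < x2 \<Longrightarrow> x2 < x3 \<Longrightarrow> width {x0,x1,x2,x3} = x3 - x0 + 1"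
  by (simp add: width_def)

lemma width_5:
  "x0 < x1 \<Longrightarrow> x1 < x2 \<Longrightarrow> x2 < x3 \<Longrightarrow> x3 < x4 \<Longrightarrow> width {x0,x1,x2,x3,x4} = x4 - x0 + 1"
  by (simp add: width_def)

lemma width_translate: "finite X \<Longrightarrow> X \<noteq> {} \<Longrightarrow> width ((+) u ` X) = width X"
proof -
  assume X: "finite X" "X \<noteq> {}"
  have "mono ((+) u)" by (auto simp: mono_def)
  with X show ?thesis by (simp add: width_def mono_Max_commute[symmetric] mono_Min_commute[symmetric])
qed

lemma four_subset_width_6:
  fixes e1 e2 e3 :: int
  assumes "0 < e1" "e1 < e2" "e2 < e3" "e3 \<le> 5"
  shows "(e1,e2,e3) \<in> {(1,2,3),(1,2,4),(1,3,4),(2,3,4),(1,2,5),(1,3,5),(1,4,5),(2,3,5),(2,4,5),(3,4,5)}"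
proof -
  have "e1 \<in> {1,2,3}" "e2 \<in> {2,3,4}" "e3 \<in> {3,4,5}" using assms by auto
  then show ?thesis using assms by (elim insertE emptyE; simp)
qed


lemma five_subset_width_7:
  fixes e1 e2 e3 e4 :: int
  assumes "0 < e1" "e1 < e2" "e2 < e3" "e3 < e4" "e4 \<le> 6"
  shows "(e1,e2,e3,e4) \<in> {(1,2,3,4),(1,2,3,5),(1,2,4,5),(1,3,4,5),(2,3,4,5),
    (1,2,3,6),(1,2,4,6),(1,3,4,6),(2,3,4,6),(1,2,5,6),(1,3,5,6),(2,3,5,6),(1,4,5,6),(2,4,5,6),(3,4,5,6)}"
proof (cases "e4 \<le> 5")
  case True
  with assms have "e1 \<in> {1,2}" "e2 \<in> {2,3}" "e3 \<in> {3,4}" "e4 \<in> {4,5}" by auto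
  then show ?thesis using assms by (elim insertE emptyE; simp)
next
  case False
  then have "e4 = 6" using assms by linarith
  then have "(e1,e2,e3) \<in> {(1,2,3),(1,2,4),(1,3,4),(2,3,4),(1,2,5),(1,3,5),(1,4,5),(2,3,5),(2,4,5),(3,4,5)}"
    using assms by (intro four_subset_width_6) auto
  with \<open>e4 = 6\<close> show ?thesis by (elim insertE emptyE; simp)
qed

lemma width_le_5_4:
  fixes A B :: "int set"
  assumes "finite A" "finite B" "card A = 5" "card B = 4" "width B \<le> 6" "card (A + B) \<le> 10"
  shows "width A \<le> 7"
proof -
  obtain x0 x1 x2 x3 x4 where A: "A = {x0,x1,x2,x3,x4}" "x0 < x1" "x1 < x2" "x2 < x3" "x3 < x4"
    using int_set_5 assms by metis
  obtain y0 y1 y2 y3 where B: "B = {y0,y1,y2,y3}" "y0 < y1" "y1 < y2" "y2 < y3"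
    using int_set_4 assms by metis
  have fB: "finite B" "B \<noteq> {}" using B by auto
  have wB: "y3 - y0 \<le> 5" using assms(5) B by (simp add: width_4)
  have gap: "x' < x + 6" if "x \<in> A" "x' \<in> A" "\<And>z. z \<in> A \<Longrightarrow> z \<le> x \<or> x' \<le> z" for x x'
  proof (rule ccontr)
    assume "\<not> x' < x + 6"
    then have "x + width B \<le> x'" using assms by linarith
    from card_set_plus_gap[OF assms(1) fB that(1,2,3) this] show False using assms by linarith
  qed
  have g: "x1 < x0 + 6" "x2 < x1 + 6" "x3 < x2 + 6" "x4 < x3 + 6"
    using A by (intro gap; auto)+
  define e where "e = [0, y1 - y0, y2 - y0, y3 - y0]"
  have e: "B = (+) y0 ` set e" by (auto simp: e_def B)
  have "(y1 - y0, y2 - y0, y3 - y0) \<in>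
      {(1,2,3),(1,2,4),(1,3,4),(2,3,4),(1,2,5),(1,3,5),(1,4,5),(2,3,5),(2,4,5),(3,4,5)}"
    using B wB by (intro four_subset_width_6) auto
  then have ein: "extensions_near 4 [1,2,3,4,5] e [0] 7 7"
    using near_5_4 unfolding e_def list.pred_inject
    by (elim insertE emptyE) (simp_all only: prod.inject simp_thms)
  let ?P1 = "{x0,x1}" and ?P2 = "{x0,x1,x2}" and ?P3 = "{x0,x1,x2,x3}"
  \<comment> \<open>Each new maximum adds a sum, so the bound 10 for \<open>A\<close> becomes 9, 8
    and 7 for its initial parts, exactly the values tested by the search.\<close>
  have c: "card (?P3 + B) < card (A + B)" "card (?P2 + B) < card (?P3 + B)" "card (?P1 + B) < card (?P2 + B)"
  proof -
    have "A = insert x4 ?P3" "?P3 = insert x3 ?P2" "?P2 = insert x2 ?P1" using A by auto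
    then show "card (?P3 + B) < card (A + B)" "card (?P2 + B) < card (?P3 + B)" "card (?P1 + B) < card (?P2 + B)"
      using A by (auto intro!: card_set_plus_insert_above fB)
  qed
  have s: "sumset_size P e = card (X + B)" if "X = (+) x0 ` set P" for P X
    unfolding e that by (simp add: card_set_plus_translate sumset_size)
  define d1 d2 d3 d4 where d: "d1 = x1 - x0" "d2 = x2 - x1" "d3 = x3 - x2" "d4 = x4 - x3"
  have dd: "d1 \<in> set [1,2,3,4,5]" "d2 \<in> set [1,2,3,4,5]" "d3 \<in> set [1,2,3,4,5]" "d4 \<in> set [1,2,3,4,5]"
    using A g unfolding d by auto
  have "sumset_size [d1, 0] e \<le> 7"
    by (subst s[of ?P1]) (use c assms in \<open>auto simp: d A insert_commute\<close>)
  then have E3: "extensions_near 3 [1,2,3,4,5] e [d1, 0] 8 7"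
    using extensions_nearD[OF ein _ dd(1)] by (simp add: d)
  have "sumset_size [d1 + d2, d1, 0] e \<le> 8"
    by (subst s[of ?P2]) (use c assms in \<open>auto simp: d A insert_commute\<close>)
  then have E2: "extensions_near 2 [1,2,3,4,5] e [d1 + d2, d1, 0] 9 7"
    using extensions_nearD[OF E3 _ dd(2)] by (simp add: d)
  have "sumset_size [d1 + d2 + d3, d1 + d2, d1, 0] e \<le> 9"
    by (subst s[of ?P3]) (use c assms in \<open>auto simp: d A insert_commute\<close>)
  then have E1: "extensions_near 1 [1,2,3,4,5] e [d1 + d2 + d3, d1 + d2, d1, 0] 10 7"
    using extensions_nearD[OF E2 _ dd(3)] by (simp add: d)
  have "sumset_size [d1 + d2 + d3 + d4, d1 + d2 + d3, d1 + d2, d1, 0] e \<le> 10"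
    by (subst s[of A]) (use c assms in \<open>auto simp: d A insert_commute\<close>)
  then have E0: "extensions_near 0 [1,2,3,4,5] e [d1 + d2 + d3 + d4, d1 + d2 + d3, d1 + d2, d1, 0] 11 7"
    using extensions_nearD[OF E1 _ dd(4)] by (simp add: d)
  then show ?thesis using A by (simp add: width_5 d extensions_near.simps)
qed

lemma width_le_4_5:
  fixes A B :: "int set"
  assumes "finite A" "finite B" "card A = 4" "card B = 5" "width B \<le> 7" "card (A + B) \<le> 10"
  shows "width A \<le> 6"
proof -
  obtain x0 x1 x2 x3 where A: "A = {x0,x1,x2,x3}" "x0 < x1" "x1 < x2" "x2 < x3"
    using int_set_4 assms by metis
  obtain y0 y1 y2 y3 y4 where B: "B = {y0,y1,y2,y3,y4}" "y0 < y1" "y1 < y2" "y2 < y3" "y3 < y4"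
    using int_set_5 assms by metis
  have fB: "finite B" "B \<noteq> {}" using B by auto
  have wB: "y4 - y0 \<le> 6" using assms(5) B by (simp add: width_5)
  have gap: "x' < x + 7" if "x \<in> A" "x' \<in> A" "\<And>z. z \<in> A \<Longrightarrow> z \<le> x \<or> x' \<le> z" for x x'
  proof (rule ccontr)
    assume "\<not> x' < x + 7"
    then have "x + width B \<le> x'" using assms by linarith
    from card_set_plus_gap[OF assms(1) fB that(1,2,3) this] show False using assms by linarith
  qed
  have g: "x1 < x0 + 7" "x2 < x1 + 7" "x3 < x2 + 7"
    using A by (intro gap; auto)+
  define e where "e = [0, y1 - y0, y2 - y0, y3 - y0, y4 - y0]"
  have e: "B = (+) y0 ` set e" by (auto simp: e_def B)
  have "(y1 - y0, y2 - y0, y3 - y0, y4 - y0) \<in>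
      {(1,2,3,4),(1,2,3,5),(1,2,4,5),(1,3,4,5),(2,3,4,5),
       (1,2,3,6),(1,2,4,6),(1,3,4,6),(2,3,4,6),(1,2,5,6),(1,3,5,6),(2,3,5,6),(1,4,5,6),(2,4,5,6),(3,4,5,6)}"
    using B wB by (intro five_subset_width_7) auto
  then have ein: "extensions_near 3 [1,2,3,4,5,6] e [0] 8 6"
    using near_4_5 unfolding e_def list.pred_inject
    by (elim insertE emptyE) (simp_all only: prod.inject simp_thms)
  let ?P1 = "{x0,x1}" and ?P2 = "{x0,x1,x2}"
  have c: "card (?P2 + B) < card (A + B)" "card (?P1 + B) < card (?P2 + B)"
  proof -
    have "A = insert x3 ?P2" "?P2 = insert x2 ?P1" using A by auto
    then show "card (?P2 + B) < card (A + B)" "card (?P1 + B) < card (?P2 + B)"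
      using A by (auto intro!: card_set_plus_insert_above fB)
  qed
  have s: "sumset_size P e = card (X + B)" if "X = (+) x0 ` set P" for P X
    unfolding e that by (simp add: card_set_plus_translate sumset_size)
  define d1 d2 d3 where d: "d1 = x1 - x0" "d2 = x2 - x1" "d3 = x3 - x2"
  have dd: "d1 \<in> set [1,2,3,4,5,6]" "d2 \<in> set [1,2,3,4,5,6]" "d3 \<in> set [1,2,3,4,5,6]"
    using A g unfolding d by auto
  have "sumset_size [d1, 0] e \<le> 8"
    by (subst s[of ?P1]) (use c assms in \<open>auto simp: d A insert_commute\<close>)
  then have E2: "extensions_near 2 [1,2,3,4,5,6] e [d1, 0] 9 6"
    using extensions_nearD[OF ein _ dd(1)] by (simp add: d)
  have "sumset_size [d1 + d2, d1, 0] e \<le> 9"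
    by (subst s[of ?P2]) (use c assms in \<open>auto simp: d A insert_commute\<close>)
  then have E1: "extensions_near 1 [1,2,3,4,5,6] e [d1 + d2, d1, 0] 10 6"
    using extensions_nearD[OF E2 _ dd(2)] by (simp add: d)
  have "sumset_size [d1 + d2 + d3, d1 + d2, d1, 0] e \<le> 10"
    by (subst s[of A]) (use c assms in \<open>auto simp: d A insert_commute\<close>)
  then have E0: "extensions_near 0 [1,2,3,4,5,6] e [d1 + d2 + d3, d1 + d2, d1, 0] 11 6"
    using extensions_nearD[OF E1 _ dd(3)] by (simp add: d)
  then show ?thesis using A by (simp add: width_4 d extensions_near.simps)
qed



section \<open>The induction over the integers\<close>

text \<open>Four elements of \<open>B\<close> within length 6 have gaps at most 3, so a run of at
  least four elements of \<open>A\<close> fills everything from \<open>m2\<close> to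
  \<open>M2 + e3\<close>. The sums \<open>0 + B\<close> below and \<open>M + B\<close> above this
  interval contribute at least \<open>8 - e3\<close> more.\<close>

lemma card_plus_interval_with_ends:
  fixes A :: "int set"
  assumes e: "0 < e1" "e1 < e2" "e2 < e3" "e3 \<le> 5" and B: "B = {0,e1,e2,e3}"
    and A: "0 \<in> A" "M \<in> A" "{m2..M2} \<subseteq> A" "finite A" and "m2 + 3 \<le> M2"
    and c: "(m2, M - M2) \<in> {(2,3),(3,2),(3,3)}"
  shows "M2 - m2 + 9 \<le> int (card (A + B))"
proof -
  let ?X = "{y \<in> B. y < m2}" and ?Y = "{y \<in> B. e3 < y + (M - M2)}"
  have "?X \<union> {m2..M2 + e3} \<union> (+) M ` ?Y \<subseteq> A + B"
  proof (intro Un_least subsetI)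
    fix v assume "v \<in> {m2..M2 + e3}"
    then have "v - 0 \<in> {m2..M2} \<or> v - e1 \<in> {m2..M2} \<or> v - e2 \<in> {m2..M2} \<or> v - e3 \<in> {m2..M2}"
      using e \<open>m2 + 3 \<le> M2\<close> unfolding atLeastAtMost_iff by linarith
    then obtain y where "y \<in> B" "v - y \<in> A" using A B by blast
    then have "(v - y) + y \<in> A + B" by blast
    then show "v \<in> A + B" by simp
  next
    fix v assume "v \<in> ?X"
    then have "0 + v \<in> A + B" using A by blast
    then show "v \<in> A + B" by simp
  next
    fix v assume "v \<in> (+) M ` ?Y"
    then show "v \<in> A + B" using A by blast
  qed
  then have "card (?X \<union> {m2..M2 + e3} \<union> (+) M ` ?Y) \<le> card (A + B)"
    using A B by (intro card_mono) (auto simp: finite_set_plus)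
  moreover have "card (?X \<union> {m2..M2 + e3} \<union> (+) M ` ?Y) = card (?X \<union> {m2..M2 + e3}) + card ((+) M ` ?Y)"
  proof (intro card_Un_disjoint)
    have "m2 < M" "M2 < M" using c \<open>m2 + 3 \<le> M2\<close> by auto
    then show "(?X \<union> {m2..M2 + e3}) \<inter> (+) M ` ?Y = {}" using B e by auto
  qed (use B in auto)
  moreover have "card (?X \<union> {m2..M2 + e3}) = card ?X + card {m2..M2 + e3}"
    using B e by (intro card_Un_disjoint) auto
  ultimately have *: "int (card ?X) + (M2 + e3 - m2 + 1) + int (card ?Y) \<le> int (card (A + B))"
    using e \<open>m2 + 3 \<le> M2\<close> by (auto simp: card_image)
  have P: "int (card {y \<in> B. P y}) =
      (if P 0 then 1 else 0) + (if P e1 then 1 else 0) + (if P e2 then 1 else 0) + (if P e3 then 1 else 0)" for P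
  proof -
    have "card {y \<in> B. P y} = (\<Sum>y\<in>B. if P y then 1 else 0)"
      using B by (simp add: sum.If_cases Int_def conj_commute)
    then show ?thesis using e by (simp add: B)
  qed
  have "8 - e3 \<le> int (card ?X) + int (card ?Y)"
    unfolding P using e c by auto
  with * show ?thesis by linarith
qed

text \<open>Every point missing from the sumset is near one of its ends, whatever the position of \<open>h\<close>.\<close>

lemma card_plus_interval_with_three_holes:
  fixes A :: "int set"
  assumes e: "0 < e1" "e1 < e2" "e2 < e3" "e3 \<le> 5" and B: "B = {0,e1,e2,e3}"
    and A: "A = insert 0 (insert (a+2) ({2..a} - {h}))" and h: "2 < h" "h < a" "6 \<le> a"
  shows "a + 6 \<le> int (card (A + B))"
proof -
  have in_A: "x \<in> A \<longleftrightarrow> x = 0 \<or> x = a + 2 \<or> (2 \<le> x \<and> x \<le> a \<and> x \<noteq> h)" for x using A by auto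
  have notin: "v \<notin> A \<and> v - e1 \<notin> A \<and> v - e2 \<notin> A \<and> v - e3 \<notin> A" if "v \<notin> A + B" for v
  proof -
    have "v - y \<notin> A" if "y \<in> B" for y
      using set_plus_intro[of "v - y" A y B] that \<open>v \<notin> A + B\<close> by auto
    from this[of 0] this[of e1] this[of e2] this[of e3] show ?thesis by (auto simp: B)
  qed
  \<comment> \<open>The interval has \<open>a + 3 + e3\<close> points, so \<open>e3 - 3\<close>
    missing ones can be afforded.\<close>
  have *: ?thesis if D: "{0..a+2+e3} - (A + B) \<subseteq> D" "finite D" "int (card D) + 3 \<le> e3" for D
  proof -
    have "{0..a+2+e3} \<subseteq> (A + B) \<union> D" using D by auto
    then have "card {0..a+2+e3} \<le> card ((A + B) \<union> D)"
      using A B D by (intro card_mono) (auto simp: finite_set_plus)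
    also have "\<dots> \<le> card (A + B) + card D" by (rule card_Un_le)
    finally show ?thesis using D e h by simp
  qed
  show ?thesis
    using four_subset_width_6[OF e]
  proof (elim insertE emptyE; simp only: prod.inject; elim conjE)
    assume E: "e1 = 1" "e2 = 2" "e3 = 3"
    have "False" if "0 \<le> v" "v \<le> a + 2 + e3" "v \<notin> A + B" for v
      using notin[OF that(3)] that(1,2) h unfolding in_A E by (smt (z3))
    then have "{0..a+2+e3} - (A + B) \<subseteq> {}" by fastforce
    then show ?thesis by (rule *) (auto simp: E card_insert_if)
  next
    assume E: "e1 = 1" "e2 = 2" "e3 = 4"
    have "v = a + 5" if "0 \<le> v" "v \<le> a + 2 + e3" "v \<notin> A + B" for v
      using notin[OF that(3)] that(1,2) h unfolding in_A E by (smt (z3))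
    then have "{0..a+2+e3} - (A + B) \<subseteq> {a + 5}" by fastforce
    then show ?thesis by (rule *) (auto simp: E card_insert_if)
  next
    assume E: "e1 = 1" "e2 = 3" "e3 = 4"
    have "False" if "0 \<le> v" "v \<le> a + 2 + e3" "v \<notin> A + B" for v
      using notin[OF that(3)] that(1,2) h unfolding in_A E by (smt (z3))
    then have "{0..a+2+e3} - (A + B) \<subseteq> {}" by fastforce
    then show ?thesis by (rule *) (auto simp: E card_insert_if)
  next
    assume E: "e1 = 2" "e2 = 3" "e3 = 4"
    have "v = 1" if "0 \<le> v" "v \<le> a + 2 + e3" "v \<notin> A + B" for v
      using notin[OF that(3)] that(1,2) h unfolding in_A E by (smt (z3))
    then have "{0..a+2+e3} - (A + B) \<subseteq> {1}" by fastforce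
    then show ?thesis by (rule *) (auto simp: E card_insert_if)
  next
    assume E: "e1 = 1" "e2 = 2" "e3 = 5"
    have "v = a + 6" if "0 \<le> v" "v \<le> a + 2 + e3" "v \<notin> A + B" for v
      using notin[OF that(3)] that(1,2) h unfolding in_A E by (smt (z3))
    then have "{0..a+2+e3} - (A + B) \<subseteq> {a + 6}" by fastforce
    then show ?thesis by (rule *) (auto simp: E card_insert_if)
  next
    assume E: "e1 = 1" "e2 = 3" "e3 = 5"
    have "v = a + 6 \<or> v = a + 4" if "0 \<le> v" "v \<le> a + 2 + e3" "v \<notin> A + B" for v
      using notin[OF that(3)] that(1,2) h unfolding in_A E by (smt (z3))
    then have "{0..a+2+e3} - (A + B) \<subseteq> {a + 6,a + 4}" by fastforce
    then show ?thesis by (rule *) (auto simp: E card_insert_if)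
  next
    assume E: "e1 = 1" "e2 = 4" "e3 = 5"
    have "False" if "0 \<le> v" "v \<le> a + 2 + e3" "v \<notin> A + B" for v
      using notin[OF that(3)] that(1,2) h unfolding in_A E by (smt (z3))
    then have "{0..a+2+e3} - (A + B) \<subseteq> {}" by fastforce
    then show ?thesis by (rule *) (auto simp: E card_insert_if)
  next
    assume E: "e1 = 2" "e2 = 3" "e3 = 5"
    have "v = 1 \<or> v = a + 6" if "0 \<le> v" "v \<le> a + 2 + e3" "v \<notin> A + B" for v
      using notin[OF that(3)] that(1,2) h unfolding in_A E by (smt (z3))
    then have "{0..a+2+e3} - (A + B) \<subseteq> {1,a + 6}" by fastforce
    then show ?thesis by (rule *) (auto simp: E card_insert_if)
  next
    assume E: "e1 = 2" "e2 = 4" "e3 = 5"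
    have "v = 1 \<or> v = 3" if "0 \<le> v" "v \<le> a + 2 + e3" "v \<notin> A + B" for v
      using notin[OF that(3)] that(1,2) h unfolding in_A E by (smt (z3))
    then have "{0..a+2+e3} - (A + B) \<subseteq> {1,3}" by fastforce
    then show ?thesis by (rule *) (auto simp: E card_insert_if)
  next
    assume E: "e1 = 3" "e2 = 4" "e3 = 5"
    have "v = 1" if "0 \<le> v" "v \<le> a + 2 + e3" "v \<notin> A + B" for v
      using notin[OF that(3)] that(1,2) h unfolding in_A E by (smt (z3))
    then have "{0..a+2+e3} - (A + B) \<subseteq> {1}" by fastforce
    then show ?thesis by (rule *) (auto simp: E card_insert_if)
  qed
qed


text \<open>Suppose that \<open>A\<close> is too wide, but not after losing either end. Then its
  interior \<open>I\<close> stays at distance at least 2 from both ends and is an interval or an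
  interval with one hole. The two preceding lemmas give \<open>card A + 6\<close> sums in these
  cases.\<close>

lemma width_le_step:
  fixes A :: "int set"
  assumes fA: "finite A" and cA: "6 \<le> card A" and "Min A = 0"
    and e: "0 < e1" "e1 < e2" "e2 < e3" "e3 \<le> 5" and B: "B = {0,e1,e2,e3}"
    and AB: "card (A + B) \<le> card A + 5"
    and w1: "width (A - {Max A}) \<le> int (card A) + 1" and w2: "width (A - {Min A}) \<le> int (card A) + 1"
  shows "width A \<le> int (card A) + 2"
proof (rule ccontr)
  assume nw: "\<not> ?thesis"
  define M where "M = Max A"
  define I where "I = A - {0, M}"
  define m2 where "m2 = Min I"
  define M2 where "M2 = Max I"
  have ne: "A \<noteq> {}" using cA by auto
  have A0: "0 \<in> A" "M \<in> A" using Min_in[OF fA ne] Max_in[OF fA ne] \<open>Min A = 0\<close> by (simp_all add: M_def)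
  have A_bd: "0 \<le> x \<and> x \<le> M" if "x \<in> A" for x
    using Min_le[OF fA that] Max_ge[OF fA that] \<open>Min A = 0\<close> by (simp add: M_def)
  have M: "int (card A) + 2 \<le> M" using nw \<open>Min A = 0\<close> by (simp add: width_def M_def)
  have cI: "card I = card A - 2" unfolding I_def using A0 M fA by (subst card_Diff_subset) auto
  have fI: "finite I" using fA by (simp add: I_def)
  have nI: "I \<noteq> {}" using cA cI by fastforce
  have I: "m2 \<in> I" "M2 \<in> I" "\<And>x. x \<in> I \<Longrightarrow> m2 \<le> x \<and> x \<le> M2"
    using fI nI by (auto simp: m2_def M2_def)
  have AI: "A - {M} = insert 0 I" "A - {0} = insert M I" using A0 M by (auto simp: I_def)
  have bd: "0 \<le> M2" "0 \<le> m2" "M2 \<le> M" "m2 \<le> M" using I A0 A_bd by (auto simp: I_def)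
  have "Max (insert 0 I) = M2" "Min (insert 0 I) = 0" "Max (insert M I) = M" "Min (insert M I) = m2"
    using fI nI bd M cA by (simp_all add: m2_def[symmetric] M2_def[symmetric])
  then have "width (A - {M}) = M2 + 1" "width (A - {0}) = M - m2 + 1"
    by (simp_all add: width_def AI)
  then have W: "M2 \<le> int (card A)" "M - m2 \<le> int (card A)"
    using w1 w2 by (simp_all add: \<open>Min A = 0\<close> M_def[symmetric])
  have IS: "I \<subseteq> {m2..M2}" using I by auto
  have "m2 \<le> M2" using I by auto
  have "card I \<le> card {m2..M2}" by (rule card_mono) (use IS in auto)
  then have L: "int (card A) - 3 \<le> M2 - m2" using cI cA by simp
  show False
  proof (cases "M2 - m2 = int (card A) - 3")
    case True
    then have "I = {m2..M2}" using IS cI cA by (intro card_subset_eq) auto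
    then have sub: "{m2..M2} \<subseteq> A" by (auto simp: I_def)
    \<comment> \<open>Both numbers are 2 or 3, and (2, 2) would make \<open>A\<close> narrow
      enough.\<close>
    have "(m2, M - M2) \<in> {(2,3),(3,2),(3,3)}" using True W M by auto
    moreover have "m2 + 3 \<le> M2" using True cA by linarith
    ultimately have "M2 - m2 + 9 \<le> int (card (A + B))"
      using card_plus_interval_with_ends[OF e B A0(1,2) sub fA] by blast
    with True AB cA show False by linarith
  next
    case False
    then have eq: "m2 = 2" "M2 = int (card A)" "M = int (card A) + 2" using L W M by linarith+
    have "card ({m2..M2} - I) = 1" using IS fI cI cA eq by (subst card_Diff_subset) auto
    then obtain h where h: "{m2..M2} - I = {h}" by (auto simp: card_1_singleton_iff)
    have hI: "h \<notin> I" "m2 \<le> h" "h \<le> M2" using h by auto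
    then have hb: "2 < h" "h < int (card A)" using I(1,2) eq by (auto simp: order.strict_iff_order)
    have "I = {m2..M2} - {h}" using h IS by blast
    have "A = insert 0 (insert M I)" using A0 by (auto simp: I_def)
    then have A': "A = insert 0 (insert M ({m2..M2} - {h}))" unfolding \<open>I = {m2..M2} - {h}\<close> .
    note card_plus_interval_with_three_holes[OF e B A'[unfolded eq] hb]
    then have "int (card A) + 6 \<le> int (card (A + B))" using cA by simp
    then show False using AB by linarith
  qed
qed

lemma width_remove_Max:
  assumes "finite X" "2 \<le> card X"
  shows "width (X - {Max X}) \<le> width X - 1"
proof -
  have "X - {Max X} \<noteq> {}" using assms by (metis card_1_singletonE card_Diff_singleton card_eq_0_iff Max_in
      One_nat_def Suc_1 Suc_le_lessD diff_is_0_eq' diff_0_eq_0 finite.emptyI less_one not_less not_less_eq_eq card.empty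
      le_zero_eq zero_less_diff)
  then have "Max (X - {Max X}) < Max X" "Min X \<le> Min (X - {Max X})"
    using assms(1) Max_in[of "X - {Max X}"] Min_in[of "X - {Max X}"] by (auto simp: order.strict_iff_order)
  then show ?thesis by (simp add: width_def)
qed

text \<open>If \<open>card B \<ge> 5\<close>, removing the maximum of \<open>B\<close> keeps its
  width in proportion. If \<open>card B = 4\<close>, \<open>B\<close> cannot shrink further; instead
  \<open>A\<close> loses either of its ends, and \<open>width_le_step\<close> combines the two
  results.\<close>

theorem width_le_of_small_sumset:
  fixes A B :: "int set"
  assumes "finite A" "finite B" "4 \<le> card A" "4 \<le> card B" "9 \<le> card A + card B"
    and "width B \<le> int (card B) + 2" "card (A + B) \<le> card A + card B + 1"
  shows "width A \<le> int (card A) + 2"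
  using assms
proof (induction "card A + card B" arbitrary: A B rule: less_induct)
  case less
  have ne: "A \<noteq> {}" "B \<noteq> {}" using less.prems by auto
  consider "card A = 4" "card B = 5" | "card A = 5" "card B = 4"
    | "5 \<le> card B" "10 \<le> card A + card B" | "card B = 4" "6 \<le> card A"
    using less.prems by linarith
  then show ?case
  proof cases
    case 1
    then show ?thesis using width_le_4_5[of A B] less.prems by simp
  next
    case 2
    then show ?thesis using width_le_5_4[of A B] less.prems by simp
  next
    case 3
    let ?B = "B - {Max B}"
    have c: "card ?B = card B - 1" using less.prems ne by simp
    moreover have "width ?B \<le> width B - 1" using less.prems 3 by (intro width_remove_Max) auto
    moreover have "card (A + ?B) < card (A + B)"
      using card_set_plus_drop_Max[of B A] less.prems ne by (simp add: add.commute)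
    ultimately show ?thesis using less.prems 3 by (intro less.hyps[of A ?B]) auto
  next
    case 4
    obtain y0 y1 y2 y3 where B: "B = {y0,y1,y2,y3}" "y0 < y1" "y1 < y2" "y2 < y3"
      using int_set_4 4 less.prems by metis
    have wB: "y3 - y0 \<le> 5" using less.prems 4 B by (simp add: width_4)
    define B' where "B' = {0, y1 - y0, y2 - y0, y3 - y0}"
    define A' where "A' = (+) (- Min A) ` A"
    have cA: "card A' = card A" and fA: "finite A'" "A' \<noteq> {}" using less.prems ne by (auto simp: A'_def card_image)
    have B': "B' = (+) (- y0) ` B" by (auto simp: B'_def B)
    have "width B' = width B" unfolding B' using less.prems ne by (intro width_translate)
    then have cB: "card B' = 4" "width B' = width B"
      using 4 unfolding B' by (simp_all add: card_image)
    have wA: "width A' = width A" unfolding A'_def using less.prems ne by (intro width_translate)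
    have m0: "Min A' = 0"
    proof (rule Min_eqI)
      show "0 \<in> A'" unfolding A'_def by (rule image_eqI[of _ _ "Min A"]) (use less.prems(1) ne Min_in in \<open>simp_all only: left_minus\<close>)
      show "0 \<le> x" if x: "x \<in> A'" for x
      proof -
        obtain y where "y \<in> A" "x = - Min A + y" using x unfolding A'_def by blast
        then show ?thesis using less.prems(1) by simp
      qed
    qed (use fA in simp)
    have AB: "card (A' + B') = card (A + B)" unfolding A'_def B' card_set_plus_translate ..
    have "width (A' - {Max A'}) \<le> int (card A') + 1" "width (A' - {Min A'}) \<le> int (card A') + 1"
    proof -
      have c: "card (A' - {Max A'}) = card A' - 1" "card (A' - {Min A'}) = card A' - 1" using fA by simp_all
      have "finite B'" "B' \<noteq> {}" by (auto simp: B'_def)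
      then have d: "card (A' - {Max A'} + B') < card (A' + B')" "card (A' - {Min A'} + B') < card (A' + B')"
        using card_set_plus_drop_Max[of A' B'] card_set_plus_drop_Min[of A' B'] fA by auto
      have *: "width X \<le> int (card X) + 2" if X: "finite X" "card X = card A' - 1" "card (X + B') < card (A' + B')" for X
      proof (rule less.hyps[of X B'])
        show "card X + card B' < card A + card B" "4 \<le> card X" "4 \<le> card B'" "9 \<le> card X + card B'"
          using X(2) cA cB 4 by simp_all
        show "width B' \<le> int (card B') + 2" using cB less.prems(6) 4 by simp
        show "card (X + B') \<le> card X + card B' + 1" using X cA cB 4 AB less.prems(7) by simp
      qed fact+
      have "width (A' - {Max A'}) \<le> int (card (A' - {Max A'})) + 2"
        by (rule *[OF _ c(1) d(1)]) (use fA in simp)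
      moreover have "width (A' - {Min A'}) \<le> int (card (A' - {Min A'})) + 2"
        by (rule *[OF _ c(2) d(2)]) (use fA in simp)
      ultimately show "width (A' - {Max A'}) \<le> int (card A') + 1" "width (A' - {Min A'}) \<le> int (card A') + 1"
        using c 4 cA by linarith+
    qed
    then have "width A' \<le> int (card A') + 2"
      using 4 less.prems B wB by (intro width_le_step[OF fA(1) _ m0 _ _ _ _ B'_def]) (auto simp: AB cA)
    then show ?thesis using wA cA by simp
  qed
qed


section \<open>Runs in difference sets of almost intervals\<close>

lemma three_not_subset_of_card_2: "finite H \<Longrightarrow> card H \<le> 2 \<Longrightarrow> i \<in> H \<Longrightarrow> j \<in> H \<Longrightarrow> k \<in> H \<Longrightarrow> i \<noteq> j \<Longrightarrow> j \<noteq> k \<Longrightarrow> i \<noteq> k \<Longrightarrow> False"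
  using card_mono[of H "{i,j,k}"] by auto

text \<open>For \<open>W \<ge> 6\<close> each of the triples 0, 1, 2 and 3, 4, 5 contains a hole,
  and there are at most two holes, so the beginning of \<open>V\<close> is nearly determined. The
  last pattern carries \<open>card V = 4\<close> because it is useful only when this forces
  \<open>card B \<ge> 5\<close>.\<close>

lemma almost_interval_pattern:
  fixes V :: "int set"
  assumes V: "V \<subseteq> {0..<W}" "0 \<in> V" "W - 1 \<in> V" "W \<le> int (card V) + 2" "4 \<le> card V"
    and no3: "\<And>v. v \<in> V \<Longrightarrow> v + 1 \<in> V \<Longrightarrow> v + 2 \<in> V \<Longrightarrow> False"
  shows "{0,1,3,4} \<subseteq> V \<or> {0,1,3,5} \<subseteq> V \<or> {0,2,3,5} \<subseteq> V \<or> {0,2,4,5} \<subseteq> V \<or> ({0,1,4,5} \<subseteq> V \<and> card V = 4)"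
proof -
  define H where "H = {0..<W} - V"
  have fV: "finite V" using V(1) finite_subset by blast
  have cV: "int (card V) \<le> W" using card_mono[OF _ V(1)] V(5) by simp
  have cH: "int (card H) = W - int (card V)"
    unfolding H_def using V(1) cV fV by (simp add: card_Diff_subset)
  have "0 \<le> W" using cV by linarith
  have fH: "finite H" "card H \<le> 2" using cH V(4) by (auto simp: H_def)
  have H3: "i \<in> V \<or> j \<in> V \<or> k \<in> V" if "0 \<le> i" "i < j" "j < k" "k < W" for i j k
    using three_not_subset_of_card_2[OF fH, of i j k] that by (auto simp: H_def)
  have n: "\<not> (0 \<in> V \<and> 1 \<in> V \<and> 2 \<in> V)" "\<not> (1 \<in> V \<and> 2 \<in> V \<and> 3 \<in> V)" "\<not> (2 \<in> V \<and> 3 \<in> V \<and> 4 \<in> V)"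
    "\<not> (3 \<in> V \<and> 4 \<in> V \<and> 5 \<in> V)" "\<not> (4 \<in> V \<and> 5 \<in> V \<and> 6 \<in> V)"
    using no3[of 0] no3[of 1] no3[of 2] no3[of 3] no3[of 4] by auto
  consider "W = 4" | "W = 5" | "W = 6" | "7 \<le> W" using cV V(5) by linarith
  then show ?thesis
  proof cases
    case 1
    then have "V = {0..<4}" using V cV by (intro card_subset_eq) auto
    then show ?thesis using n(1) by auto
  next
    case 2
    then have "card H \<le> 1" using cH V(5) by linarith
    then have H2: "i \<in> V \<or> j \<in> V" if "0 \<le> i" "i < j" "j < W" for i j
      using card_mono[OF fH(1), of "{i,j}"] that by (auto simp: H_def)
    have "4 \<in> V" using V(3) 2 by simp
    with n V(2) H2[of 1 2] H2[of 2 3] H2[of 1 3] 2 show ?thesis by auto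
  next
    case 3
    then have "5 \<in> V" using V(3) by simp
    moreover have "card V = 4" if "2 \<notin> V" "3 \<notin> V"
    proof -
      have "{2,3} \<subseteq> H" using that 3 by (auto simp: H_def)
      then have "2 \<le> card H" using card_mono[OF fH(1), of "{2,3}"] by simp
      then show ?thesis using cH 3 V(5) by linarith
    qed
    ultimately show ?thesis
      using n V(2) H3[of 1 2 3] H3[of 1 2 4] H3[of 1 3 4] H3[of 2 3 4] 3
      unfolding insert_subset by (smt (z3) empty_subsetI)
  next
    case 4
    then show ?thesis
      using n V(2) H3[of 1 2 3] H3[of 1 2 4] H3[of 1 2 5] H3[of 1 2 6] H3[of 1 3 4] H3[of 1 3 5] H3[of 1 3 6]
        H3[of 1 4 5] H3[of 1 4 6] H3[of 1 5 6]
        H3[of 2 3 4] H3[of 2 3 5] H3[of 2 3 6] H3[of 2 4 5] H3[of 2 4 6] H3[of 2 5 6]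
        H3[of 3 4 5] H3[of 3 4 6] H3[of 3 5 6] H3[of 4 5 6]
      unfolding insert_subset by (smt (z3) empty_subsetI)
  qed
qed

text \<open>For a suitable \<open>v\<close> the run consists of \<open>v - y\<close> with
  \<open>0 \<le> y < L\<close>. If \<open>y\<close> is a hole of \<open>B\<close>, the same
  difference is \<open>(v + d) - (y + d)\<close>, where \<open>v + d\<close> lies in
  \<open>V\<close> and \<open>y + d\<close> is not a hole. Three consecutive elements of
  \<open>V\<close> always suffice, two suffice when the holes of \<open>B\<close> are not adjacent,
  and the patterns above settle two adjacent holes.\<close>

lemma difference_run_normalised:
  fixes V B :: "int set"
  assumes V: "V \<subseteq> {0..<W}" "0 \<in> V" "W - 1 \<in> V" "W \<le> int (card V) + 2" "4 \<le> card V"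
    and B: "B \<subseteq> {0..<L}" "0 \<in> B" "L - 1 \<in> B" "L \<le> int (card B) + 2" "4 \<le> card B"
    and "9 \<le> card V + card B"
  shows "\<exists>s. \<forall>u. s \<le> u \<and> u < s + L \<longrightarrow> (\<exists>v\<in>V. \<exists>y\<in>B. u = v - y)"
proof -
  define H where "H = {0..<L} - B"
  have fB: "finite B" using B(1) finite_subset by blast
  have cB: "int (card B) \<le> L" using card_mono[OF _ B(1)] B(5) by simp
  have cH: "int (card H) = L - int (card B)"
    unfolding H_def using B(1) cB fB by (simp add: card_Diff_subset)
  have fH: "finite H" "card H \<le> 2" using cH B(4) by (auto simp: H_def)
  have BH: "y \<in> B \<longleftrightarrow> y \<notin> H" if "0 \<le> y" "y < L" for y using that B(1) by (auto simp: H_def)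
  have H_bd: "0 < y \<and> y < L - 1" if "y \<in> H" for y
  proof -
    have "y \<noteq> 0" "y \<noteq> L - 1" "0 \<le> y" "y < L" using that B(2,3) by (auto simp: H_def)
    then show ?thesis by linarith
  qed
  have "finite V" using V(1) finite_subset by blast
  show ?thesis
  proof (cases "\<exists>v. v \<in> V \<and> v + 1 \<in> V \<and> v + 2 \<in> V")
    case True
    then obtain v where v: "v \<in> V" "v + 1 \<in> V" "v + 2 \<in> V" by blast
    have "\<exists>w\<in>V. \<exists>y\<in>B. u = w - y" if "v - L + 1 \<le> u" "u < v - L + 1 + L" for u
    proof -
      define y where "y = v - u"
      have y: "0 \<le> y" "y < L" "u = v - y" using that by (auto simp: y_def)
      consider "y \<notin> H" | "y \<in> H" "y + 1 \<notin> H" | "y \<in> H" "y + 1 \<in> H" by blast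
      then show ?thesis
      proof cases
        case 1 then show ?thesis using v y BH[of y] by auto
      next
        case 2 then show ?thesis using v(2) y BH[of "y+1"] H_bd[of y] by (intro bexI[of _ "v+1"] bexI[of _ "y+1"]) auto
      next
        case 3
        then have "y + 2 \<notin> H" using three_not_subset_of_card_2[OF fH, of y "y+1" "y+2"] by auto
        with 3 show ?thesis
          using v(3) y BH[of "y+2"] H_bd[of "y+1"] by (intro bexI[of _ "v+2"] bexI[of _ "y+2"]) auto
      qed
    qed
    then show ?thesis by blast
  next
    case False
    then have no3: "\<And>v. v \<in> V \<Longrightarrow> v + 1 \<in> V \<Longrightarrow> v + 2 \<in> V \<Longrightarrow> False" by blast
    have pat: "{0,1,3,4} \<subseteq> V \<or> {0,1,3,5} \<subseteq> V \<or> {0,2,3,5} \<subseteq> V \<or> {0,2,4,5} \<subseteq> V \<or> ({0,1,4,5} \<subseteq> V \<and> card V = 4)"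
      by (rule almost_interval_pattern[OF V]) (use no3 in blast)
    show ?thesis
    proof (cases "\<exists>\<eta>. \<eta> \<in> H \<and> \<eta> + 1 \<in> H")
      case False
      obtain v where v: "v \<in> V" "v + 1 \<in> V"
      proof -
        have "(0 \<in> V \<and> 0 + 1 \<in> V) \<or> (2 \<in> V \<and> 2 + 1 \<in> V) \<or> (4 \<in> V \<and> 4 + 1 \<in> V)" using pat by auto
        then show ?thesis using that by blast
      qed
      have "\<exists>w\<in>V. \<exists>y\<in>B. u = w - y" if "v - L + 1 \<le> u" "u < v - L + 1 + L" for u
      proof -
        define y where "y = v - u"
        have y: "0 \<le> y" "y < L" "u = v - y" using that by (auto simp: y_def)
        consider "y \<notin> H" | "y \<in> H" "y + 1 \<notin> H" using False by blast
        then show ?thesis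
        proof cases
          case 1 then show ?thesis using v y BH[of y] by auto
        next
          case 2 then show ?thesis using v(2) y BH[of "y+1"] H_bd[of y] by (intro bexI[of _ "v+1"] bexI[of _ "y+1"]) auto
        qed
      qed
      then show ?thesis by blast
    next
      case True
      then obtain \<eta> where \<eta>: "\<eta> \<in> H" "\<eta> + 1 \<in> H" by blast
      have H: "y \<in> H \<longleftrightarrow> y = \<eta> \<or> y = \<eta> + 1" for y
        using three_not_subset_of_card_2[OF fH, of \<eta> "\<eta>+1" y] \<eta> by auto
      have "2 \<le> card H" using card_mono[OF fH(1), of "{\<eta>,\<eta>+1}"] \<eta> by simp
      then have L: "L = int (card B) + 2" using cH fH by linarith
      have \<eta>b: "1 \<le> \<eta>" "\<eta> \<le> L - 3" using H_bd[OF \<eta>(1)] H_bd[OF \<eta>(2)] by linarith+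
      \<comment> \<open>The shift \<open>d\<close> repairs the hole \<open>\<eta>\<close> and
        \<open>d'\<close> the hole \<open>\<eta> + 1\<close>. The conditions keep the shifted
        positions between 0 and \<open>L - 1\<close> and away from both holes.\<close>
      have window: ?thesis if w: "v \<in> V" "v + d \<in> V" "v + d' \<in> V"
        "d \<noteq> 0" "d \<noteq> 1" "-\<eta> \<le> d" "d < L - \<eta>" "d' \<noteq> 0" "d' \<noteq> -1" "-\<eta> - 1 \<le> d'" "d' < L - 1 - \<eta>" for v d d'
      proof -
        have "\<exists>w\<in>V. \<exists>y\<in>B. u = w - y" if u: "v - L + 1 \<le> u" "u < v - L + 1 + L" for u
        proof -
          define y where "y = v - u"
          have y: "0 \<le> y" "y < L" "u = v - y" using u by (auto simp: y_def)
          consider "y \<notin> H" | "y = \<eta>" | "y = \<eta> + 1" using H by blast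
          then show ?thesis
          proof cases
            case 1 then show ?thesis using w y BH[of y] by blast
          next
            case 2 then show ?thesis using w y BH[of "\<eta> + d"] H by (intro bexI[of _ "v+d"] bexI[of _ "\<eta>+d"]) auto
          next
            case 3 then show ?thesis using w y BH[of "\<eta> + 1 + d'"] H by (intro bexI[of _ "v+d'"] bexI[of _ "\<eta>+1+d'"]) auto
          qed
        qed
        then show ?thesis by blast
      qed
      have L6: "6 \<le> L" using L B(5) by linarith
      from pat show ?thesis
      proof (elim disjE conjE)
        assume *: "{0,1,3,4} \<subseteq> V"
        show ?thesis
        proof (cases "\<eta> = 1")
          case True
          show ?thesis by (rule window[of 0 3 1]) (use * \<eta>b L6 True in simp_all)
        next
          case False
          show ?thesis by (rule window[of 3 "-2" 1]) (use * \<eta>b L6 False in simp_all)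
        qed
      next
        assume *: "{0,1,3,5} \<subseteq> V"
        show ?thesis
        proof (cases "\<eta> = 1")
          case True
          show ?thesis by (rule window[of 0 3 1]) (use * \<eta>b L6 True in simp_all)
        next
          case False
          show ?thesis by (rule window[of 3 "-2" "-2"]) (use * \<eta>b L6 False in simp_all)
        qed
      next
        assume *: "{0,2,3,5} \<subseteq> V"
        show ?thesis
        proof (cases "\<eta> = 1")
          case True
          show ?thesis by (rule window[of 2 3 1]) (use * \<eta>b L6 True in simp_all)
        next
          case False
          show ?thesis by (rule window[of 2 "-2" 1]) (use * \<eta>b L6 False in simp_all)
        qed
      next
        assume *: "{0,2,4,5} \<subseteq> V"
        show ?thesis
        proof (cases "\<eta> = 1")
          case True
          show ?thesis by (rule window[of 2 2 2]) (use * \<eta>b L6 True in simp_all)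
        next
          case False
          show ?thesis by (rule window[of 4 "-2" 1]) (use * \<eta>b L6 False in simp_all)
        qed
      next
        assume *: "{0,1,4,5} \<subseteq> V" "card V = 4"
        \<comment> \<open>If \<open>V\<close> and \<open>B\<close> were both {0, 1, 4, 5}, there
          would be no run of length 6; the bound on the sizes excludes this.\<close>
        then have "7 \<le> L" using L assms(11) by linarith
        show ?thesis
        proof (cases "\<eta> \<le> 2")
          case True
          show ?thesis by (rule window[of 0 4 1]) (use * \<open>7 \<le> L\<close> \<eta>b True in simp_all)
        next
          case False
          show ?thesis by (rule window[of 4 "-3" 1]) (use * \<open>7 \<le> L\<close> \<eta>b False in simp_all)
        qed
      qed
    qed
  qed
qed

theorem difference_run:
  fixes V B :: "int set"
  assumes "finite V" "finite B" "4 \<le> card V" "4 \<le> card B" "9 \<le> card V + card B"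
    and "width V \<le> int (card V) + 2" "width B \<le> int (card B) + 2"
  shows "\<exists>s. \<forall>u. s \<le> u \<and> u < s + width B \<longrightarrow> (\<exists>v\<in>V. \<exists>y\<in>B. u = v - y)"
proof -
  have ne: "V \<noteq> {}" "B \<noteq> {}" using assms by auto
  let ?V = "(+) (- Min V) ` V" and ?B = "(+) (- Min B) ` B"
  have *: "(+) (- Min X) ` X \<subseteq> {0..<width X} \<and> 0 \<in> (+) (- Min X) ` X \<and> width X - 1 \<in> (+) (- Min X) ` X"
    if X: "finite X" "X \<noteq> {}" for X :: "int set"
  proof (intro conjI)
    show "(+) (- Min X) ` X \<subseteq> {0..<width X}"
    proof
      fix x assume "x \<in> (+) (- Min X) ` X"
      then obtain y where y: "y \<in> X" "x = - Min X + y" by blast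
      have "Min X \<le> y" "y \<le> Max X" using X y by auto
      then show "x \<in> {0..<width X}" unfolding y(2) width_def by auto
    qed
    show "0 \<in> (+) (- Min X) ` X" by (rule image_eqI[of _ _ "Min X"]) (use X Min_in in \<open>simp_all only: left_minus\<close>)
    show "width X - 1 \<in> (+) (- Min X) ` X" by (rule image_eqI[of _ _ "Max X"]) (use X in \<open>simp_all add: width_def\<close>)
  qed
  have c: "card ?V = card V" "card ?B = card B" by (simp_all add: card_image)
  have "\<exists>s. \<forall>u. s \<le> u \<and> u < s + width B \<longrightarrow> (\<exists>v\<in>?V. \<exists>y\<in>?B. u = v - y)"
    using *[OF assms(1) ne(1)] *[OF assms(2) ne(2)] assms
    by (intro difference_run_normalised[where W = "width V"]) (auto simp only: c)
  then obtain s where s: "\<And>u. s \<le> u \<Longrightarrow> u < s + width B \<Longrightarrow> \<exists>v\<in>?V. \<exists>y\<in>?B. u = v - y" by blast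
  have "\<exists>v\<in>V. \<exists>y\<in>B. u = v - y" if u: "s + Min V - Min B \<le> u" "u < s + Min V - Min B + width B" for u
  proof -
    obtain v y where vy: "v \<in> V" "y \<in> B" "u - Min V + Min B = (- Min V + v) - (- Min B + y)"
      using s[of "u - Min V + Min B"] u by auto
    have "u = v - y" using vy(3) by simp
    then show ?thesis using vy by blast
  qed
  then show ?thesis by blast
qed


section \<open>Progressions in \<open>\<int>/p\<int>\<close>\<close>

definition pt :: "'p::prime_card mod_ring \<Rightarrow> 'p mod_ring \<Rightarrow> int \<Rightarrow> 'p mod_ring" where
  "pt r x i = x + of_int i * r"

lemma pt_0 [simp]: "pt r x 0 = x"
  by (simp add: pt_def)

lemma pt_add: "pt r x (i + j) = pt r (pt r x i) j"
  by (simp add: pt_def algebra_simps)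

lemma pt_plus_pt: "pt r x i + pt r y j = pt r (x + y) (i + j)"
  by (simp add: pt_def algebra_simps)

lemma pt_minus_pt: "pt r x i - pt r y j = pt r (x - y) (i - j)"
  by (simp add: pt_def algebra_simps)

lemma of_int_mod_ring_eq_0_iff:
  "(of_int i :: 'p::prime_card mod_ring) = 0 \<longleftrightarrow> int CARD('p) dvd i"
  using of_int_eq_0_iff_char_dvd[where 'a = "'p mod_ring"] by (simp add: semiring_char_mod_ring)

lemma pt_eq_iff:
  fixes r :: "'p::prime_card mod_ring"
  assumes "r \<noteq> 0"
  shows "pt r x i = pt r x j \<longleftrightarrow> int CARD('p) dvd i - j"
proof -
  have "pt r x i = pt r x j \<longleftrightarrow> of_int (i - j) * r = 0"
    by (simp add: pt_def algebra_simps)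
  then show ?thesis using assms by (simp add: of_int_mod_ring_eq_0_iff del: of_int_diff)
qed

lemma pt_inj_on:
  fixes r :: "'p::prime_card mod_ring"
  assumes "r \<noteq> 0" "\<And>i j. i \<in> I \<Longrightarrow> j \<in> I \<Longrightarrow> i - j < int CARD('p)"
  shows "inj_on (pt r x) I"
proof (rule inj_onI)
  fix i j assume ij: "i \<in> I" "j \<in> I" "pt r x i = pt r x j"
  then have "int CARD('p) dvd i - j" using pt_eq_iff[OF assms(1)] by blast
  moreover have "\<bar>i - j\<bar> < int CARD('p)" using assms(2)[OF ij(1,2)] assms(2)[OF ij(2,1)] by linarith
  ultimately show "i = j" using zdvd_not_zless[of "\<bar>i - j\<bar>" "int CARD('p)"] by (cases "i = j") auto
qed

lemma pt_surj:
  fixes r :: "'p::prime_card mod_ring"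
  assumes "r \<noteq> 0"
  shows "pt r x ` {k..<k + int CARD('p)} = UNIV"
proof (rule card_subset_eq)
  have "inj_on (pt r x) {k..<k + int CARD('p)}" by (rule pt_inj_on[OF assms]) auto
  then show "card (pt r x ` {k..<k + int CARD('p)}) = card (UNIV :: 'p mod_ring set)"
    by (simp add: card_image)
qed auto

lemma pt_obtain:
  fixes r :: "'p::prime_card mod_ring"
  assumes "r \<noteq> 0"
  obtains i where "k \<le> i" "i < k + int CARD('p)" "y = pt r x i"
proof -
  have "y \<in> pt r x ` {k..<k + int CARD('p)}" unfolding pt_surj[OF assms] by blast
  then show ?thesis using that by auto
qed

lemma translation_invariant_eq_UNIV:
  fixes r :: "'p::prime_card mod_ring"
  assumes "r \<noteq> 0" "X \<noteq> {}" "\<And>x. x \<in> X \<Longrightarrow> x + r \<in> X"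
  shows "X = UNIV"
proof -
  obtain x where x: "x \<in> X" using assms by blast
  have *: "pt r x (int n) \<in> X" for n
  proof (induction n)
    case 0
    show ?case using x by simp
  next
    case (Suc n)
    then show ?case using assms(3)[OF Suc] by (simp add: pt_def algebra_simps)
  qed
  have "y \<in> X" for y
  proof -
    obtain i where "0 \<le> i" "y = pt r x i" using pt_obtain[OF assms(1), of 0 y x] by auto
    then show ?thesis using *[of "nat i"] by simp
  qed
  then show ?thesis by blast
qed

text \<open>Dyson's e-transform: \<open>X'\<close> adds \<open>e + Y\<close> to \<open>X\<close> and
  \<open>Y'\<close> keeps the part of \<open>Y\<close> inside \<open>X - e\<close>. The total size
  is unchanged and \<open>X' + Y'\<close> stays inside \<open>X + Y\<close>. Some \<open>e\<close>
  makes \<open>Y'\<close> nonempty and proper unless \<open>X\<close> is invariant under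
  \<open>Y - Y\<close>, and then \<open>Y\<close> is a singleton.\<close>

theorem Cauchy_Davenport:
  fixes X Y :: "'p::prime_card mod_ring set"
  assumes "X \<noteq> {}" "Y \<noteq> {}" "X + Y \<noteq> UNIV"
  shows "card X + card Y \<le> card (X + Y) + 1"
  using assms
proof (induction "card Y" arbitrary: X Y rule: less_induct)
  case less
  show ?case
  proof (cases "\<exists>x\<in>X. \<exists>y\<in>Y. \<exists>y'\<in>Y. x - y + y' \<notin> X")
    case True
    then obtain x y y' where xy: "x \<in> X" "y \<in> Y" "y' \<in> Y" "x - y + y' \<notin> X" by blast
    define e where "e = x - y"
    define X' where "X' = X \<union> (+) e ` Y"
    define Y' where "Y' = {z \<in> Y. e + z \<in> X}"
    have sub: "X' + Y' \<subseteq> X + Y"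
    proof
      fix s assume "s \<in> X' + Y'"
      then obtain u v where uv: "u \<in> X'" "v \<in> Y'" "s = u + v" by (auto elim: set_plus_elim)
      show "s \<in> X + Y"
      proof (cases "u \<in> X")
        case True
        then show ?thesis using uv by (auto simp: Y'_def)
      next
        case False
        then obtain w where "w \<in> Y" "u = e + w" using uv by (auto simp: X'_def)
        then have "s = (e + v) + w" using uv by (simp add: algebra_simps)
        moreover have "e + v \<in> X" using uv by (simp add: Y'_def)
        ultimately show ?thesis using \<open>w \<in> Y\<close> by blast
      qed
    qed
    have "y' \<notin> Y'" "y \<in> Y'" using xy by (auto simp: Y'_def e_def)
    then have "Y' \<subset> Y" "Y' \<noteq> {}" using xy by (auto simp: Y'_def)
    then have "card Y' < card Y" by (intro psubset_card_mono) auto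
    moreover have "card X' + card Y' = card X + card Y"
    proof -
      have "(+) e ` Y' = X \<inter> (+) e ` Y" by (auto simp: Y'_def)
      then have "card Y' = card (X \<inter> (+) e ` Y)" by (metis card_image inj_on_add)
      moreover have "card ((+) e ` Y) = card Y" by (simp add: card_image)
      ultimately show ?thesis
        using card_Un_Int[of X "(+) e ` Y"] by (simp add: X'_def)
    qed
    moreover have "X' + Y' \<noteq> UNIV" using sub less.prems(3) by auto
    ultimately have "card X + card Y \<le> card (X' + Y') + 1"
      using less.hyps[of Y' X'] \<open>Y' \<noteq> {}\<close> less.prems(1) by (auto simp: X'_def)
    moreover have "card (X' + Y') \<le> card (X + Y)" using sub by (intro card_mono) auto
    ultimately show ?thesis by linarith
  next
    case False
    then have inv: "x - y + y' \<in> X" if "x \<in> X" "y \<in> Y" "y' \<in> Y" for x y y' using that by blast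
    obtain y where y: "y \<in> Y" using less.prems by blast
    have "Y = {y}"
    proof (rule ccontr)
      assume "Y \<noteq> {y}"
      then obtain y' where y': "y' \<in> Y" "y' \<noteq> y" using y by blast
      have "X = UNIV"
        by (rule translation_invariant_eq_UNIV[of "y' - y"]) (use y' less.prems inv[OF _ y y'(1)] in \<open>auto simp: algebra_simps\<close>)
      have "z \<in> X + Y" for z using set_plus_intro[of "z - y" X y Y] y \<open>X = UNIV\<close> by simp
      then show False using less.prems(3) by blast
    qed
    moreover have "(+) y ` X \<subseteq> X + Y" using y by (auto simp: add.commute[of y])
    then have "card ((+) y ` X) \<le> card (X + Y)" by (intro card_mono) auto
    ultimately show ?thesis by (simp add: card_image)
  qed
qed

section \<open>Almost progressions and their lifts to the integers\<close>

definition seg :: "'p::prime_card mod_ring \<Rightarrow> 'p mod_ring \<Rightarrow> int \<Rightarrow> 'p mod_ring set" where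
  "seg r x n = pt r x ` {0..<n}"

text \<open>The overview's "almost a progression", with difference \<open>r\<close>. Fixing the
  length at \<open>card X + 2\<close> covers shorter progressions too.\<close>

definition near :: "'p::prime_card mod_ring \<Rightarrow> 'p mod_ring set \<Rightarrow> bool" where
  "near r X \<longleftrightarrow> r \<noteq> 0 \<and> (\<exists>x. X \<subseteq> seg r x (int (card X) + 2))"

lemma seg_mono: "n \<le> m \<Longrightarrow> seg r x n \<subseteq> seg r x m"
  by (auto simp: seg_def)

lemma seg_uminus: "uminus ` seg r x n = seg r (- x - of_int (n - 1) * r) n"
proof -
  have "uminus ` pt r x ` {0..<n} = pt r (- x - of_int (n - 1) * r) ` (\<lambda>i. n - 1 - i) ` {0..<n}"
    unfolding image_image by (rule image_cong) (simp_all add: pt_def algebra_simps)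
  also have "(\<lambda>i. n - 1 - i) ` {0..<n} = {0..<n}"
  proof -
    have "\<exists>j\<in>{0..<n}. i = n - 1 - j" if "i \<in> {0..<n}" for i
      using that by (intro bexI[of _ "n - 1 - i"]) auto
    then show ?thesis by auto
  qed
  finally show ?thesis by (simp add: seg_def)
qed

lemma near_uminus: "near r (uminus ` X) \<longleftrightarrow> near r X"
proof -
  have *: "near r (uminus ` X)" if X: "near r X" for X :: "'p::prime_card mod_ring set" and r
  proof -
    obtain x where "r \<noteq> 0" "X \<subseteq> seg r x (int (card X) + 2)" using X by (auto simp: near_def)
    then have "uminus ` X \<subseteq> seg r (- x - of_int (int (card X) + 2 - 1) * r) (int (card X) + 2)"
      using image_mono[of X _ uminus] by (subst seg_uminus[symmetric]) blast
    then show ?thesis using \<open>r \<noteq> 0\<close> by (auto simp: near_def card_image)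
  qed
  have "uminus ` uminus ` X = X" by (simp add: image_image)
  then show ?thesis using *[of r X] *[of r "uminus ` X"] by auto
qed

lemma near_lift:
  fixes X :: "'p::prime_card mod_ring set"
  assumes "X \<subseteq> seg r x n" "r \<noteq> 0" "n \<le> int CARD('p)"
  obtains X0 where "X0 \<subseteq> {0..<n}" "X = pt r x ` X0" "card X0 = card X" "finite X0"
proof -
  define X0 where "X0 = {i \<in> {0..<n}. pt r x i \<in> X}"
  have "inj_on (pt r x) X0" using assms by (intro pt_inj_on) (auto simp: X0_def)
  moreover have X: "X = pt r x ` X0" using assms(1) by (auto simp: X0_def seg_def)
  ultimately have "card X0 = card X" by (simp add: card_image)
  moreover have "X0 \<subseteq> {0..<n}" by (auto simp: X0_def)
  moreover from this have "finite X0" by (rule finite_subset) simp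
  ultimately show ?thesis using that[of X0] X by blast
qed

lemma near_lift_width:
  fixes X :: "'p::prime_card mod_ring set"
  assumes "near r X" "int (card X) + 2 \<le> int CARD('p)" "X \<noteq> {}"
  obtains x X0 where "finite X0" "X0 \<noteq> {}" "X = pt r x ` X0" "card X0 = card X" "width X0 \<le> int (card X) + 2"
proof -
  obtain x where "r \<noteq> 0" "X \<subseteq> seg r x (int (card X) + 2)" using assms by (auto simp: near_def)
  then obtain X0 where X0: "X0 \<subseteq> {0..<int (card X) + 2}" "X = pt r x ` X0" "card X0 = card X" "finite X0"
    using near_lift assms(2) by metis
  have ne: "X0 \<noteq> {}" using X0 assms(3) by auto
  have "Max X0 \<in> {0..<int (card X) + 2}" "Min X0 \<in> {0..<int (card X) + 2}"
    using X0(1) Max_in[OF X0(4) ne] Min_in[OF X0(4) ne] by blast+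
  then have "width X0 \<le> int (card X) + 2" by (simp add: width_def)
  then show ?thesis using that[OF X0(4) ne X0(2,3)] by blast
qed

lemma near_lift_subset_seg:
  assumes "finite X0"
  shows "pt r x ` X0 \<subseteq> seg r (pt r x (Min X0)) (width X0)"
proof
  fix y assume "y \<in> pt r x ` X0"
  then obtain i where i: "i \<in> X0" "y = pt r x i" by blast
  then have "Min X0 \<le> i" "i \<le> Max X0" using assms by auto
  then have "i - Min X0 \<in> {0..<width X0}" by (simp add: width_def)
  moreover have "y = pt r (pt r x (Min X0)) (i - Min X0)" using i by (simp add: pt_add[symmetric])
  ultimately show "y \<in> seg r (pt r x (Min X0)) (width X0)" unfolding seg_def by blast
qed

lemma Compl_seg:
  fixes r :: "'p::prime_card mod_ring"
  assumes "r \<noteq> 0"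
  shows "- seg r x n \<subseteq> seg r (pt r x n) (int CARD('p) - n)"
proof
  fix y assume y: "y \<in> - seg r x n"
  obtain i where i: "0 \<le> i" "i < int CARD('p)" "y = pt r x i"
    using pt_obtain[OF assms, of 0 y x] by auto
  have "n \<le> i" using y i by (force simp: seg_def)
  then show "y \<in> seg r (pt r x n) (int CARD('p) - n)"
    using i by (auto simp: seg_def pt_add[symmetric] intro!: image_eqI[of _ _ "i - n"])
qed

text \<open>\<open>A\<close> lies in the \<open>p - L\<close> terms after its gap and
  \<open>B\<close> in \<open>L\<close> terms, so the index sums take at most \<open>p - 1\<close>
  consecutive values and the sumset lifts to the integers without collisions.\<close>

theorem near_of_small_sumset:
  fixes A B :: "'p::prime_card mod_ring set"
  assumes r: "r \<noteq> 0" and B: "B \<subseteq> seg r y L" "L \<le> int (card B) + 2" and gap: "A \<inter> seg r x L = {}"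
    and "4 \<le> card A" "4 \<le> card B" "9 \<le> card A + card B" "card (A + B) \<le> card A + card B + 1"
  shows "near r A"
proof -
  let ?p = "int CARD('p)"
  have "L \<le> ?p"
  proof (rule ccontr)
    assume "\<not> L \<le> ?p"
    then have "seg r x L = UNIV" using pt_surj[OF r, of x 0] seg_mono[of ?p L r x] by (auto simp: seg_def)
    then show False using gap assms(5) by auto
  qed
  have "0 \<le> L" using B(1) assms(6) by (auto simp: seg_def intro!: leI)
  have "A \<subseteq> - seg r x L" using gap by blast
  then have A: "A \<subseteq> seg r (pt r x L) (?p - L)" using Compl_seg[OF r, of x L] by blast
  define x' where "x' = pt r x L"
  obtain A0 where A0: "A0 \<subseteq> {0..<?p - L}" "A = pt r x' ` A0" "card A0 = card A" "finite A0"
    using near_lift[OF A r] \<open>0 \<le> L\<close> unfolding x'_def by auto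
  obtain B0 where B0: "B0 \<subseteq> {0..<L}" "B = pt r y ` B0" "card B0 = card B" "finite B0"
    using near_lift[OF B(1) r \<open>L \<le> ?p\<close>] .
  have "A + B = pt r (x' + y) ` (A0 + B0)"
    unfolding A0(2) B0(2) by (force simp: set_plus_def pt_plus_pt)
  moreover have "inj_on (pt r (x' + y)) (A0 + B0)"
  proof (rule pt_inj_on[OF r])
    fix i j assume "i \<in> A0 + B0" "j \<in> A0 + B0"
    then obtain a b a' b' where "a \<in> A0" "b \<in> B0" "a' \<in> A0" "b' \<in> B0" "i = a + b" "j = a' + b'"
      by (auto elim!: set_plus_elim)
    moreover from this have "a < ?p - L" "b < L" "0 \<le> a'" "0 \<le> b'" using A0(1) B0(1) by auto
    ultimately show "i - j < ?p" by linarith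
  qed
  ultimately have "card (A0 + B0) = card (A + B)" by (simp add: card_image)
  moreover have ne: "A0 \<noteq> {}" "B0 \<noteq> {}" using A0 B0 assms by auto
  have "Max B0 \<in> {0..<L}" "Min B0 \<in> {0..<L}" using B0(1) Max_in[OF B0(4) ne(2)] Min_in[OF B0(4) ne(2)] by blast+
  then have "width B0 \<le> int (card B0) + 2" using B(2) B0(3) by (simp add: width_def)
  ultimately have "width A0 \<le> int (card A0) + 2"
    using assms A0 B0 by (intro width_le_of_small_sumset[of A0 B0]) auto
  then have "A \<subseteq> seg r (pt r x' (Min A0)) (int (card A) + 2)"
    using near_lift_subset_seg[OF A0(4), of r x'] seg_mono[of "width A0" "int (card A) + 2" r] A0(2,3) by fastforce
  then show ?thesis using r by (auto simp: near_def)
qed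

text \<open>The run supplied by \<open>difference_run\<close> for \<open>V - B\<close> is missed by
  \<open>A\<close>, which is the gap that the lift needs.\<close>

theorem near_of_disjoint_difference:
  fixes A B V :: "'p::prime_card mod_ring set"
  assumes "near r V" "near r B" and disj: "\<And>v y. v \<in> V \<Longrightarrow> y \<in> B \<Longrightarrow> v - y \<notin> A"
    and p: "int (card V) + 2 \<le> int CARD('p)" "int (card B) + 2 \<le> int CARD('p)"
    and c: "4 \<le> card A" "4 \<le> card B" "4 \<le> card V" "9 \<le> card A + card B" "9 \<le> card V + card B"
    and AB: "card (A + B) \<le> card A + card B + 1"
  shows "near r A"
proof -
  have ne: "V \<noteq> {}" "B \<noteq> {}" using c by auto
  have r: "r \<noteq> 0" using assms(1) by (simp add: near_def)
  obtain x V0 where V0: "finite V0" "V0 \<noteq> {}" "V = pt r x ` V0" "card V0 = card V" "width V0 \<le> int (card V) + 2"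
    using near_lift_width[OF assms(1) p(1) ne(1)] .
  obtain y B0 where B0: "finite B0" "B0 \<noteq> {}" "B = pt r y ` B0" "card B0 = card B" "width B0 \<le> int (card B) + 2"
    using near_lift_width[OF assms(2) p(2) ne(2)] .
  obtain s where s: "\<And>u. s \<le> u \<Longrightarrow> u < s + width B0 \<Longrightarrow> \<exists>v\<in>V0. \<exists>y\<in>B0. u = v - y"
    using difference_run[OF V0(1) B0(1)] c V0 B0 by (metis (no_types, lifting))
  have "A \<inter> seg r (pt r (x - y) s) (width B0) = {}"
  proof -
    have "pt r (pt r (x - y) s) i \<notin> A" if i: "0 \<le> i" "i < width B0" for i
    proof -
      obtain v w where "v \<in> V0" "w \<in> B0" "s + i = v - w" using s[of "s + i"] i by auto
      then have "pt r (pt r (x - y) s) i = pt r x v - pt r y w" by (simp add: pt_minus_pt pt_add[symmetric])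
      then show ?thesis using disj[of "pt r x v" "pt r y w"] V0 B0 \<open>v \<in> V0\<close> \<open>w \<in> B0\<close> by auto
    qed
    then show ?thesis by (auto simp: seg_def)
  qed
  moreover have "B \<subseteq> seg r (pt r y (Min B0)) (width B0)"
    unfolding B0(3) by (rule near_lift_subset_seg[OF B0(1)])
  ultimately show ?thesis using near_of_small_sumset[OF r _ _ _ c(1,2,4) AB] B0(5) by blast
qed


section \<open>Translates and representations\<close>

definition overlap :: "'a::ab_group_add \<Rightarrow> 'a set \<Rightarrow> 'a set" where
  "overlap g X = {x \<in> X. x + g \<in> X}"

definition ends :: "'a::ab_group_add \<Rightarrow> 'a set \<Rightarrow> 'a set" where
  "ends g X = {x \<in> X. x + g \<notin> X}"

lemma card_overlap_ends: "finite X \<Longrightarrow> card (overlap g X) + card (ends g X) = card X"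
  by (subst card_Un_disjoint[symmetric]) (auto simp: overlap_def ends_def intro!: arg_cong[of _ _ card])

lemma card_overlap_uminus: "card (overlap (- g) X) = card (overlap g X)"
proof -
  have "overlap (- g) X = (+) g ` overlap g X"
    by (force simp: overlap_def image_iff algebra_simps intro: bexI[of _ "_ - g"])
  then show ?thesis by (simp add: card_image)
qed

lemma card_ends_uminus:
  assumes "finite X"
  shows "card (ends (- g) X) = card (ends g X)"
  using card_overlap_ends[OF assms, of g] card_overlap_ends[OF assms, of "- g"] card_overlap_uminus[of g X]
  by linarith

lemma card_Un_translate:
  assumes "finite X"
  shows "card (X \<union> (+) g ` X) = card X + card (ends g X)"
proof -
  have "X \<union> (+) g ` X = X \<union> (+) g ` ends g X"
    by (auto simp: ends_def add.commute)
  moreover have "X \<inter> (+) g ` ends g X = {}" by (auto simp: ends_def add.commute)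
  ultimately show ?thesis using assms by (simp add: card_Un_disjoint card_image ends_def)
qed

lemma ends_nonempty:
  fixes X :: "'p::prime_card mod_ring set"
  assumes "g \<noteq> 0" "X \<noteq> {}" "X \<noteq> UNIV"
  shows "ends g X \<noteq> {}"
  using translation_invariant_eq_UNIV[of g X] assms by (auto simp: ends_def)

lemma overlap_plus_subset: "overlap g X + Y \<subseteq> overlap g (X + Y)"
proof
  fix z assume "z \<in> overlap g X + Y"
  then obtain x y where "x \<in> X" "x + g \<in> X" "y \<in> Y" "z = x + y"
    by (auto simp: overlap_def elim!: set_plus_elim)
  moreover from this have "z + g = (x + g) + y" by (simp add: algebra_simps)
  ultimately show "z \<in> overlap g (X + Y)" unfolding overlap_def by (metis (mono_tags, lifting) mem_Collect_eq set_plus_intro)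
qed

lemma Un_translate_plus: "(X \<union> (+) g ` X) + Y = (X + Y) \<union> (+) g ` (X + Y :: 'a::ab_group_add set)"
proof -
  have "(X \<union> (+) g ` X) + Y = (X + Y) \<union> ((+) g ` X + Y)" by (auto simp: set_plus_def)
  then show ?thesis using set_plus_translate[of g X 0 Y] by simp
qed

section \<open>Counting representations\<close>

definition representations :: "'a::ab_group_add set \<Rightarrow> 'a set \<Rightarrow> 'a \<Rightarrow> 'a set" where
  "representations T B x = {t \<in> T. x - t \<in> B}"

lemma representations_empty_iff: "representations T B x = {} \<longleftrightarrow> x \<notin> T + B"
proof -
  have "x \<in> T + B" if "t \<in> T" "x - t \<in> B" for t
    using set_plus_intro[OF that] by simp
  then show ?thesis by (auto simp: representations_def elim!: set_plus_elim)
qed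

lemma sum_card_representations:
  fixes T B :: "'a::{finite,ab_group_add} set"
  shows "(\<Sum>x\<in>T + B. int (card (representations T B x))) = int (card T) * int (card B)"
proof -
  have "(\<Sum>x\<in>T + B. int (card (representations T B x))) = (\<Sum>x\<in>UNIV. int (card (representations T B x)))"
    by (rule sum.mono_neutral_left) (auto simp: representations_empty_iff)
  also have "\<dots> = (\<Sum>x\<in>UNIV. \<Sum>t\<in>T. if x - t \<in> B then 1 else 0)"
    by (simp add: representations_def sum.If_cases Int_def)
  also have "\<dots> = (\<Sum>t\<in>T. \<Sum>x\<in>UNIV. if x - t \<in> B then 1 else 0)"
    by (rule sum.swap)
  also have "\<dots> = (\<Sum>t\<in>T. int (card B))"
  proof (rule sum.cong)
    fix t
    have "{x. x - t \<in> B} = (+) t ` B"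
      by (auto simp: image_iff algebra_simps intro!: bexI[of _ "_ - t"])
    then have "card {x. x - t \<in> B} = card B" by (simp add: card_image)
    then show "(\<Sum>x\<in>UNIV. if x - t \<in> B then 1 else 0) = int (card B)"
      by (simp add: sum.If_cases)
  qed simp
  finally show ?thesis by simp
qed

text \<open>This counts the solutions of \<open>t + b = t' + b'\<close> with
  \<open>t \<noteq> t'\<close>: the additive energy of \<open>T\<close> and \<open>B\<close> without
  its diagonal.\<close>

definition overlap_sum :: "'a::ab_group_add set \<Rightarrow> 'a set \<Rightarrow> int" where
  "overlap_sum T B = (\<Sum>t\<in>T. \<Sum>t'\<in>T - {t}. int (card (overlap (t - t') B)))"

lemma sum_card_representations_squared:
  fixes T B :: "'a::{finite,ab_group_add} set"
  shows "(\<Sum>x\<in>T + B. int (card (representations T B x))^2) = int (card T) * int (card B) + overlap_sum T B"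
proof -
  let ?f = "\<lambda>x t. if x - t \<in> B then 1 else 0 :: int"
  have "(\<Sum>x\<in>T + B. int (card (representations T B x))^2) = (\<Sum>x\<in>UNIV. int (card (representations T B x))^2)"
    by (rule sum.mono_neutral_left) (auto simp: representations_empty_iff)
  also have "\<dots> = (\<Sum>x\<in>UNIV. (\<Sum>t\<in>T. ?f x t) * (\<Sum>t'\<in>T. ?f x t'))"
    by (simp add: representations_def sum.If_cases Int_def power2_eq_square)
  also have "\<dots> = (\<Sum>x\<in>UNIV. \<Sum>t\<in>T. \<Sum>t'\<in>T. ?f x t * ?f x t')"
    by (simp only: sum_product)
  also have "\<dots> = (\<Sum>t\<in>T. \<Sum>t'\<in>T. \<Sum>x\<in>UNIV. ?f x t * ?f x t')"
    by (subst sum.swap, rule sum.cong[OF refl], rule sum.swap)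
  also have "\<dots> = (\<Sum>t\<in>T. \<Sum>t'\<in>T. int (card (overlap (t - t') B)))"
  proof (intro sum.cong refl)
    fix t t'
    have "{x. x - t \<in> B \<and> x - t' \<in> B} = (+) t ` overlap (t - t') B"
      by (auto simp: overlap_def image_iff algebra_simps intro!: exI[of _ "_ - t"])
    then have "card {x. x - t \<in> B \<and> x - t' \<in> B} = card (overlap (t - t') B)" by (simp add: card_image)
    moreover have "(\<Sum>x\<in>UNIV. ?f x t * ?f x t') = (\<Sum>x\<in>UNIV. if x - t \<in> B \<and> x - t' \<in> B then 1 else 0)"
      by (rule sum.cong) auto
    ultimately show "(\<Sum>x\<in>UNIV. ?f x t * ?f x t') = int (card (overlap (t - t') B))"
      by (simp add: sum.If_cases)
  qed
  also have "\<dots> = (\<Sum>t\<in>T. int (card B) + (\<Sum>t'\<in>T - {t}. int (card (overlap (t - t') B))))"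
    by (rule sum.cong) (auto simp: sum.remove overlap_def)
  finally show ?thesis by (simp add: sum.distrib overlap_sum_def)
qed

lemma card_representations_pos: "finite T \<Longrightarrow> x \<in> T + B \<Longrightarrow> 1 \<le> card (representations T B x)"
  using representations_empty_iff[of T B x] by (auto simp: Suc_le_eq card_gt_0_iff representations_def)

text \<open>Sum the inequality \<open>(r - 1)(r - 2) \<ge> 0\<close> over all sums, where
  \<open>r\<close> is the number of representations.\<close>

lemma card_plus_ge_by_pairs:
  fixes T B :: "'a::{finite,ab_group_add} set"
  shows "2 * int (card T) * int (card B) \<le> 2 * int (card (T + B)) + overlap_sum T B"
proof -
  have "3 * int (card (representations T B x)) \<le> 2 + int (card (representations T B x))^2"
    if "x \<in> T + B" for x
  proof -
    have "0 \<le> (int (card (representations T B x)) - 1) * (int (card (representations T B x)) - 2)"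
      using card_representations_pos[OF _ that] by (cases "card (representations T B x) = 1") auto
    then show ?thesis by (simp add: algebra_simps power2_eq_square)
  qed
  then have "(\<Sum>x\<in>T + B. 3 * int (card (representations T B x))) \<le>
      (\<Sum>x\<in>T + B. 2 + int (card (representations T B x))^2)"
    by (rule sum_mono)
  then show ?thesis
    by (simp add: sum_distrib_left[symmetric] sum.distrib sum_card_representations sum_card_representations_squared mult.commute mult.left_commute)
qed

text \<open>Here the inequality is \<open>(r - 2)(r - 3) \<ge> 0\<close>, sharper when most sums
  have two or three representations. Its value 2 at \<open>r = 1\<close> produces the term for
  uniquely represented sums.\<close>

lemma card_plus_ge_by_pairs_refined:
  fixes T B :: "'a::{finite,ab_group_add} set"
  shows "4 * int (card T) * int (card B) + 2 * int (card {x \<in> T + B. card (representations T B x) = 1})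
    \<le> 6 * int (card (T + B)) + overlap_sum T B"
proof -
  have "5 * int (card (representations T B x)) + (if card (representations T B x) = 1 then 2 else 0)
      \<le> 6 + int (card (representations T B x))^2"
    if "x \<in> T + B" for x
  proof -
    have "1 \<le> card (representations T B x)" by (rule card_representations_pos[OF _ that]) simp
    then consider "card (representations T B x) = 1" | "card (representations T B x) = 2" | "3 \<le> card (representations T B x)"
      by linarith
    then show ?thesis
    proof cases
      case 3
      then have "0 \<le> (int (card (representations T B x)) - 2) * (int (card (representations T B x)) - 3)" by simp
      then show ?thesis using 3 by (simp add: algebra_simps power2_eq_square)
    qed auto
  qed
  then have "(\<Sum>x\<in>T + B. 5 * int (card (representations T B x)) + (if card (representations T B x) = 1 then 2 else 0)) \<le>
      (\<Sum>x\<in>T + B. 6 + int (card (representations T B x))^2)"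
    by (rule sum_mono)
  then show ?thesis
    by (simp add: sum_distrib_left[symmetric] sum.distrib sum_card_representations sum_card_representations_squared
        sum.If_cases Int_def mult.commute mult.left_commute)
qed

lemma overlap_sum_le:
  fixes T B :: "'a::{finite,ab_group_add} set"
  assumes "\<And>t t'. t \<in> T \<Longrightarrow> t' \<in> T \<Longrightarrow> t \<noteq> t' \<Longrightarrow> int (card (overlap (t - t') B)) \<le> \<rho>"
  shows "overlap_sum T B \<le> int (card T) * (int (card T) - 1) * \<rho>"
proof -
  have "(\<Sum>t'\<in>T - {t}. int (card (overlap (t - t') B))) \<le> (int (card T) - 1) * \<rho>" if "t \<in> T" for t
  proof -
    have "(\<Sum>t'\<in>T - {t}. int (card (overlap (t - t') B))) \<le> of_nat (card (T - {t})) * \<rho>"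
      by (rule sum_bounded_above) (use assms that in auto)
    moreover have "1 \<le> card T" using that by (auto simp: Suc_le_eq card_gt_0_iff)
    ultimately show ?thesis using that by simp
  qed
  then have "overlap_sum T B \<le> of_nat (card T) * ((int (card T) - 1) * \<rho>)"
    unfolding overlap_sum_def by (rule sum_bounded_above)
  then show ?thesis by (simp add: mult.assoc)
qed

lemma overlap_sum_commute:
  fixes T B :: "'a::{finite,ab_group_add} set"
  shows "overlap_sum T B = overlap_sum B T"
proof -
  have "card (representations T B x) = card (representations B T x)" for x
  proof (rule bij_betw_same_card[of "\<lambda>t. x - t"])
    show "bij_betw (\<lambda>t. x - t) (representations T B x) (representations B T x)"
      by (rule bij_betw_byWitness[where f' = "\<lambda>t. x - t"]) (auto simp: representations_def)
  qed
  then have "(\<Sum>x\<in>T + B. int (card (representations T B x))^2) = (\<Sum>x\<in>B + T. int (card (representations B T x))^2)"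
    by (simp add: add.commute[of T])
  then show ?thesis by (simp add: sum_card_representations_squared)
qed

section \<open>Sums with two representations\<close>

definition doubly_covered :: "'a::ab_group_add set \<Rightarrow> 'a set \<Rightarrow> bool" where
  "doubly_covered A B \<longleftrightarrow> (\<forall>a\<in>A. \<forall>b\<in>B. \<exists>a'\<in>A. \<exists>b'\<in>B. a' \<noteq> a \<and> a' + b' = a + b)"

lemma doubly_covered_commute: "doubly_covered A B \<longleftrightarrow> doubly_covered B A"
proof -
  have "doubly_covered B A" if d: "doubly_covered A B" for A B :: "'a set"
    unfolding doubly_covered_def
  proof (intro ballI)
    fix b a assume "b \<in> B" "a \<in> A"
    then obtain a' b' where "a' \<in> A" "b' \<in> B" "a' \<noteq> a" "a' + b' = a + b"
      using d unfolding doubly_covered_def by metis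
    moreover from this have "b' \<noteq> b" by auto
    ultimately show "\<exists>b'\<in>B. \<exists>a'\<in>A. b' \<noteq> b \<and> b' + a' = b + a" by (metis add.commute)
  qed
  then show ?thesis by blast
qed

lemma ends_plus_rep:
  assumes "z \<in> ends g (A + B)" "a \<in> A" "b \<in> B" "z = a + b"
  shows "a \<in> ends g A" "b \<in> ends g B"
proof -
  have *: "a + b + g \<notin> A + B" using assms by (auto simp: ends_def)
  have "a + g \<notin> A" using * set_plus_intro[of "a + g" A b B] assms by (auto simp: algebra_simps)
  moreover have "b + g \<notin> B" using * set_plus_intro[of a A "b + g" B] assms by (auto simp: algebra_simps)
  ultimately show "a \<in> ends g A" "b \<in> ends g B" using assms by (auto simp: ends_def)
qed

lemma doubly_covered_ends:
  assumes "doubly_covered A B" "z \<in> ends g (A + B)"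
  obtains a b a' b' where "a \<in> ends g A" "b \<in> ends g B" "a' \<in> ends g A" "b' \<in> ends g B"
    "a \<noteq> a'" "z = a + b" "z = a' + b'"
proof -
  obtain a b where ab: "a \<in> A" "b \<in> B" "z = a + b" using assms(2) by (auto simp: ends_def elim!: set_plus_elim)
  obtain a' b' where ab': "a' \<in> A" "b' \<in> B" "a' \<noteq> a" "a' + b' = a + b"
    using assms(1) ab unfolding doubly_covered_def by metis
  show ?thesis
    using that[of a b a' b'] ends_plus_rep[OF assms(2) ab] ends_plus_rep[OF assms(2) ab'(1,2)] ab ab' by auto
qed

text \<open>With only two ends \<open>\<alpha>\<close>, \<open>\<alpha>'\<close> of
  \<open>A\<close>, every end of \<open>A + B\<close> would be represented through both. By
  cardinality the ends of \<open>A + B\<close> would be exactly \<open>\<alpha> + ends g B\<close>,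
  and then \<open>ends g B\<close> would be invariant under \<open>\<alpha> - \<alpha>'\<close>,
  hence everything.\<close>

lemma card_ends_ge_3:
  fixes A B :: "'p::prime_card mod_ring set"
  assumes d: "doubly_covered A B" and g: "g \<noteq> 0" and ne: "A \<noteq> {}" "B \<noteq> {}" "A + B \<noteq> UNIV" "B \<noteq> UNIV"
    and le: "card (ends g B) \<le> card (ends g (A + B))"
  shows "3 \<le> card (ends g A)"
proof (rule ccontr)
  assume "\<not> 3 \<le> card (ends g A)"
  moreover have "A + B \<noteq> {}" using ne by (auto simp: set_plus_def)
  then obtain z where "z \<in> ends g (A + B)" using ends_nonempty[OF g _ ne(3)] by blast
  then obtain \<alpha> \<alpha>' where \<alpha>: "\<alpha> \<in> ends g A" "\<alpha>' \<in> ends g A" "\<alpha> \<noteq> \<alpha>'"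
    using doubly_covered_ends[OF d] by metis
  then have "2 \<le> card (ends g A)" using card_mono[of "ends g A" "{\<alpha>,\<alpha>'}"] by auto
  ultimately have "card (ends g A) = card {\<alpha>,\<alpha>'}" using \<alpha> by auto
  then have eA: "ends g A = {\<alpha>,\<alpha>'}" using \<alpha> by (intro card_subset_eq[symmetric]) auto
  have both: "z - \<alpha> \<in> ends g B \<and> z - \<alpha>' \<in> ends g B" if z: "z \<in> ends g (A + B)" for z
  proof -
    obtain a b a' b' where *: "a \<in> ends g A" "b \<in> ends g B" "a' \<in> ends g A" "b' \<in> ends g B"
      "a \<noteq> a'" "z = a + b" "z = a' + b'"
      using doubly_covered_ends[OF d z] .
    then have "z - a = b" "z - a' = b'" by (auto simp: diff_eq_eq add.commute)
    then show ?thesis using * eA by auto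
  qed
  then have "ends g (A + B) \<subseteq> (+) \<alpha> ` ends g B"
    by (auto simp: image_iff algebra_simps intro!: bexI[of _ "_ - \<alpha>"])
  moreover have "card ((+) \<alpha> ` ends g B) = card (ends g B)" by (simp add: card_image)
  ultimately have eq: "ends g (A + B) = (+) \<alpha> ` ends g B" using le by (intro card_seteq) auto
  have "ends g B = UNIV"
  proof (rule translation_invariant_eq_UNIV[of "\<alpha> - \<alpha>'"])
    show "ends g B \<noteq> {}" using ends_nonempty[OF g ne(2,4)] .
    show "y + (\<alpha> - \<alpha>') \<in> ends g B" if "y \<in> ends g B" for y
      using both[of "\<alpha> + y"] eq that by (auto simp: algebra_simps)
  qed (use \<alpha> in auto)
  then show False using ne(4) by (auto simp: ends_def)
qed


section \<open>Minimal counterexamples\<close>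

text \<open>Two holes cannot cover three consecutive positions. This replaces
  \<open>difference_run\<close> where the other set contains three consecutive terms but need not be
  an almost interval.\<close>

lemma run_of_three:
  fixes B :: "int set"
  assumes "finite B" "B \<noteq> {}" "width B \<le> int (card B) + 2"
  shows "\<exists>s. \<forall>u. s \<le> u \<and> u < s + width B \<longrightarrow> (\<exists>d\<in>{0,1,2}. \<exists>y\<in>B. u = d - y)"
proof -
  define H where "H = {Min B..Max B} - B"
  have sub: "B \<subseteq> {Min B..Max B}" using assms by auto
  have "card H = card {Min B..Max B} - card B" unfolding H_def using sub assms by (intro card_Diff_subset) auto
  then have "card H \<le> 2" using assms(3) unfolding width_def card_atLeastAtMost_int by linarith
  then have H: "finite H" "card H \<le> 2" by (auto simp: H_def)
  have in_B: "y \<in> B \<or> y \<in> H" if "Min B \<le> y" "y \<le> Max B" for y using that by (auto simp: H_def)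
  have H_bd: "y < Max B" "Min B \<le> y" if "y \<in> H" for y
    using that Max_in[OF assms(1,2)] by (auto simp: H_def order.strict_iff_order)
  have "\<exists>d\<in>{0,1,2}. \<exists>y\<in>B. u = d - y" if "- Max B \<le> u" "u < - Max B + width B" for u
  proof -
    define y where "y = - u"
    have y: "Min B \<le> y" "y \<le> Max B" using that by (auto simp: y_def width_def)
    have "y \<in> B \<or> y + 1 \<in> B \<or> y + 2 \<in> B"
    proof (rule ccontr)
      assume n: "\<not> ?thesis"
      then have "y \<in> H" using in_B y by blast
      then have "y + 1 \<in> H" using in_B[of "y + 1"] H_bd n y by fastforce
      moreover from this have "y + 2 \<in> H" using in_B[of "y + 2"] H_bd(1)[of "y+1"] n y by fastforce
      ultimately show False using three_not_subset_of_card_2[OF H \<open>y \<in> H\<close>] by fastforce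
    qed
    then show ?thesis
    proof (elim disjE)
      assume "y \<in> B" then show ?thesis by (intro bexI[of _ 0] bexI[of _ y]) (auto simp: y_def)
    next
      assume "y + 1 \<in> B" then show ?thesis by (intro bexI[of _ 1] bexI[of _ "y + 1"]) (auto simp: y_def)
    next
      assume "y + 2 \<in> B" then show ?thesis by (intro bexI[of _ 2] bexI[of _ "y + 2"]) (auto simp: y_def)
    qed
  qed
  then show ?thesis by blast
qed

text \<open>An end is the last term or precedes one of at most two holes.\<close>

lemma card_ends_near:
  fixes B :: "'p::prime_card mod_ring set"
  assumes "near r B" "int (card B) + 2 \<le> int CARD('p)" "B \<noteq> {}"
  shows "card (ends r B) \<le> 3"
proof -
  obtain y B0 where B0: "finite B0" "B0 \<noteq> {}" "B = pt r y ` B0" "card B0 = card B" "width B0 \<le> int (card B) + 2"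
    using near_lift_width[OF assms] .
  define H where "H = {Min B0..Max B0} - B0"
  have sub: "B0 \<subseteq> {Min B0..Max B0}" using B0 by auto
  have "card H = card {Min B0..Max B0} - card B0" unfolding H_def using sub B0 by (intro card_Diff_subset) auto
  then have "card H \<le> 2" using B0(4,5) unfolding width_def card_atLeastAtMost_int by linarith
  then have H: "finite H" "card H \<le> 2" by (auto simp: H_def)
  have "ends r B \<subseteq> pt r y ` insert (Max B0) ((\<lambda>i. i - 1) ` H)"
  proof
    fix x assume "x \<in> ends r B"
    then have x: "x \<in> B" "x + r \<notin> B" by (auto simp: ends_def)
    then obtain i where i: "i \<in> B0" "x = pt r y i" using B0 by auto
    have "x + r = pt r y (i + 1)" using i by (simp add: pt_def algebra_simps)
    then have "i + 1 \<notin> B0" using x B0 by auto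
    moreover have "Min B0 \<le> i" "i \<le> Max B0" using i B0 by auto
    ultimately have "i = Max B0 \<or> i + 1 \<in> H" by (auto simp: H_def)
    then have "i \<in> insert (Max B0) ((\<lambda>i. i - 1) ` H)" by (auto simp: image_iff intro!: bexI[of _ "i + 1"])
    then show "x \<in> pt r y ` insert (Max B0) ((\<lambda>i. i - 1) ` H)" using i by blast
  qed
  then have "card (ends r B) \<le> card (pt r y ` insert (Max B0) ((\<lambda>i. i - 1) ` H))" using H by (intro card_mono) auto
  also have "\<dots> \<le> card (insert (Max B0) ((\<lambda>i. i - 1) ` H))" using H by (intro card_image_le) auto
  also have "\<dots> \<le> Suc (card ((\<lambda>i. i - 1) ` H))" by (rule card_insert_le_m1) auto
  also have "\<dots> \<le> Suc (card H)" using H by (simp add: card_image_le)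
  finally show ?thesis using H by linarith
qed

section \<open>Small pairs and the order of minimality\<close>

definition good :: "'p::prime_card mod_ring set \<Rightarrow> 'p mod_ring set \<Rightarrow> bool" where
  "good A B \<longleftrightarrow> (\<exists>r. near r A \<and> near r B)"

text \<open>The conditions are symmetric in \<open>A\<close>, \<open>B\<close> and the complement of
  \<open>A + B\<close>, so that the pair may be replaced by another two of the three sets up to
  sign. The last one says that the three sizes add up to at least \<open>p - 1\<close>. The bounds 9
  exclude the parallelograms of sizes (4, 4).\<close>

definition small_pair :: "'p::prime_card mod_ring set \<Rightarrow> 'p mod_ring set \<Rightarrow> bool" where
  "small_pair A B \<longleftrightarrow> 4 \<le> card A \<and> 4 \<le> card B \<and> 4 \<le> card (- (A + B)) \<and> 9 \<le> card A + card B \<and>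
    9 \<le> card A + card (- (A + B)) \<and> 9 \<le> card B + card (- (A + B)) \<and> card (A + B) \<le> card A + card B + 1"

definition excess :: "'p::prime_card mod_ring set \<Rightarrow> 'p mod_ring set \<Rightarrow> int" where
  "excess A B = int (card (A + B)) - int (card A) - int (card B)"

definition critical :: "'p::prime_card mod_ring set \<Rightarrow> 'p mod_ring set \<Rightarrow> bool" where
  "critical A B \<longleftrightarrow> 53 \<le> CARD('p) \<and> small_pair A B \<and> \<not> good A B \<and>
    (\<forall>X Y :: 'p mod_ring set. small_pair X Y \<longrightarrow> excess X Y < excess A B \<or>
       (excess X Y = excess A B \<and> card X + card Y < card A + card B) \<longrightarrow> good X Y)"

lemma good_commute: "good A B \<longleftrightarrow> good B A"
  by (auto simp: good_def)

lemma small_pair_commute: "small_pair A B \<longleftrightarrow> small_pair B A"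
  by (auto simp: small_pair_def add.commute)

lemma critical_commute: "critical A B \<Longrightarrow> critical B A"
  unfolding critical_def excess_def by (simp add: good_commute[of B] small_pair_commute[of B] add.commute[of B])

lemma critical_minimal:
  fixes A B X Y :: "'p::prime_card mod_ring set"
  assumes "critical A B" "small_pair X Y" "\<not> good X Y"
  shows "excess A B \<le> excess X Y" "excess X Y = excess A B \<Longrightarrow> card A + card B \<le> card X + card Y"
proof -
  have "\<not> (excess X Y < excess A B \<or> (excess X Y = excess A B \<and> card X + card Y < card A + card B))"
    using assms unfolding critical_def by blast
  then show "excess A B \<le> excess X Y" "excess X Y = excess A B \<Longrightarrow> card A + card B \<le> card X + card Y" by auto
qed

lemma card_Compl_mod_ring:
  fixes N :: "'p::prime_card mod_ring set"
  shows "card N + card (- N) = CARD('p)"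
  using card_Un_disjoint[of N "- N"] by (simp add: Compl_partition)

lemma critical_basic:
  fixes A B :: "'p::prime_card mod_ring set"
  assumes "critical A B"
  shows "53 \<le> CARD('p)" "4 \<le> card A" "4 \<le> card B" "9 \<le> card A + card B"
    "card (A + B) \<le> card A + card B + 1" "card A + card B \<le> card (A + B) + 1"
    "card (A + B) + card (- (A + B)) = CARD('p)" "4 \<le> card (- (A + B))" "A + B \<noteq> UNIV" "A \<noteq> {}" "B \<noteq> {}"
    "A \<noteq> UNIV" "B \<noteq> UNIV"
proof -
  show *: "53 \<le> CARD('p)" "4 \<le> card A" "4 \<le> card B" "9 \<le> card A + card B"
    "card (A + B) \<le> card A + card B + 1" "4 \<le> card (- (A + B))"
    using assms by (auto simp: critical_def small_pair_def)
  show **: "A + B \<noteq> UNIV" "A \<noteq> {}" "B \<noteq> {}" using * by auto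
  show "card A + card B \<le> card (A + B) + 1" using Cauchy_Davenport[OF **(2,3,1)] .
  show p: "card (A + B) + card (- (A + B)) = CARD('p)" by (rule card_Compl_mod_ring)
  have "card A < CARD('p)" "card B < CARD('p)" using \<open>card A + card B \<le> card (A + B) + 1\<close> p * by linarith+
  then show "A \<noteq> UNIV" "B \<noteq> UNIV" by auto
qed

text \<open>The pair \<open>(B, C)\<close> with \<open>C = - (complement of A + B)\<close> satisfies the same hypotheses.\<close>

lemma critical_card_le_Compl:
  fixes A B :: "'p::prime_card mod_ring set"
  assumes cr: "critical A B"
  shows "card A \<le> card (- (A + B))"
proof -
  note b = critical_basic[OF cr]
  define C where "C = uminus ` (- (A + B))"
  have cC: "card C = card (- (A + B))" by (simp add: C_def card_image)
  have "B + C \<subseteq> - (uminus ` A)"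
  proof
    fix z assume "z \<in> B + C"
    then obtain y n where z: "y \<in> B" "n \<notin> A + B" "z = y - n" by (auto simp: C_def elim!: set_plus_elim)
    have "z \<noteq> - a" if "a \<in> A" for a
      using set_plus_intro[OF that z(1)] z(2,3) by (auto simp: algebra_simps)
    then show "z \<in> - (uminus ` A)" by auto
  qed
  then have "uminus ` A \<subseteq> - (B + C)" by blast
  then have "card (uminus ` A) \<le> card (- (B + C))" by (rule card_mono[rotated]) simp
  then have AC: "card A \<le> card (- (B + C))" by (simp add: card_image)
  have BC: "card (B + C) + card (- (B + C)) = CARD('p)" by (rule card_Compl_mod_ring)
  have sp: "small_pair B C"
    using cr AC BC b cC by (auto simp: critical_def small_pair_def)
  have "\<not> good B C"
  proof
    assume "good B C"
    then obtain r where r: "near r B" "near r (- (A + B))" by (auto simp: good_def C_def near_uminus)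
    have "near r A"
    proof (rule near_of_disjoint_difference[OF r(2,1)])
      show "v - y \<notin> A" if "v \<in> - (A + B)" "y \<in> B" for v y
        using set_plus_intro[of "v - y" A y B] that by auto
    qed (use cr b in \<open>auto simp: critical_def small_pair_def\<close>)
    then show False using r(1) cr by (auto simp: critical_def good_def)
  qed
  \<comment> \<open>As \<open>B + C\<close> misses \<open>- A\<close>, its excess is at most that of
    \<open>(A, B)\<close>. Minimality makes the two equal, and then
    \<open>card A + card B \<le> card B + card C\<close>.\<close>
  from critical_minimal[OF cr sp this] show ?thesis using AC BC cC b by (auto simp: excess_def)
qed

text \<open>If m is the size of the complement, then |A|, |B| <= m gives 53 <= p <= 3m + 1.\<close>

lemma critical_18_le_Compl:
  assumes "critical A B"
  shows "18 \<le> card (- (A + B))"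
  using critical_card_le_Compl[OF assms] critical_card_le_Compl[OF critical_commute[OF assms]]
    critical_basic[OF assms] by (simp add: add.commute)

text \<open>Let \<open>V\<close> be the complement of \<open>A + B\<close>, so \<open>V - B\<close>
  misses \<open>A\<close>. If \<open>B\<close> is near for \<open>r\<close>, then \<open>V\<close>
  has no three consecutive terms in direction \<open>r\<close>, since otherwise \<open>A\<close>
  would be near for \<open>r\<close> too. So at least half of \<open>V\<close> are ends. Enlarging
  \<open>V\<close> to \<open>V'\<close> by its translate gains at least half its size, and
  \<open>B'\<close> loses at most three elements of \<open>B\<close>. Now \<open>V' - B'\<close>
  still misses \<open>A\<close>, and Cauchy-Davenport gives |V| <= 10, against 18.\<close>

lemma critical_not_near:
  fixes A B :: "'p::prime_card mod_ring set"
  assumes cr: "critical A B"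
  shows "\<not> near r B"
proof
  assume r: "near r B"
  note b = critical_basic[OF cr]
  define V where "V = - (A + B)"
  have V18: "18 \<le> card V" using critical_18_le_Compl[OF cr] by (simp add: V_def)
  have nA: "\<not> near r A" using r cr by (auto simp: critical_def good_def)
  have pB: "int (card B) + 2 \<le> int CARD('p)" using b by linarith
  have VB: "v - y \<notin> A" if "v \<in> V" "y \<in> B" for v y
    using set_plus_intro[of "v - y" A y B] that by (auto simp: V_def)
  have r0: "r \<noteq> 0" using r by (simp add: near_def)
  obtain y B0 where B0: "finite B0" "B0 \<noteq> {}" "B = pt r y ` B0" "card B0 = card B" "width B0 \<le> int (card B) + 2"
    using near_lift_width[OF r pB b(11)] .
  have no3: "\<not> (v \<in> V \<and> v + r \<in> V \<and> v + 2 * r \<in> V)" for v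
  proof
    assume v: "v \<in> V \<and> v + r \<in> V \<and> v + 2 * r \<in> V"
    then have vd: "pt r v d \<in> V" if "d \<in> {0,1,2}" for d using that by (auto simp: pt_def)
    obtain s where s: "\<And>u. s \<le> u \<Longrightarrow> u < s + width B0 \<Longrightarrow> \<exists>d\<in>{0,1,2}. \<exists>y\<in>B0. u = d - y"
      using run_of_three[OF B0(1,2)] B0(4,5) by (metis (no_types, lifting))
    have "pt r (pt r (v - y) s) i \<notin> A" if i: "0 \<le> i" "i < width B0" for i
    proof -
      have "\<exists>d\<in>{0,1,2}. \<exists>y\<in>B0. s + i = d - y" by (rule s) (use i in auto)
      then obtain d w where "d \<in> {0,1,2}" "w \<in> B0" "s + i = d - w" by blast
      then have "pt r (pt r (v - y) s) i = pt r v d - pt r y w" by (simp add: pt_minus_pt pt_add[symmetric])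
      then show ?thesis using VB[OF vd, of d "pt r y w"] B0 \<open>d \<in> {0,1,2}\<close> \<open>w \<in> B0\<close> by auto
    qed
    then have gap: "A \<inter> seg r (pt r (v - y) s) (width B0) = {}" by (auto simp: seg_def)
    have "B \<subseteq> seg r (pt r y (Min B0)) (width B0)"
      unfolding B0(3) by (rule near_lift_subset_seg[OF B0(1)])
    from near_of_small_sumset[OF r0 this B0(5) gap] b nA show False by blast
  qed
  have "V \<subseteq> ends r V \<union> (\<lambda>x. x - r) ` ends r V"
  proof
    fix v assume v: "v \<in> V"
    show "v \<in> ends r V \<union> (\<lambda>x. x - r) ` ends r V"
    proof (cases "v + r \<in> V")
      case True
      then have "v + r + r \<notin> V" using no3[of v] v by (auto simp: algebra_simps)
      then have "v + r \<in> ends r V" using True by (auto simp: ends_def)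
      then show ?thesis by (auto simp: image_iff intro!: bexI[of _ "v + r"])
    qed (use v in \<open>auto simp: ends_def\<close>)
  qed
  then have "card V \<le> card (ends r V \<union> (\<lambda>x. x - r) ` ends r V)" by (intro card_mono) auto
  also have "\<dots> \<le> card (ends r V) + card ((\<lambda>x. x - r) ` ends r V)" by (rule card_Un_le)
  also have "\<dots> \<le> 2 * card (ends r V)" using card_image_le[of "ends r V" "\<lambda>x. x - r"] by simp
  finally have V2: "card V \<le> 2 * card (ends r V)" .
  define B' where "B' = overlap (- r) B"
  define V' where "V' = V \<union> (+) r ` V"
  have B3: "card (ends r B) \<le> 3" using card_ends_near[OF r pB b(11)] .
  have cB': "card B' + card (ends r B) = card B"
    using card_overlap_ends[of B "- r"] card_ends_uminus[of B r] by (simp add: B'_def)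
  have cV': "card V' = card V + card (ends r V)" unfolding V'_def by (rule card_Un_translate) simp
  have "V' + uminus ` B' \<subseteq> - A"
  proof
    fix z assume "z \<in> V' + uminus ` B'"
    then obtain v x where z: "v \<in> V'" "x \<in> B" "x - r \<in> B" "z = v - x"
      by (auto simp: B'_def overlap_def elim!: set_plus_elim)
    show "z \<in> - A"
    proof (cases "v \<in> V")
      case True
      then show ?thesis using VB[of v x] z by simp
    next
      case False
      then obtain w where "w \<in> V" "v = r + w" using z by (auto simp: V'_def)
      then have "z = w - (x - r)" using z by (simp add: algebra_simps)
      then show ?thesis using VB[OF \<open>w \<in> V\<close> z(3)] by simp
    qed
  qed
  then have sub: "card (V' + uminus ` B') \<le> card (- A)" and "V' + uminus ` B' \<noteq> UNIV"
    using b(10) by (auto intro!: card_mono)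
  moreover have "V' \<noteq> {}" using V18 by (auto simp: V'_def)
  moreover have "B' \<noteq> {}" using cB' B3 b(3) by auto
  ultimately have "card V' + card (uminus ` B') \<le> card (V' + uminus ` B') + 1"
    by (intro Cauchy_Davenport) auto
  moreover have "card (uminus ` B') = card B'" by (simp add: card_image)
  moreover have "card A + card (- A) = CARD('p)" by (rule card_Compl_mod_ring)
  ultimately show False using sub cV' cB' B3 V2 V18 b(5,7) unfolding V_def by linarith
qed

section \<open>Consequences of minimality\<close>

text \<open>Since \<open>B\<close> is near for no difference, no pair containing \<open>B\<close> is
  good, and minimality applies to any replacement of \<open>A\<close>.\<close>

lemma critical_replace:
  assumes cr: "critical A B" and "small_pair Y B"
  shows "excess A B \<le> excess Y B" "excess Y B = excess A B \<Longrightarrow> card A \<le> card Y"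
proof -
  have "\<not> good Y B" using critical_not_near[OF cr] by (auto simp: good_def)
  from critical_minimal[OF cr assms(2) this]
  show "excess A B \<le> excess Y B" "excess Y B = excess A B \<Longrightarrow> card A \<le> card Y" by auto
qed

text \<open>If \<open>a + b\<close> had a single representation, deleting \<open>a\<close> would
  lose a sum: the excess would not grow and the size would fall. The size hypotheses keep the
  shrunken pair within \<open>small_pair\<close>.\<close>

lemma critical_doubly_covered_aux:
  fixes A B :: "'p::prime_card mod_ring set"
  assumes cr: "critical A B" and "10 \<le> card A + card B" "5 \<le> card A"
  shows "doubly_covered A B"
  unfolding doubly_covered_def
proof (intro ballI, rule ccontr)
  fix a b assume ab: "a \<in> A" "b \<in> B" and n: "\<not> (\<exists>a'\<in>A. \<exists>b'\<in>B. a' \<noteq> a \<and> a' + b' = a + b)"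
  note c = critical_basic[OF cr]
  have "A - {a} + B \<subset> A + B"
  proof
    show "A - {a} + B \<subseteq> A + B" by (rule set_plus_mono2) auto
    have "a + b \<in> A + B" using ab by blast
    moreover have "a + b \<notin> A - {a} + B"
    proof
      assume "a + b \<in> A - {a} + B"
      then obtain a' b' where "a' \<in> A" "a' \<noteq> a" "b' \<in> B" "a + b = a' + b'" by (blast elim: set_plus_elim)
      then show False using n by metis
    qed
    ultimately show "A - {a} + B \<noteq> A + B" by blast
  qed
  then have less: "card (A - {a} + B) < card (A + B)" by (intro psubset_card_mono) auto
  have cA: "card (A - {a}) = card A - 1" using ab by simp
  have "card (A - {a} + B) + card (- (A - {a} + B)) = CARD('p)" by (rule card_Compl_mod_ring)
  then have "small_pair (A - {a}) B"
    using less cA c assms critical_18_le_Compl[OF cr] unfolding small_pair_def by linarith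
  from critical_replace[OF cr this] show False using less cA assms(3) by (auto simp: excess_def)
qed

lemma critical_doubly_covered:
  assumes cr: "critical A B" and "10 \<le> card A + card B"
  shows "doubly_covered A B"
proof (cases "5 \<le> card A")
  case True
  then show ?thesis using critical_doubly_covered_aux assms by blast
next
  case False
  then have "doubly_covered B A"
    using critical_doubly_covered_aux[OF critical_commute[OF cr]] assms by simp
  then show ?thesis using doubly_covered_commute by blast
qed

text \<open>Submodularity: \<open>A \<inter> (A + g)\<close> and \<open>A \<union> (A + g)\<close> have together at most twice the
  excess of \<open>A\<close>, and a smaller set than \<open>A\<close> has a larger excess.\<close>

lemma critical_card_overlap:
  fixes A B :: "'p::prime_card mod_ring set"
  assumes cr: "critical A B" and g: "g \<noteq> 0" and j: "4 \<le> card (overlap g A)"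
  shows "card (overlap g A) + card B \<le> 8"
proof (rule ccontr)
  assume n: "\<not> ?thesis"
  note c = critical_basic[OF cr]
  let ?Y = "overlap g A" and ?Z = "A \<union> (+) g ` A" and ?N = "A + B"
  have Y: "card ?Y + card (ends g A) = card A" by (rule card_overlap_ends) simp
  have Z: "card ?Z = card A + card (ends g A)" by (rule card_Un_translate) simp
  have N: "card (overlap g ?N) + card (ends g ?N) = card ?N" by (rule card_overlap_ends) simp
  have "?Z + B = ?N \<union> (+) g ` ?N" by (rule Un_translate_plus)
  then have ZB: "card (?Z + B) = card ?N + card (ends g ?N)" by (simp add: card_Un_translate)
  have YB: "card (?Y + B) \<le> card (overlap g ?N)" by (rule card_mono) (use overlap_plus_subset in auto)
  have "0 < card (ends g A)" using ends_nonempty[OF g c(10,12)] by (simp add: card_gt_0_iff)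
  \<comment> \<open>An excess above 1 leaves \<open>small_pair\<close>, but it already exceeds
    \<open>excess A B\<close>, which is at most 1.\<close>
  have Y': "excess A B + 1 \<le> excess ?Y B"
  proof (cases "excess ?Y B \<le> 1")
    case True
    have "card (?Y + B) + card (- (?Y + B)) = CARD('p)" by (rule card_Compl_mod_ring)
    then have "small_pair ?Y B"
      using True j n c N YB critical_18_le_Compl[OF cr] unfolding small_pair_def excess_def by linarith
    from critical_replace[OF cr this] Y \<open>0 < card (ends g A)\<close> show ?thesis by linarith
  next
    case False
    then show ?thesis using c by (simp add: excess_def)
  qed
  then have Z': "excess ?Z B \<le> excess A B - 1"
    using N YB ZB Y Z unfolding excess_def by linarith
  have "card (?Z + B) + card (- (?Z + B)) = CARD('p)" by (rule card_Compl_mod_ring)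
  \<comment> \<open>The complement of \<open>A + B\<close> loses at most
    \<open>card (ends g A) - 1\<close> elements. The ends number at most \<open>card A - 4\<close>
    and \<open>A\<close> is no larger than that complement, so at least five elements
    remain.\<close>
  then have "small_pair ?Z B"
    using Z' Z Y j c critical_card_le_Compl[OF cr] unfolding small_pair_def excess_def by linarith
  from critical_replace(1)[OF cr this] Z' show False by linarith
qed

text \<open>Pair counting for \<open>A\<close> with three elements of \<open>B\<close>. By
  \<open>critical_card_overlap\<close> the overlaps of \<open>A\<close> are at most 3, or at most 4
  when \<open>card B = 4\<close>.\<close>

lemma critical_card_bound_aux:
  fixes A B :: "'p::prime_card mod_ring set"
  assumes cr: "critical A B"
  shows "5 \<le> card B \<Longrightarrow> 2 * card A \<le> card B + 10" "card B = 4 \<Longrightarrow> card A \<le> 8"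
proof -
  note c = critical_basic[OF cr]
  obtain T where T: "T \<subseteq> B" "card T = 3" using obtain_subset_with_card_n[of 3 B] c by auto
  have "T + A \<subseteq> B + A" using T by (intro set_plus_mono2) auto
  then have "T + A \<subseteq> A + B" by (simp only: add.commute[of B A])
  then have TA: "card (T + A) \<le> card (A + B)" by (rule card_mono[rotated]) simp
  have *: "6 * int (card A) \<le> 2 * int (card (A + B)) + 6 * \<rho>"
    if "\<And>g. g \<noteq> 0 \<Longrightarrow> int (card (overlap g A)) \<le> \<rho>" for \<rho>
    using card_plus_ge_by_pairs[of T A] overlap_sum_le[of T A \<rho>] that T TA by simp
  show "2 * card A \<le> card B + 10" if "5 \<le> card B"
  proof -
    have "int (card (overlap g A)) \<le> 3" if "g \<noteq> 0" for g
      using critical_card_overlap[OF cr that] \<open>5 \<le> card B\<close> by linarith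
    from *[OF this] show ?thesis using c by simp
  qed
  show "card A \<le> 8" if "card B = 4"
  proof -
    have "int (card (overlap g A)) \<le> 4" if "g \<noteq> 0" for g
      using critical_card_overlap[OF cr that] \<open>card B = 4\<close> by linarith
    from *[OF this] show ?thesis using c that by simp
  qed
qed

lemma critical_card_le_10:
  assumes "critical A B"
  shows "card A \<le> 10" "card B \<le> 10"
proof -
  note * = critical_card_bound_aux[OF assms] critical_card_bound_aux[OF critical_commute[OF assms]]
    critical_basic(2,3)[OF assms]
  show "card A \<le> 10" "card B \<le> 10" using * by linarith+
qed

text \<open>Otherwise passing from \<open>A\<close> to its union with \<open>A + g\<close> would add
  more elements to the set than to the sumset and lower the excess. The bounds by 10 ensure that the
  complement stays large enough.\<close>

lemma critical_card_ends_le: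
  fixes A B :: "'p::prime_card mod_ring set"
  assumes cr: "critical A B"
  shows "card (ends g A) \<le> card (ends g (A + B))"
proof (rule ccontr)
  assume n: "\<not> ?thesis"
  note c = critical_basic[OF cr] critical_card_le_10[OF cr]
  let ?Z = "A \<union> (+) g ` A" and ?N = "A + B"
  have A: "card (overlap g A) + card (ends g A) = card A" by (rule card_overlap_ends) simp
  have Z: "card ?Z = card A + card (ends g A)" by (rule card_Un_translate) simp
  have "?Z + B = ?N \<union> (+) g ` ?N" by (rule Un_translate_plus)
  then have ZB: "card (?Z + B) = card ?N + card (ends g ?N)" by (simp add: card_Un_translate)
  have "card (?Z + B) + card (- (?Z + B)) = CARD('p)" by (rule card_Compl_mod_ring)
  then have "small_pair ?Z B"
    using Z ZB A n c unfolding small_pair_def by linarith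
  from critical_replace(1)[OF cr this] n Z ZB show False by (simp add: excess_def)
qed

lemma critical_card_ends_ge_3:
  assumes cr: "critical A B" and d: "doubly_covered A B" and g: "g \<noteq> 0"
  shows "3 \<le> card (ends g A)" "3 \<le> card (ends g B)"
proof -
  note c = critical_basic[OF cr]
  have d': "doubly_covered B A" using d doubly_covered_commute by blast
  have "card (ends g B) \<le> card (ends g (A + B))"
    using critical_card_ends_le[OF critical_commute[OF cr]] by (simp add: add.commute)
  then show "3 \<le> card (ends g A)" using card_ends_ge_3[OF d g] c by blast
  show "3 \<le> card (ends g B)"
    using card_ends_ge_3[OF d' g] c critical_card_ends_le[OF cr] by (metis add.commute)
qed


section \<open>Three ends in a common direction\<close>

text \<open>\<open>A\<close> splits into \<open>overlap g A\<close> and the ends for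
  \<open>g\<close>, and also into the translate of \<open>overlap g A\<close> by \<open>g\<close>
  and the ends for \<open>- g\<close>. Comparing the sums of elements brings out a cardinality as a
  coefficient of \<open>g\<close>.\<close>

lemma sum_ends_diff:
  fixes A :: "'p::prime_card mod_ring set"
  shows "\<Sum>(ends g A) - \<Sum>(ends (- g) A) = of_nat (card (overlap g A)) * g"
proof -
  have 1: "A = overlap g A \<union> ends g A" "overlap g A \<inter> ends g A = {}" by (auto simp: overlap_def ends_def)
  have 2: "A = (+) g ` overlap g A \<union> ends (- g) A" "(+) g ` overlap g A \<inter> ends (- g) A = {}"
  proof -
    show "A = (+) g ` overlap g A \<union> ends (- g) A"
    proof
      show "A \<subseteq> (+) g ` overlap g A \<union> ends (- g) A"
      proof
        fix x assume "x \<in> A"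
        then show "x \<in> (+) g ` overlap g A \<union> ends (- g) A"
          by (cases "x - g \<in> A") (auto simp: overlap_def ends_def image_iff intro!: bexI[of _ "x - g"])
      qed
    qed (auto simp: overlap_def ends_def add.commute)
  qed (auto simp: overlap_def ends_def)
  have "\<Sum>A = \<Sum>(overlap g A) + \<Sum>(ends g A)"
    by (subst 1(1), rule sum.union_disjoint) (use 1(2) in auto)
  moreover have "\<Sum>A = \<Sum>((+) g ` overlap g A) + \<Sum>(ends (- g) A)"
    by (subst 2(1), rule sum.union_disjoint) (use 2(2) in auto)
  moreover have "\<Sum>((+) g ` overlap g A) = of_nat (card (overlap g A)) * g + \<Sum>(overlap g A)"
    by (simp add: sum.reindex sum.distrib)
  ultimately show ?thesis by (simp add: algebra_simps)
qed

lemma of_int_mult_eq_0_iff: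
  fixes g :: "'p::prime_card mod_ring"
  assumes "g \<noteq> 0"
  shows "of_int i * g = 0 \<longleftrightarrow> int CARD('p) dvd i"
  using assms by (simp add: of_int_mod_ring_eq_0_iff)

text \<open>This arises from \<open>X = {u, u + h, u + 3h}\<close> and \<open>Y = {v, v + h, v + 2h}\<close> with \<open>w = u + v\<close>, the only
  case in which the three doubly represented sums do not add up to \<open>\<Sum>X + \<Sum>Y\<close>.\<close>

definition shifted_triple :: "'p::prime_card mod_ring set \<Rightarrow> 'p mod_ring set \<Rightarrow> 'p mod_ring set \<Rightarrow> bool" where
  "shifted_triple X Y S \<longleftrightarrow> (\<exists>w h. h \<noteq> 0 \<and> w \<in> X + Y \<and> pt h w 4 \<in> X + Y \<and> S = {pt h w 1, pt h w 2, pt h w 3})"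

lemma shifted_triple_commute: "shifted_triple X Y S \<longleftrightarrow> shifted_triple Y X S"
  by (simp add: shifted_triple_def add.commute)

lemma pt_small_eq_iff:
  fixes r :: "'p::prime_card mod_ring"
  assumes "r \<noteq> 0" "\<bar>i - j\<bar> < int CARD('p)"
  shows "pt r x i = pt r x j \<longleftrightarrow> i = j"
proof -
  have "int CARD('p) dvd i - j \<Longrightarrow> i = j"
    using assms(2) zdvd_not_zless[of "\<bar>i - j\<bar>" "int CARD('p)"] by (cases "i = j") auto
  then show ?thesis using pt_eq_iff[OF assms(1), of x i j] by auto
qed

definition two_reps :: "'a::ab_group_add set \<Rightarrow> 'a set \<Rightarrow> 'a \<Rightarrow> bool" where
  "two_reps X Y s \<longleftrightarrow> (\<exists>x\<in>X. \<exists>x'\<in>X. x \<noteq> x' \<and> s - x \<in> Y \<and> s - x' \<in> Y)"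

lemma two_reps_commute: "two_reps X Y s \<longleftrightarrow> two_reps Y X s"
proof -
  have "two_reps Y X s" if "two_reps X Y s" for X Y :: "'a set"
  proof -
    from that obtain x x' where "x \<in> X" "x' \<in> X" "x \<noteq> x'" "s - x \<in> Y" "s - x' \<in> Y"
      unfolding two_reps_def by blast
    then show ?thesis unfolding two_reps_def by (intro bexI[of _ "s - x"] bexI[of _ "s - x'"]) auto
  qed
  then show ?thesis by blast
qed

text \<open>In units of \<open>\<delta>\<close>, \<open>Y\<close> is 0, 1, 2 and \<open>X\<close> is
  0, 1, k. A doubly represented sum other than 1 and 2 must use k, so k is -2, -1, 2 or 3, and then
  exactly three sums qualify. For k = -1 and k = 2 they add up as claimed; k = 3 and its mirror
  image k = -2 are the exceptional case.\<close>

lemma three_by_three_progression: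
  fixes X Y S :: "'p::prime_card mod_ring set"
  assumes p: "53 \<le> CARD('p)" and \<delta>: "\<delta> \<noteq> 0" and X: "card X = 3" "u \<in> X" "u + \<delta> \<in> X"
    and Y: "Y = {v, v + \<delta>, v + 2 * \<delta>}" and S: "3 \<le> card S" "\<And>s. s \<in> S \<Longrightarrow> two_reps X Y s"
  shows "card S = 3 \<and> (\<Sum>S = \<Sum>X + \<Sum>Y \<or> shifted_triple X Y S)"
proof -
  have eq: "pt \<delta> x i = pt \<delta> x j \<longleftrightarrow> i = j" if "\<bar>i - j\<bar> < 53" for x i j
    by (rule pt_small_eq_iff[OF \<delta>]) (use that p in linarith)
  have inj: "inj_on (pt \<delta> x) I" if I: "I \<subseteq> {-2..4}" for x I
  proof (rule pt_inj_on[OF \<delta>])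
    fix i j assume "i \<in> I" "j \<in> I"
    then have "i \<le> 4" "-2 \<le> j" using I by auto
    then show "i - j < int CARD('p)" using p by linarith
  qed
  have Y': "Y = pt \<delta> v ` {0,1,2}" by (auto simp: Y pt_def)
  have "card (X - {u, u + \<delta>}) = 1" using X \<delta> by (subst card_Diff_subset) auto
  then obtain w where w: "X - {u, u + \<delta>} = {w}" by (auto simp: card_1_singleton_iff)
  then have Xw: "X = {u, u + \<delta>, w}" "w \<noteq> u" "w \<noteq> u + \<delta>" using X by auto
  have "\<not> S \<subseteq> {pt \<delta> (u + v) 1, pt \<delta> (u + v) 2}"
  proof
    assume "S \<subseteq> {pt \<delta> (u + v) 1, pt \<delta> (u + v) 2}"
    then have "card S \<le> card {pt \<delta> (u + v) 1, pt \<delta> (u + v) 2}" by (intro card_mono) auto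
    also have "\<dots> \<le> 2" by (simp add: card_insert_if)
    finally show False using S(1) by simp
  qed
  then obtain s where s: "s \<in> S" "s \<noteq> pt \<delta> (u + v) 1" "s \<noteq> pt \<delta> (u + v) 2" by blast
  obtain x x' where x: "x \<in> X" "x' \<in> X" "x \<noteq> x'" "s - x \<in> Y" "s - x' \<in> Y"
    using S(2)[OF s(1)] unfolding two_reps_def by blast
  have uY: "s - u \<in> Y \<Longrightarrow> s - (u + \<delta>) \<in> Y \<Longrightarrow> False"
  proof -
    assume "s - u \<in> Y" "s - (u + \<delta>) \<in> Y"
    then obtain i j where ij: "i \<in> {0,1,2}" "j \<in> {0,1,2::int}" "s - u = pt \<delta> v i" "s - (u + \<delta>) = pt \<delta> v j"
      unfolding Y' by blast
    then have si: "s = pt \<delta> (u + v) i" "s = pt \<delta> (u + v) (j + 1)" by (simp_all add: pt_def algebra_simps)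
    then have "i = j + 1" using eq[of i "j+1" "u + v"] ij(1,2) by auto
    then show False using si s ij(1,2) by auto
  qed
  have wY: "s - w \<in> Y" and uuY: "s - u \<in> Y \<or> s - (u + \<delta>) \<in> Y" using x uY Xw by auto
  then obtain k where k: "w = pt \<delta> u k" "k \<in> {-2,-1,2,3}"
  proof -
    obtain i where i: "i \<in> {0,1,2}" "s - w = pt \<delta> v i" using wY Y' by blast
    obtain j where j: "j \<in> {0,1,2,3}" "s = pt \<delta> (u + v) j"
    proof -
      from uuY show ?thesis
      proof
        assume "s - u \<in> Y"
        then obtain j where "j \<in> {0,1,2}" "s - u = pt \<delta> v j" unfolding Y' by blast
        then show ?thesis using that[of j] by (auto simp: pt_def algebra_simps)
      next
        assume "s - (u + \<delta>) \<in> Y"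
        then obtain j where "j \<in> {0,1,2}" "s - (u + \<delta>) = pt \<delta> v j" unfolding Y' by blast
        then show ?thesis using that[of "j + 1"] by (auto simp: pt_def algebra_simps)
      qed
    qed
    have "j \<in> {0,3}" using j s by auto
    moreover have wk: "w = pt \<delta> u (j - i)" using i(2) j(2) by (simp add: pt_def algebra_simps)
    moreover have "j - i \<noteq> 0" "j - i \<noteq> 1"
    proof -
      show "j - i \<noteq> 0" using wk Xw(2) by auto
      show "j - i \<noteq> 1"
      proof
        assume "j - i = 1"
        then show False using wk Xw(3) by (simp add: pt_def)
      qed
    qed
    ultimately show ?thesis using that[of "j - i"] i(1) by auto
  qed
  have X': "X = pt \<delta> u ` {0,1,k}" using Xw k by (auto simp: pt_def)
  \<comment> \<open>The index of the first doubly represented sum.\<close>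
  define n where "n = (if k \<in> {-1,-2} then 0 else 1 :: int)"
  have "S \<subseteq> pt \<delta> (u + v) ` {n, n+1, n+2}"
  proof
    fix z assume "z \<in> S"
    then obtain y y' where y: "y \<in> X" "y' \<in> X" "y \<noteq> y'" "z - y \<in> Y" "z - y' \<in> Y"
      using S(2) unfolding two_reps_def by blast
    obtain i i' where i: "i \<in> {0,1,k}" "i' \<in> {0,1,k}" "y = pt \<delta> u i" "y' = pt \<delta> u i'" using y X' by blast
    obtain j j' where j: "j \<in> {0,1,2}" "j' \<in> {0,1,2}" "z - y = pt \<delta> v j" "z - y' = pt \<delta> v j'" using y Y' by blast
    have z: "z = pt \<delta> (u + v) (i + j)" "z = pt \<delta> (u + v) (i' + j')"
      using i j by (simp_all add: pt_def algebra_simps)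
    have ne: "i \<noteq> i'" using i y by auto
    have "-2 \<le> k \<and> k \<le> 3" using k(2) by auto
    then have "-2 \<le> i \<and> i \<le> 3" "-2 \<le> i' \<and> i' \<le> 3" using i(1,2) by auto
    moreover have "0 \<le> j \<and> j \<le> 2" "0 \<le> j' \<and> j' \<le> 2" using j(1,2) by auto
    ultimately have b: "-2 \<le> i" "i \<le> 3" "-2 \<le> i'" "i' \<le> 3" "0 \<le> j" "j \<le> 2" "0 \<le> j'" "j' \<le> 2"
      by blast+
    have "\<bar>i + j - (i' + j')\<bar> < 53" using b by linarith
    then have "i + j = i' + j'" using z eq by metis
    then have "i + j \<in> {n, n+1, n+2}"
      using ne i(1,2) k(2) b unfolding n_def insert_iff empty_iff by (smt (z3))
    then show "z \<in> pt \<delta> (u + v) ` {n, n+1, n+2}" using z by blast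
  qed
  moreover have "card (pt \<delta> (u + v) ` {n, n+1, n+2}) = 3"
  proof -
    have "inj_on (pt \<delta> (u + v)) {n, n+1, n+2}" by (rule inj) (auto simp: n_def)
    then show ?thesis by (simp add: card_image)
  qed
  ultimately have S': "S = pt \<delta> (u + v) ` {n, n+1, n+2}" using S(1) by (intro card_seteq) auto
  then have cS: "card S = 3" using \<open>card (pt \<delta> (u + v) ` {n, n+1, n+2}) = 3\<close> by simp
  have sumS: "\<Sum>S = 3 * (u + v) + of_int (3 * n + 3) * \<delta>"
  proof -
    have "inj_on (pt \<delta> (u + v)) {n, n+1, n+2}" by (rule inj) (auto simp: n_def)
    then have "\<Sum>S = (\<Sum>i\<in>{n,n+1,n+2}. pt \<delta> (u + v) i)" unfolding S' by (simp only: sum.reindex o_def id_def)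
    then show ?thesis by (simp add: pt_def algebra_simps)
  qed
  have sumY: "\<Sum>Y = 3 * v + 3 * \<delta>"
  proof -
    have "inj_on (pt \<delta> v) {0,1,2}" by (rule inj) (auto simp: n_def)
    then have "\<Sum>Y = (\<Sum>i\<in>{0,1,2}. pt \<delta> v i)" unfolding Y' by (simp only: sum.reindex o_def id_def)
    then show ?thesis by (simp add: pt_def algebra_simps)
  qed
  have sumX: "\<Sum>X = 3 * u + of_int (1 + k) * \<delta>"
  proof -
    have "inj_on (pt \<delta> u) {0,1,k}" by (rule inj) (use k in auto)
    then have "\<Sum>X = (\<Sum>i\<in>{0,1,k}. pt \<delta> u i)" unfolding X' by (simp only: sum.reindex o_def id_def)
    then show ?thesis using k by (auto simp: pt_def algebra_simps)
  qed
  consider "k = -1" | "k = 2" | "k = -2" | "k = 3" using k by blast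
  then show ?thesis
  proof cases
    case 1
    then show ?thesis using cS sumS sumX sumY by (simp add: n_def algebra_simps)
  next
    case 2
    then show ?thesis using cS sumS sumX sumY by (simp add: n_def algebra_simps)
  next
    case 3
    have "pt \<delta> u 1 \<in> X" "pt \<delta> u (-2) \<in> X" "pt \<delta> v 2 \<in> Y" "pt \<delta> v 1 \<in> Y" using 3 by (auto simp: X' Y')
    then have "pt \<delta> u 1 + pt \<delta> v 2 \<in> X + Y" "pt \<delta> u (-2) + pt \<delta> v 1 \<in> X + Y" by blast+
    moreover have "pt (- \<delta>) (pt \<delta> (u + v) 3) 4 = pt \<delta> u (-2) + pt \<delta> v 1" "pt \<delta> u 1 + pt \<delta> v 2 = pt \<delta> (u + v) 3"
      by (simp_all add: pt_def algebra_simps)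
    moreover have "S = {pt (- \<delta>) (pt \<delta> (u + v) 3) 1, pt (- \<delta>) (pt \<delta> (u + v) 3) 2, pt (- \<delta>) (pt \<delta> (u + v) 3) 3}"
      unfolding S' using 3 by (auto simp: n_def pt_def algebra_simps)
    ultimately have "shifted_triple X Y S"
      unfolding shifted_triple_def using \<delta> by (intro exI[of _ "pt \<delta> (u + v) 3"] exI[of _ "- \<delta>"]) auto
    then show ?thesis using cS by blast
  next
    case 4
    have "pt \<delta> u 3 \<in> X" "pt \<delta> u 0 \<in> X" "pt \<delta> v 1 \<in> Y" "pt \<delta> v 0 \<in> Y" using 4 by (auto simp only: X' Y' image_insert insert_iff)
    then have "pt \<delta> u 3 + pt \<delta> v 1 \<in> X + Y" "pt \<delta> u 0 + pt \<delta> v 0 \<in> X + Y" by blast+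
    moreover have "pt \<delta> (u + v) 4 = pt \<delta> u 3 + pt \<delta> v 1" "pt \<delta> u 0 + pt \<delta> v 0 = u + v"
      by (simp_all add: pt_def algebra_simps)
    moreover have "S = {pt \<delta> (u + v) 1, pt \<delta> (u + v) 2, pt \<delta> (u + v) 3}"
      unfolding S' using 4 by (simp add: n_def)
    ultimately have "shifted_triple X Y S"
      unfolding shifted_triple_def using \<delta> by (intro exI[of _ "u + v"] exI[of _ \<delta>]) auto
    then show ?thesis using cS by blast
  qed
qed

lemma two_neq_0: "53 \<le> CARD('p) \<Longrightarrow> (2 :: 'p::prime_card mod_ring) \<noteq> 0"
  using of_int_mod_ring_eq_0_iff[of 2, where 'p = 'p] zdvd_not_zless[of 2 "int CARD('p)"] by auto

text \<open>Two sums that use the same \<open>a\<close> and \<open>b\<close> place four differences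
  in the three-element set \<open>Y\<close>. A coincidence among them makes \<open>Y\<close> a
  progression with difference \<open>b - a\<close>.\<close>

lemma three_by_three_shared_pair:
  fixes X Y S :: "'p::prime_card mod_ring set"
  assumes p: "53 \<le> CARD('p)" and X: "card X = 3" "a \<in> X" "b \<in> X" "a \<noteq> b" and Y: "card Y = 3"
    and S: "3 \<le> card S" "\<And>s. s \<in> S \<Longrightarrow> two_reps X Y s"
    and s: "s \<noteq> s'" "s - a \<in> Y" "s - b \<in> Y" "s' - a \<in> Y" "s' - b \<in> Y"
  shows "card S = 3 \<and> (\<Sum>S = \<Sum>X + \<Sum>Y \<or> shifted_triple X Y S)"
proof -
  have *: ?thesis if st: "t - a \<in> Y" "t - b \<in> Y" "t' - a \<in> Y" "t' - b = t - a" for t t'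
  proof -
    define \<delta> where "\<delta> = b - a"
    have \<delta>: "\<delta> \<noteq> 0" using X by (simp add: \<delta>_def)
    have e: "t - a = (t - b) + \<delta>" "t' - a = (t - b) + 2 * \<delta>" using st by (auto simp: \<delta>_def algebra_simps)
    have "2 * \<delta> \<noteq> 0" using \<delta> two_neq_0[OF p] by simp
    then have "2 * \<delta> \<noteq> \<delta>" using \<delta> by (metis add_cancel_right_right mult_2)
    then have "card {t - b, t - b + \<delta>, t - b + 2 * \<delta>} = 3" using \<delta> \<open>2 * \<delta> \<noteq> 0\<close> by simp
    then have "Y = {t - b, t - b + \<delta>, t - b + 2 * \<delta>}"
      using st Y e by (intro card_seteq[symmetric]) auto
    from three_by_three_progression[OF p \<delta> X(1,2) _ this S] show ?thesis using X by (auto simp: \<delta>_def)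
  qed
  have "\<not> card {s - a, s - b, s' - a, s' - b} \<le> 3 \<longrightarrow> False"
    using card_mono[of Y "{s - a, s - b, s' - a, s' - b}"] s Y by auto
  then have "s' - b = s - a \<or> s - b = s' - a" using s(1) X(4) by (auto simp: card_insert_if split: if_splits)
  then show ?thesis using *[of s s'] *[of s' s] s by auto
qed

text \<open>Two representations of \<open>s\<close> leave out one element \<open>f s\<close> of
  \<open>X\<close> and one element \<open>e s\<close> of \<open>Y\<close>, so \<open>2 s\<close>
  equals \<open>(\<Sum>X - f s) + (\<Sum>Y - e s)\<close>. If \<open>f\<close> and \<open>e\<close>
  are injective, they exhaust \<open>X\<close> and \<open>Y\<close>, and summing over
  \<open>S\<close> gives the identity. If not, two sums share a pair.\<close>

lemma three_by_three:
  fixes X Y S :: "'p::prime_card mod_ring set"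
  assumes p: "53 \<le> CARD('p)" and X: "card X = 3" and Y: "card Y = 3"
    and S: "3 \<le> card S" "\<And>s. s \<in> S \<Longrightarrow> two_reps X Y s"
  shows "card S = 3 \<and> (\<Sum>S = \<Sum>X + \<Sum>Y \<or> shifted_triple X Y S)"
proof -
  have "\<exists>f e. \<exists>x x'. X = {x, x', f} \<and> Y = {s - x, s - x', e} \<and> x \<noteq> x' \<and> x \<noteq> f \<and> x' \<noteq> f \<and> s - x \<noteq> e \<and> s - x' \<noteq> e"
    if s: "s \<in> S" for s
  proof -
    obtain x x' where x: "x \<in> X" "x' \<in> X" "x \<noteq> x'" "s - x \<in> Y" "s - x' \<in> Y"
      using S(2)[OF s] unfolding two_reps_def by blast
    have "card (X - {x, x'}) = 1" using X x by (subst card_Diff_subset) auto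
    then obtain f where f: "X - {x, x'} = {f}" by (auto simp: card_1_singleton_iff)
    have "card (Y - {s - x, s - x'}) = 1" using Y x by (subst card_Diff_subset) auto
    then obtain e where e: "Y - {s - x, s - x'} = {e}" by (auto simp: card_1_singleton_iff)
    have "X = {x, x', f}" "Y = {s - x, s - x', e}" "x \<noteq> f" "x' \<noteq> f" "s - x \<noteq> e" "s - x' \<noteq> e"
      using x f e by blast+
    then show ?thesis using x(3) by metis
  qed
  then obtain f e where fe: "\<And>s. s \<in> S \<Longrightarrow> \<exists>x x'. X = {x, x', f s} \<and> Y = {s - x, s - x', e s} \<and>
      x \<noteq> x' \<and> x \<noteq> f s \<and> x' \<noteq> f s \<and> s - x \<noteq> e s \<and> s - x' \<noteq> e s"
    by metis
  have fX: "x \<in> X \<Longrightarrow> x \<noteq> f s \<Longrightarrow> s - x \<in> Y" if "s \<in> S" for s x using fe[OF that] by auto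
  have eY: "y \<in> Y \<Longrightarrow> y \<noteq> e s \<Longrightarrow> s - y \<in> X" if "s \<in> S" for s y using fe[OF that] by auto
  show ?thesis
  proof (cases "inj_on f S \<and> inj_on e S")
    case False
    then consider s s' where "s \<in> S" "s' \<in> S" "s \<noteq> s'" "f s = f s'"
      | s s' where "s \<in> S" "s' \<in> S" "s \<noteq> s'" "e s = e s'"
      unfolding inj_on_def by metis
    then show ?thesis
    proof cases
      case 1
      obtain a b where ab: "X = {a, b, f s}" "a \<noteq> b" "a \<noteq> f s" "b \<noteq> f s" using fe[OF 1(1)] by blast
      show ?thesis
        by (rule three_by_three_shared_pair[OF p X _ _ ab(2) Y S 1(3)])
          (use ab fX[OF 1(1)] fX[OF 1(2)] 1(4) in auto)
    next
      case 2
      obtain x x' where "X = {x, x', f s}" "Y = {s - x, s - x', e s}" "x \<noteq> x'" "s - x \<noteq> e s" "s - x' \<noteq> e s"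
        using fe[OF 2(1)] by blast
      then obtain a b where ab: "Y = {a, b, e s}" "a \<noteq> b" "a \<noteq> e s" "b \<noteq> e s" by (metis diff_left_imp_eq)
      have S': "\<And>s. s \<in> S \<Longrightarrow> two_reps Y X s" using S(2) two_reps_commute by blast
      have "card S = 3 \<and> (\<Sum>S = \<Sum>Y + \<Sum>X \<or> shifted_triple Y X S)"
        by (rule three_by_three_shared_pair[OF p Y _ _ ab(2) X S(1) S' 2(3)])
          (use ab eY[OF 2(1)] eY[OF 2(2)] 2(4) in auto)
      then show ?thesis by (simp add: shifted_triple_commute[of Y] add.commute[of "\<Sum>Y"])
    qed
  next
    case True
    have "f ` S \<subseteq> X" "e ` S \<subseteq> Y" using fe by blast+
    moreover have "card (f ` S) = card S" "card (e ` S) = card S" using True by (simp_all add: card_image)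
    moreover have "card (f ` S) \<le> card X" using \<open>f ` S \<subseteq> X\<close> by (intro card_mono) auto
    ultimately have c: "card S = 3" and "card (f ` S) = card X" "card (e ` S) = card Y" using S(1) X Y by auto
    have fe': "f ` S = X" "e ` S = Y"
      by (rule card_subset_eq; use \<open>f ` S \<subseteq> X\<close> \<open>e ` S \<subseteq> Y\<close> \<open>card (f ` S) = card X\<close> \<open>card (e ` S) = card Y\<close> in simp)+
    have "2 * s = (\<Sum>X - f s) + (\<Sum>Y - e s)" if s: "s \<in> S" for s
    proof -
      obtain x x' where x: "X = {x, x', f s}" "Y = {s - x, s - x', e s}" "x \<noteq> x'" "x \<noteq> f s" "x' \<noteq> f s" "s - x \<noteq> e s" "s - x' \<noteq> e s"
        using fe[OF s] by blast
      have "\<Sum>X = x + x' + f s" by (subst x(1)) (use x(3-) in \<open>simp add: algebra_simps\<close>)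
      moreover have "\<Sum>Y = (s - x) + (s - x') + e s" by (subst x(2)) (use x(3-) in \<open>simp add: algebra_simps\<close>)
      ultimately show ?thesis by (simp add: algebra_simps)
    qed
    then have "(\<Sum>s\<in>S. 2 * s) = (\<Sum>s\<in>S. (\<Sum>X - f s) + (\<Sum>Y - e s))" by (rule sum.cong[OF refl])
    then have "2 * \<Sum>S = 3 * \<Sum>X - sum f S + (3 * \<Sum>Y - sum e S)"
      using c by (simp add: sum_distrib_left[symmetric] sum.distrib sum_subtractf)
    moreover have "sum f S = \<Sum>(f ` S)" "sum e S = \<Sum>(e ` S)"
      using True by (simp_all add: sum.reindex)
    ultimately have "2 * (\<Sum>S - (\<Sum>X + \<Sum>Y)) = 0" by (simp add: fe' algebra_simps)
    then have "\<Sum>S - (\<Sum>X + \<Sum>Y) = 0" using two_neq_0[OF p] by (metis mult_eq_0_iff)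
    then show ?thesis using c by simp
  qed
qed

lemma chain_to_end:
  fixes N :: "'p::prime_card mod_ring set"
  assumes g: "g \<noteq> 0" and x: "x \<in> N" and N: "N \<noteq> UNIV"
  obtains k :: nat where "pt g x (int k) \<in> ends g N" "\<forall>t\<le>k. pt g x (int t) \<in> N"
    "\<forall>t<k. pt g x (int t) \<notin> ends g N" "inj_on (\<lambda>t. pt g x (int t)) {..k}"
proof -
  have step: "pt g x (int t) + g = pt g x (int (Suc t))" for t by (simp add: pt_def algebra_simps)
  have ex: "\<exists>t. pt g x (int t) \<in> ends g N"
  proof (rule ccontr)
    assume n: "\<nexists>t. pt g x (int t) \<in> ends g N"
    have "pt g x (int t) \<in> N" for t
    proof (induction t)
      case (Suc t)
      then show ?case using n step[of t] by (auto simp: ends_def)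
    qed (use x in simp)
    moreover have "\<exists>t. y = pt g x (int t)" for y
    proof -
      obtain i where "0 \<le> i" "y = pt g x i" using pt_obtain[OF g, of 0 y x] by auto
      then show ?thesis by (intro exI[of _ "nat i"]) simp
    qed
    ultimately show False using N by (metis UNIV_eq_I)
  qed
  define k where "k = (LEAST t. pt g x (int t) \<in> ends g N)"
  have k: "pt g x (int k) \<in> ends g N" "\<And>t. t < k \<Longrightarrow> pt g x (int t) \<notin> ends g N"
    unfolding k_def using LeastI_ex[OF ex] not_less_Least by blast+
  have in_N: "pt g x (int t) \<in> N" if "t \<le> k" for t
    using that
  proof (induction t)
    case (Suc t)
    then show ?case using k(2)[of t] step[of t] by (auto simp: ends_def)
  qed (use x in simp)
  \<comment> \<open>After a repetition the walk would repeat itself, so the end would have been met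
    before step \<open>k\<close>.\<close>
  have "inj_on (\<lambda>t. pt g x (int t)) {..k}"
  proof (rule linorder_inj_onI)
    fix t t' assume t: "t < t'" "t' \<in> {..k}"
    show "pt g x (int t) \<noteq> pt g x (int t')"
    proof
      assume "pt g x (int t) = pt g x (int t')"
      then have "pt g x (int (t + (k - t'))) = pt g x (int (t' + (k - t')))"
        by (simp only: of_nat_add pt_add)
      moreover have "t' + (k - t') = k" "t + (k - t') < k" using t by auto
      ultimately show False using k(1) k(2)[of "t + (k - t')"] by metis
    qed
  qed auto
  then show ?thesis using that[of k] k in_N by blast
qed

text \<open>Walks in direction \<open>g\<close> from \<open>w\<close> and from
  \<open>w' = w + 4 h\<close> reach ends \<open>w + i h\<close> and \<open>w + j h\<close>, whence
  \<open>k g = i h\<close> and \<open>k' g = (j - 4) h\<close>. Eliminating \<open>h\<close> makes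
  \<open>i k' + (4 - j) k\<close> a positive multiple of p, which is too small. The bound 13 is the
  largest |A| + |B| + 1 among the sizes to which this is applied: (5, 7), (6, 6) and (4, 8).\<close>

lemma no_shifted_triple_of_ends:
  fixes A B :: "'p::prime_card mod_ring set"
  assumes p: "53 \<le> CARD('p)" and g: "g \<noteq> 0" and N: "card (A + B) \<le> 13"
  shows "\<not> shifted_triple (ends g A) (ends g B) (ends g (A + B))"
proof
  let ?N = "A + B"
  assume "shifted_triple (ends g A) (ends g B) (ends g ?N)"
  then obtain w h where h: "h \<noteq> 0" and wN: "w \<in> ends g A + ends g B" "pt h w 4 \<in> ends g A + ends g B"
    and E: "ends g ?N = {pt h w 1, pt h w 2, pt h w 3}"
    unfolding shifted_triple_def by blast
  have "ends g A + ends g B \<subseteq> ?N" by (rule set_plus_mono2) (auto simp: ends_def)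
  then have w: "w \<in> ?N" "pt h w 4 \<in> ?N" using wN by auto
  have NU: "?N \<noteq> UNIV" using N p by auto
  define w' where "w' = pt h w 4"
  obtain k where k: "pt g w (int k) \<in> ends g ?N" "\<forall>t\<le>k. pt g w (int t) \<in> ?N"
    "\<forall>t<k. pt g w (int t) \<notin> ends g ?N" "inj_on (\<lambda>t. pt g w (int t)) {..k}"
    using chain_to_end[OF g w(1) NU] .
  obtain k' where k': "pt g w' (int k') \<in> ends g ?N" "\<forall>t\<le>k'. pt g w' (int t) \<in> ?N"
    "\<forall>t<k'. pt g w' (int t) \<notin> ends g ?N" "inj_on (\<lambda>t. pt g w' (int t)) {..k'}"
    using chain_to_end[OF g w(2) NU] unfolding w'_def .
  let ?P = "(\<lambda>t. pt g w (int t)) ` {..k}" and ?P' = "(\<lambda>t. pt g w' (int t)) ` {..k'}"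
  have cP: "card ?P = k + 1" "card ?P' = k' + 1" using k(4) k'(4) by (simp_all add: card_image)
  have "card ?P \<le> card ?N" "card ?P' \<le> card ?N" using k(2) k'(2) by (auto intro!: card_mono)
  then have k12: "k \<le> 12" "k' \<le> 12" using cP N by linarith+
  obtain i where i: "i \<in> {1,2,3}" "pt g w (int k) = pt h w i" using k(1) E by blast
  obtain j where j: "j \<in> {1,2,3}" "pt g w' (int k') = pt h w j" using k'(1) E by blast
  have kg: "of_int (int k) * g = of_int i * h" using i(2) by (simp add: pt_def)
  have k'g: "of_int (int k') * g = of_int (j - 4) * h" using j(2) by (simp add: pt_def w'_def algebra_simps)
  have "of_int (i * int k' + (4 - j) * int k) * g = 0"
  proof -
    have "of_int (i * int k' + (4 - j) * int k) * g = of_int i * (of_int (int k') * g) + of_int (4 - j) * (of_int (int k) * g)"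
      by (simp add: algebra_simps)
    also have "\<dots> = 0" unfolding kg k'g by (simp add: algebra_simps)
    finally show ?thesis .
  qed
  then have dvd: "int CARD('p) dvd i * int k' + (4 - j) * int k"
    using of_int_mult_eq_0_iff[OF g] by blast
  have "k \<noteq> 0"
  proof
    assume "k = 0"
    then have "of_int i = (0 :: 'p mod_ring)" using kg h by simp
    then have "int CARD('p) dvd i" by (simp only: of_int_mod_ring_eq_0_iff)
    then show False using i(1) p zdvd_imp_le[of "int CARD('p)" i] by auto
  qed
  have pos: "0 < i * int k' + (4 - j) * int k"
    using i(1) j(1) \<open>k \<noteq> 0\<close> by (intro add_nonneg_pos) auto
  \<comment> \<open>If \<open>i = j\<close>, the value is at most 4 times 12, that is 48. Otherwise
    the walks end differently and are disjoint, so \<open>k + k' \<le> 11\<close> and the value is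
    at most 33.\<close>
  have "i * int k' + (4 - j) * int k < 53"
  proof (cases "i = j")
    case True
    then show ?thesis using i(1) k12 by auto
  next
    case False
    have "?P \<inter> ?P' = {}"
    proof (rule ccontr)
      assume "?P \<inter> ?P' \<noteq> {}"
      then obtain t t' where t: "t \<le> k" "t' \<le> k'" "pt g w (int t) = pt g w' (int t')" by auto
      have shift: "pt g w (int (t + n)) = pt g w' (int (t' + n))" for n
        using t(3) by (simp add: pt_def algebra_simps)
      have "k - t = k' - t'"
      proof (cases "k - t \<le> k' - t'")
        case True
        then have "pt g w' (int (t' + (k - t))) \<in> ends g ?N" using shift[of "k - t"] k(1) t by simp
        then show ?thesis using k'(3)[rule_format, of "t' + (k - t)"] True t by linarith
      next
        case nle: False
        then have "pt g w (int (t + (k' - t'))) \<in> ends g ?N" using shift[of "k' - t'"] k'(1) t by simp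
        then show ?thesis using k(3)[rule_format, of "t + (k' - t')"] nle t by linarith
      qed
      then have "t + (k - t) = k" "t' + (k - t) = k'" using t by simp_all
      then have "pt g w (int k) = pt g w' (int k')" using shift[of "k - t"] by metis
      then have "pt h w i = pt h w j" using i j by simp
      then show False using False pt_small_eq_iff[OF h, of i j w] i(1) j(1) p by auto
    qed
    then have "card (?P \<union> ?P') = k + k' + 2" using cP by (subst card_Un_disjoint) auto
    moreover have "card (?P \<union> ?P') \<le> card ?N" using k(2) k'(2) by (intro card_mono) auto
    ultimately have "int k + int k' \<le> 11" using N by linarith
    moreover have "i * int k' \<le> 3 * int k'" "(4 - j) * int k \<le> 3 * int k" using i(1) j(1) by (auto intro!: mult_right_mono)
    ultimately show ?thesis by linarith
  qed
  then show False using zdvd_imp_le[OF dvd pos] p by linarith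
qed

lemma no_common_three_ends:
  fixes A B :: "'p::prime_card mod_ring set"
  assumes cr: "critical A B" and d: "doubly_covered A B" and g: "g \<noteq> 0" and N: "card (A + B) \<le> 13"
    and le: "card (ends g A) \<le> 3" "card (ends g B) \<le> 3"
  shows False
proof -
  note c = critical_basic[OF cr]
  have *: "card (ends h A) = 3 \<and> card (ends h B) = 3 \<and> card (ends h (A + B)) = 3 \<and>
      \<Sum>(ends h (A + B)) = \<Sum>(ends h A) + \<Sum>(ends h B)" if h: "h = g \<or> h = - g" for h
  proof -
    have h0: "h \<noteq> 0" using h g by auto
    have "card (ends h A) \<le> 3" "card (ends h B) \<le> 3" using le h card_ends_uminus[of A g] card_ends_uminus[of B g] by auto
    then have 3: "card (ends h A) = 3" "card (ends h B) = 3"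
      using critical_card_ends_ge_3[OF cr d h0] by linarith+
    have "3 \<le> card (ends h (A + B))" using critical_card_ends_le[OF cr, of h] 3 by simp
    moreover have "two_reps (ends h A) (ends h B) s" if s: "s \<in> ends h (A + B)" for s
    proof -
      obtain a b a' b' where "a \<in> ends h A" "b \<in> ends h B" "a' \<in> ends h A" "b' \<in> ends h B"
        "a \<noteq> a'" "s = a + b" "s = a' + b'" using doubly_covered_ends[OF d s] .
      moreover from this have "s - a = b" "s - a' = b'" by (simp_all add: diff_eq_eq add.commute)
      ultimately show ?thesis unfolding two_reps_def by metis
    qed
    ultimately show ?thesis
      using three_by_three[OF c(1) 3] no_shifted_triple_of_ends[OF c(1) h0 N] 3 by blast
  qed
  have o: "card (overlap g A) + 3 = card A" "card (overlap g B) + 3 = card B" "card (overlap g (A + B)) + 3 = card (A + B)"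
    using *[of g] card_overlap_ends[of A g] card_overlap_ends[of B g] card_overlap_ends[of "A + B" g] by auto
  have "of_nat (card (overlap g (A + B))) * g = (of_nat (card (overlap g A)) * g) + (of_nat (card (overlap g B)) * g)"
    unfolding sum_ends_diff[symmetric] using *[of g] *[of "- g"] by (simp add: algebra_simps)
  then have "of_int (int (card (overlap g (A + B))) - int (card (overlap g A)) - int (card (overlap g B))) * g = 0"
    by (simp add: algebra_simps)
  then have "int CARD('p) dvd int (card (overlap g (A + B))) - int (card (overlap g A)) - int (card (overlap g B))"
    using of_int_mult_eq_0_iff[OF g] by blast
  \<comment> \<open>The integer is \<open>card (A + B) - card A - card B + 3\<close>, which lies
    between 2 and 4.\<close>
  moreover have "0 < int (card (overlap g (A + B))) - int (card (overlap g A)) - int (card (overlap g B))"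
    "int (card (overlap g (A + B))) - int (card (overlap g A)) - int (card (overlap g B)) < 53"
    using o c by linarith+
  ultimately show False using zdvd_imp_le c(1) by fastforce
qed


section \<open>Sizes of a minimal counterexample\<close>

text \<open>\<open>overlap g A + B\<close> lies in \<open>overlap g (A + B)\<close>, and
  \<open>A + B\<close> has at least as many ends as \<open>A\<close>.\<close>

lemma critical_card_overlap_plus:
  assumes cr: "critical A B"
  shows "card (overlap g A + B) \<le> card B + 1 + card (overlap g A)"
proof -
  have "card (overlap g A + B) \<le> card (overlap g (A + B))"
    by (rule card_mono) (use overlap_plus_subset in auto)
  moreover have "card (overlap g A) + card (ends g A) = card A" "card (overlap g (A + B)) + card (ends g (A + B)) = card (A + B)"
    by (simp_all add: card_overlap_ends)
  ultimately show ?thesis using critical_card_ends_le[OF cr, of g] critical_basic(5)[OF cr] by linarith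
qed

text \<open>\<open>{z, z'} + B\<close> has exactly \<open>card B + card (ends (z' - z) B)\<close>
  elements. This is a source of directions in which \<open>B\<close> has few ends.\<close>

lemma critical_card_ends_of_pair:
  assumes cr: "critical A B" and z: "overlap g A = {z, z'}" "z \<noteq> z'"
  shows "card (ends (z' - z) B) \<le> 3"
proof -
  have "{z, z'} + B = (+) z ` (B \<union> (+) (z' - z) ` B)"
  proof -
    have "{z, z'} + B = (+) z ` B \<union> (+) z' ` B" by (auto simp: set_plus_def)
    moreover have "(+) z ` (+) (z' - z) ` B = (+) z' ` B" by (simp add: image_image add.assoc[symmetric])
    ultimately show ?thesis by (simp only: image_Un)
  qed
  then have "card ({z, z'} + B) = card B + card (ends (z' - z) B)"
    by (simp add: card_image card_Un_translate)
  then show ?thesis using critical_card_overlap_plus[OF cr, of g] z by simp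
qed

text \<open>Two equal differences form a parallelogram, whose other side is repeated as
  well.\<close>

lemma two_le_card_overlap:
  assumes "g \<noteq> 0" "z \<in> overlap g A" "z' \<in> overlap g A"
  shows "{z, z + g} \<subseteq> overlap (z' - z) A" "finite A \<Longrightarrow> 2 \<le> card (overlap (z' - z) A)"
proof -
  show *: "{z, z + g} \<subseteq> overlap (z' - z) A"
    using assms by (auto simp: overlap_def algebra_simps)
  show "2 \<le> card (overlap (z' - z) A)" if "finite A"
    using card_mono[OF _ *] that assms(1) by (simp add: overlap_def)
qed

lemma critical_card_overlap_le_3:
  assumes "critical A B" "5 \<le> card B" "g \<noteq> 0"
  shows "card (overlap g A) \<le> 3"
  using critical_card_overlap[OF assms(1,3)] assms(2) by linarith

text \<open>With overlaps of at most 1, pair counting with five elements of \<open>B\<close> gives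
  4|A| <= |B| + 11. Together with 2|B| <= |A| + 10 this contradicts |A| >= 5.\<close>

lemma critical_not_Sidon:
  fixes A B :: "'p::prime_card mod_ring set"
  assumes cr: "critical A B" and "5 \<le> card A" "5 \<le> card B"
  shows "\<exists>g. g \<noteq> 0 \<and> 2 \<le> card (overlap g A)"
proof (rule ccontr)
  assume n: "\<not> ?thesis"
  then have le: "int (card (overlap g A)) \<le> 1" if "g \<noteq> 0" for g using that by force
  note c = critical_basic[OF cr]
  obtain T where T: "T \<subseteq> B" "card T = 5" using obtain_subset_with_card_n[of 5 B] assms by auto
  have "T + A \<subseteq> B + A" using T by (intro set_plus_mono2) auto
  then have "card (T + A) \<le> card (A + B)" by (simp add: card_mono add.commute[of B])
  moreover have "overlap_sum T A \<le> int (card T) * (int (card T) - 1) * 1" by (rule overlap_sum_le) (use le in auto)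
  ultimately have "5 * card A \<le> card (A + B) + 10" using card_plus_ge_by_pairs[of T A] T by simp
  then show False using critical_card_bound_aux[OF cr] critical_card_bound_aux[OF critical_commute[OF cr]] assms c by linarith
qed

text \<open>Three ends leave an overlap of at most 2, so a repeated difference gives exactly a pair
  \<open>z\<close>, \<open>z'\<close>. In direction \<open>z' - z\<close> both sets then have at
  most three ends.\<close>

lemma critical_card_5_False:
  assumes cr: "critical A B" and "card A = 5" "5 \<le> card B"
  shows False
proof -
  note c = critical_basic[OF cr]
  have d: "doubly_covered A B" using critical_doubly_covered[OF cr] assms by simp
  obtain g where g: "g \<noteq> 0" "2 \<le> card (overlap g A)" using critical_not_Sidon[OF cr] assms by auto
  have "card (overlap g A) \<le> 2"
    using critical_card_ends_ge_3(1)[OF cr d g(1)] card_overlap_ends[of A g] assms by simp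
  then have "card (overlap g A) = 2" using g by simp
  then obtain z z' where z: "overlap g A = {z, z'}" "z \<noteq> z'" by (auto simp: card_2_iff)
  have h: "z' - z \<noteq> 0" using z by simp
  have "2 \<le> card (overlap (z' - z) A)" by (rule two_le_card_overlap(2)[OF g(1)]) (use z in auto)
  then have "card (ends (z' - z) A) \<le> 3" using card_overlap_ends[of A "z' - z"] assms by simp
  moreover have "card (A + B) \<le> 13"
    using critical_card_bound_aux(1)[OF critical_commute[OF cr]] assms c by simp
  ultimately show False
    using no_common_three_ends[OF cr d h] critical_card_ends_of_pair[OF cr z] by blast
qed

text \<open>If the overlap of \<open>A\<close> is a pair, some direction leaves \<open>B\<close>
  with at most three ends and an overlap of at most 3. If it has three elements, pair counting for
  it and \<open>B\<close> gives 4|B| <= 26.\<close>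

lemma critical_card_le_6:
  assumes cr: "critical A B" and "6 \<le> card A" "6 \<le> card B"
  shows "card B \<le> 6"
proof -
  have d: "doubly_covered A B" using critical_doubly_covered[OF cr] assms by simp
  obtain g where g: "g \<noteq> 0" "2 \<le> card (overlap g A)" using critical_not_Sidon[OF cr] assms by auto
  have B3: "card (overlap h B) \<le> 3" if "h \<noteq> 0" for h
    using critical_card_overlap_le_3[OF critical_commute[OF cr] _ that] assms by simp
  have "card (overlap g A) \<le> 3" using critical_card_overlap_le_3[OF cr _ g(1)] assms by simp
  then consider "card (overlap g A) = 2" | "card (overlap g A) = 3" using g by linarith
  then show ?thesis
  proof cases
    case 1
    then obtain z z' where z: "overlap g A = {z, z'}" "z \<noteq> z'" by (auto simp: card_2_iff)
    then show ?thesis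
      using critical_card_ends_of_pair[OF cr z] B3[of "z' - z"] card_overlap_ends[of B "z' - z"] by simp
  next
    case 2
    have "overlap_sum (overlap g A) B \<le> int (card (overlap g A)) * (int (card (overlap g A)) - 1) * 3"
      by (rule overlap_sum_le) (use B3 in force)
    then show ?thesis
      using card_plus_ge_by_pairs[of "overlap g A" B] critical_card_overlap_plus[OF cr, of g] 2 by simp
  qed
qed

lemma overlap_sum_gtD:
  fixes T B :: "'a::{finite,ab_group_add} set"
  assumes "int (card T) * (int (card T) - 1) * \<rho> < overlap_sum T B"
  obtains t t' where "t \<in> T" "t' \<in> T" "t \<noteq> t'" "\<rho> < int (card (overlap (t - t') B))"
  using overlap_sum_le[of T B \<rho>] assms by (meson not_le)

text \<open>The refined count gives \<open>g\<close> with an overlap \<open>Z\<close> of three in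
  \<open>A\<close>. Counting again for \<open>Z\<close> gives a difference \<open>h\<close> of
  \<open>Z\<close> with an overlap of at least three in \<open>B\<close>. Either \<open>h\<close>
  serves both sets, or the overlap of \<open>A\<close> for \<open>h\<close> is just the pair
  \<open>z\<close>, \<open>z + g\<close>, and then \<open>g\<close> serves both.\<close>

lemma critical_card_6_False:
  assumes cr: "critical A B" and "card A = 6" "card B = 6"
  shows False
proof -
  note c = critical_basic[OF cr]
  have d: "doubly_covered A B" using critical_doubly_covered[OF cr] assms by simp
  have N: "card (A + B) \<le> 13" using c assms by simp
  have A3: "card (overlap h A) \<le> 3" if "h \<noteq> 0" for h
    using critical_card_overlap_le_3[OF cr _ that] assms by simp
  have eA: "card (overlap h A) + card (ends h A) = 6" "card (overlap h B) + card (ends h B) = 6" for h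
    using card_overlap_ends[of A h] card_overlap_ends[of B h] assms by simp_all
  have "int (card B) * (int (card B) - 1) * 2 < overlap_sum B A"
    using card_plus_ge_by_pairs_refined[of B A] N assms by (simp add: add.commute[of B])
  then obtain t t' where t: "t \<in> B" "t' \<in> B" "t \<noteq> t'" "2 < int (card (overlap (t - t') A))"
    by (rule overlap_sum_gtD)
  define g where "g = t - t'"
  have g: "g \<noteq> 0" "card (overlap g A) = 3" using t A3[of g] by (auto simp: g_def)
  have gA: "card (ends g A) \<le> 3" using eA(1)[of g] g by simp
  define Z where "Z = overlap g A"
  have "card (Z + B) \<le> 10" using critical_card_overlap_plus[OF cr, of g] g assms by (simp add: Z_def)
  then have "int (card Z) * (int (card Z) - 1) * 2 < overlap_sum Z B"
    using card_plus_ge_by_pairs[of Z B] g assms by (simp add: Z_def)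
  then obtain z' z where z: "z' \<in> Z" "z \<in> Z" "z' \<noteq> z" "2 < int (card (overlap (z' - z) B))"
    by (rule overlap_sum_gtD)
  define h where "h = z' - z"
  have h: "h \<noteq> 0" "card (ends h B) \<le> 3" using z eA(2)[of h] by (auto simp: h_def)
  have hA: "{z, z + g} \<subseteq> overlap h A" "2 \<le> card (overlap h A)"
    unfolding h_def using two_le_card_overlap[OF g(1)] z by (auto simp: Z_def)
  show False
  proof (cases "card (overlap h A) = 3")
    case True
    then show False using no_common_three_ends[OF cr d h(1) N _ h(2)] eA(1)[of h] by simp
  next
    case False
    then have "card (overlap h A) = 2" using hA(2) A3[OF h(1)] by simp
    then have "{z, z + g} = overlap h A" using hA(1) g(1) by (intro card_seteq) auto
    then have "card (ends (z + g - z) B) \<le> 3" using critical_card_ends_of_pair[OF cr, of h z "z + g"] g(1) by simp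
    then show False using no_common_three_ends[OF cr d g(1) N gA] by simp
  qed
qed

text \<open>For \<open>card B \<le> 8\<close> the refined count finds a difference of
  \<open>A\<close> in which \<open>B\<close> has at most three ends. Being a difference of
  \<open>A\<close>, it leaves \<open>A\<close> with at most three of its four elements as
  ends.\<close>

lemma critical_card_4_False:
  assumes cr: "critical A B" and "card A = 4" "6 \<le> card B"
  shows False
proof -
  note c = critical_basic[OF cr]
  have d: "doubly_covered A B" using critical_doubly_covered[OF cr] assms by simp
  have b8: "card B \<le> 8" using critical_card_bound_aux(2)[OF critical_commute[OF cr]] assms by simp
  have "int (card A) * (int (card A) - 1) * (int (card B) - 4) < overlap_sum A B"
    using card_plus_ge_by_pairs_refined[of A B] c b8 assms by simp
  then obtain t t' where t: "t \<in> A" "t' \<in> A" "t \<noteq> t'" "int (card B) - 4 < int (card (overlap (t - t') B))"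
    by (rule overlap_sum_gtD)
  have "t' \<in> overlap (t - t') A" using t by (simp add: overlap_def)
  then have "1 \<le> card (overlap (t - t') A)" by (auto simp: Suc_le_eq card_gt_0_iff)
  then show False
    using no_common_three_ends[OF cr d, of "t - t'"] t b8 c assms
      card_overlap_ends[of A "t - t'"] card_overlap_ends[of B "t - t'"] by simp
qed

lemma doubly_coveredI:
  fixes A B :: "'a::{finite,ab_group_add} set"
  assumes "\<And>x. x \<in> A + B \<Longrightarrow> card (representations A B x) \<noteq> 1"
  shows "doubly_covered A B"
  unfolding doubly_covered_def
proof (intro ballI)
  fix a b assume ab: "a \<in> A" "b \<in> B"
  then have aR: "a \<in> representations A B (a + b)" by (simp add: representations_def)
  have "card (representations A B (a + b)) \<noteq> 1" using assms ab by blast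
  then have "representations A B (a + b) \<noteq> {a}" by auto
  then obtain a' where "a' \<in> representations A B (a + b)" "a' \<noteq> a" using aR by blast
  then show "\<exists>a'\<in>A. \<exists>b'\<in>B. a' \<noteq> a \<and> a' + b' = a + b"
    by (intro bexI[of _ a'] bexI[of _ "a + b - a'"]) (auto simp: representations_def)
qed

text \<open>Minimality gives no second representations at these sizes, but the refined count does:
  80 + 2u <= 60 + 20, where u is the number of uniquely represented sums.\<close>

lemma critical_4_5_Sidon_False:
  assumes cr: "critical A B" and "card A = 4" "card B = 5"
    and Sidon: "\<And>g. g \<noteq> 0 \<Longrightarrow> card (overlap g A) \<le> 1"
  shows False
proof -
  note c = critical_basic[OF cr]
  have "overlap_sum B A \<le> int (card B) * (int (card B) - 1) * 1" by (rule overlap_sum_le) (use Sidon in force)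
  then have le: "overlap_sum A B \<le> 20" using assms by (simp add: overlap_sum_commute[of A])
  have N: "card (A + B) \<le> 10" using c assms by simp
  note ge = card_plus_ge_by_pairs_refined[of A B]
  then have "80 + 2 * int (card {x \<in> A + B. card (representations A B x) = 1}) \<le> 6 * int (card (A + B)) + overlap_sum A B"
    using assms by simp
  then have "card {x \<in> A + B. card (representations A B x) = 1} = 0" using le N by linarith
  then have d: "doubly_covered A B" by (intro doubly_coveredI) auto
  have "int (card A) * (int (card A) - 1) * 1 < overlap_sum A B" using ge N assms by simp
  then obtain t t' where t: "t \<in> A" "t' \<in> A" "t \<noteq> t'" "1 < int (card (overlap (t - t') B))"
    by (rule overlap_sum_gtD)
  have "t' \<in> overlap (t - t') A" using t by (simp add: overlap_def)
  then have "1 \<le> card (overlap (t - t') A)" by (auto simp: Suc_le_eq card_gt_0_iff)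
  then show False
    using no_common_three_ends[OF cr d, of "t - t'"] t N assms
      card_overlap_ends[of A "t - t'"] card_overlap_ends[of B "t - t'"] by simp
qed

lemma critical_cards:
  assumes cr: "critical A B" and "card A \<le> card B"
  shows "card A = 4 \<and> card B = 5"
proof (rule ccontr)
  assume n: "\<not> ?thesis"
  note c = critical_basic[OF cr]
  consider "card A = 4" "6 \<le> card B" | "card A = 5" "5 \<le> card B" | "6 \<le> card A" "6 \<le> card B"
    using n c assms(2) by linarith
  then show False
  proof cases
    case 3
    have "card B \<le> 6" "card A \<le> 6"
      using critical_card_le_6[OF cr 3] critical_card_le_6[OF critical_commute[OF cr] 3(2,1)] by auto
    then show False using critical_card_6_False[OF cr] 3 by simp
  qed (use critical_card_4_False[OF cr] critical_card_5_False[OF cr] in auto)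
qed


section \<open>Four and five elements\<close>

definition row :: "'p::prime_card mod_ring \<Rightarrow> 'p mod_ring set \<Rightarrow> 'p mod_ring \<Rightarrow> int \<Rightarrow> bool" where
  "row g X u n \<longleftrightarrow> 1 \<le> n \<and> seg g u n \<subseteq> X \<and> u - g \<notin> X \<and> pt g u n \<notin> X"

lemma card_seg:
  fixes u :: "'p::prime_card mod_ring"
  assumes "g \<noteq> 0" "0 \<le> n" "n \<le> int CARD('p)"
  shows "int (card (seg g u n)) = n"
proof -
  have "inj_on (pt g u) {0..<n}" by (rule pt_inj_on[OF assms(1)]) (use assms in auto)
  then show ?thesis using assms by (simp add: seg_def card_image)
qed

lemma card_row:
  fixes u :: "'p::prime_card mod_ring"
  assumes "g \<noteq> 0" "row g X u n"
  shows "int (card (seg g u n)) = n"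
proof (rule card_seg[OF assms(1)])
  show "0 \<le> n" using assms by (simp add: row_def)
  show "n \<le> int CARD('p)"
  proof (rule ccontr)
    assume "\<not> ?thesis"
    then have "seg g u n = UNIV" using pt_surj[OF assms(1), of u 0] seg_mono[of "int CARD('p)" n g u] by (auto simp: seg_def)
    then show False using assms(2) by (auto simp: row_def)
  qed
qed

lemma row_last_in_ends: "row g X u n \<Longrightarrow> pt g u (n - 1) \<in> ends g X"
proof -
  assume r: "row g X u n"
  then have "pt g u (n - 1) \<in> X" by (auto simp: row_def seg_def)
  moreover have "pt g u (n - 1) + g = pt g u n" by (simp add: pt_def algebra_simps)
  ultimately show ?thesis using r by (simp add: row_def ends_def)
qed

text \<open>The row is found by walking back from \<open>e\<close>. The last conclusion places every
  backward walk inside \<open>X\<close> in this row, so that the rows of all ends cover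
  \<open>X\<close>.\<close>

lemma row_of_end:
  fixes X :: "'p::prime_card mod_ring set"
  assumes g: "g \<noteq> 0" and e: "e \<in> ends g X" and X: "X \<noteq> UNIV"
  obtains u n where "row g X u n" "pt g u (n - 1) = e"
    "\<forall>k::nat. (\<forall>t\<le>k. pt (- g) e (int t) \<in> X) \<longrightarrow> pt (- g) e (int k) \<in> seg g u n"
proof -
  have eX: "e \<in> X" "e + g \<notin> X" using e by (auto simp: ends_def)
  have mg: "- g \<noteq> 0" using g by simp
  obtain k where k: "pt (- g) e (int k) \<in> ends (- g) X" "\<forall>t\<le>k. pt (- g) e (int t) \<in> X"
    "\<forall>t<k. pt (- g) e (int t) \<notin> ends (- g) X" "inj_on (\<lambda>t. pt (- g) e (int t)) {..k}"
    using chain_to_end[OF mg eX(1) X] .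
  define u where "u = pt (- g) e (int k)"
  have ue: "pt g u i = pt (- g) e (int k - i)" for i by (simp add: u_def pt_def algebra_simps)
  have sub: "seg g u (int k + 1) \<subseteq> X"
  proof
    fix x assume "x \<in> seg g u (int k + 1)"
    then obtain i where i: "0 \<le> i" "i < int k + 1" "x = pt g u i" by (auto simp: seg_def)
    then have "x = pt (- g) e (int (nat (int k - i)))" by (simp add: ue)
    then show "x \<in> X" using k(2)[rule_format, of "nat (int k - i)"] i by simp
  qed
  have "u - g \<notin> X" using k(1) by (auto simp: ends_def u_def)
  moreover have "pt g u (int k + 1) = e + g" by (simp add: u_def pt_def algebra_simps)
  then have "pt g u (int k + 1) \<notin> X" using eX(2) by simp
  ultimately have r: "row g X u (int k + 1)" using sub by (simp add: row_def)
  have in_seg: "pt (- g) e (int l) \<in> seg g u (int k + 1)" if l: "\<forall>t\<le>l. pt (- g) e (int t) \<in> X" for l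
  proof -
    have "l \<le> k"
    proof (rule ccontr)
      assume "\<not> l \<le> k"
      then have "pt (- g) e (int (Suc k)) \<in> X" using l by (metis not_less_eq_eq)
      moreover have "pt (- g) e (int (Suc k)) = u - g" by (simp add: u_def pt_def algebra_simps)
      ultimately show False using \<open>u - g \<notin> X\<close> by simp
    qed
    moreover have "pt (- g) e (int l) = pt g u (int k - int l)" by (simp add: ue)
    ultimately show ?thesis by (auto simp: seg_def)
  qed
  show ?thesis by (rule that[OF r]) (use in_seg in \<open>auto simp: ue\<close>)
qed

text \<open>Every point walks forward to an end, so there are no more rows than ends;
  \<open>m = 0\<close> stands for an absent second row.\<close>

lemma rows_of_two_ends:
  fixes X :: "'p::prime_card mod_ring set"
  assumes g: "g \<noteq> 0" and X: "X \<noteq> {}" "X \<noteq> UNIV" and c: "card (ends g X) \<le> 2"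
  obtains u n v m where "row g X u n" "m = 0 \<or> row g X v m" "X = seg g u n \<union> seg g v m"
    "seg g u n \<inter> seg g v m = {}" "0 \<le> m" "m \<le> n" "int (card X) = n + m"
proof -
  have cover: "\<exists>e\<in>ends g X. \<exists>k::nat. x = pt (- g) e (int k) \<and> (\<forall>t\<le>k. pt (- g) e (int t) \<in> X)" if x: "x \<in> X" for x
  proof -
    obtain k where k: "pt g x (int k) \<in> ends g X" "\<forall>t\<le>k. pt g x (int t) \<in> X"
      "\<forall>t<k. pt g x (int t) \<notin> ends g X" "inj_on (\<lambda>t. pt g x (int t)) {..k}"
      using chain_to_end[OF g x X(2)] .
    have "pt (- g) (pt g x (int k)) (int t) \<in> X" if "t \<le> k" for t
    proof -
      have "pt (- g) (pt g x (int k)) (int t) = pt g x (int (k - t))"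
        using that by (simp add: pt_def algebra_simps of_nat_diff)
      then show ?thesis using k(2) by simp
    qed
    moreover have "x = pt (- g) (pt g x (int k)) (int k)" by (simp add: pt_def)
    ultimately show ?thesis using k(1) by blast
  qed
  obtain e where e: "e \<in> ends g X" using ends_nonempty[OF g X] by blast
  obtain u n where u: "row g X u n" "pt g u (n - 1) = e"
    "\<forall>k::nat. (\<forall>t\<le>k. pt (- g) e (int t) \<in> X) \<longrightarrow> pt (- g) e (int k) \<in> seg g u n"
    using row_of_end[OF g e X(2)] .
  have n: "1 \<le> n" "seg g u n \<subseteq> X" using u(1) by (auto simp: row_def)
  show ?thesis
  proof (cases "ends g X = {e}")
    case True
    have "X \<subseteq> seg g u n"
    proof
      fix x assume "x \<in> X"
      then obtain e'' k where "e'' \<in> ends g X" "x = pt (- g) e'' (int k)" "\<forall>t\<le>k. pt (- g) e'' (int t) \<in> X"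
        using cover by blast
      then show "x \<in> seg g u n" using u(3) True by auto
    qed
    then have "X = seg g u n" using n by blast
    moreover from this have "int (card X) = n" using card_row[OF g u(1)] by simp
    ultimately show ?thesis using that[of u n 0 0] u(1) n by (simp add: seg_def)
  next
    case False
    then obtain e' where e': "e' \<in> ends g X" "e' \<noteq> e" using e by blast
    have "{e, e'} = ends g X" using e e' c by (intro card_seteq) auto
    obtain v m where v: "row g X v m" "pt g v (m - 1) = e'"
      "\<forall>k::nat. (\<forall>t\<le>k. pt (- g) e' (int t) \<in> X) \<longrightarrow> pt (- g) e' (int k) \<in> seg g v m"
      using row_of_end[OF g e'(1) X(2)] .
    have m: "1 \<le> m" "seg g v m \<subseteq> X" using v(1) by (auto simp: row_def)
    have "X \<subseteq> seg g u n \<union> seg g v m"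
    proof
      fix x assume "x \<in> X"
      then obtain e'' k where "e'' \<in> {e, e'}" "x = pt (- g) e'' (int k)" "\<forall>t\<le>k. pt (- g) e'' (int t) \<in> X"
        using cover \<open>{e, e'} = ends g X\<close> by blast
      then show "x \<in> seg g u n \<union> seg g v m" using u(3) v(3) by auto
    qed
    then have XX: "X = seg g u n \<union> seg g v m" using n m by blast
    have disj: "seg g u n \<inter> seg g v m = {}"
    proof (rule ccontr)
      assume "seg g u n \<inter> seg g v m \<noteq> {}"
      then obtain i j where ij: "0 \<le> i" "i < n" "0 \<le> j" "j < m" "pt g u i = pt g v j"
        by (auto simp: seg_def)
      have shift: "pt g u (i + l) = pt g v (j + l)" for l using ij(5) by (simp add: pt_add)
      \<comment> \<open>Rows that meet run in parallel, and the one with the shorter remainder would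
        stop inside the other.\<close>
      have "n - i = m - j"
      proof (rule ccontr)
        assume ne: "n - i \<noteq> m - j"
        show False
        proof (cases "n - i < m - j")
          case True
          have "pt g u n = pt g v (j + (n - i))" using shift[of "n - i"] by simp
          moreover have "pt g v (j + (n - i)) \<in> seg g v m" using True ij by (auto simp: seg_def)
          ultimately show False using u(1) m by (auto simp: row_def)
        next
          case nl: False
          have "pt g v m = pt g u (i + (m - j))" using shift[of "m - j"] by simp
          moreover have "pt g u (i + (m - j)) \<in> seg g u n" using nl ne ij by (auto simp: seg_def)
          ultimately show False using v(1) n by (auto simp: row_def)
        qed
      qed
      then have "pt g u (n - 1) = pt g v (m - 1)" using shift[of "n - i - 1"] by (simp add: algebra_simps)
      then show False using u(2) v(2) e'(2) by simp
    qed
    have cX: "int (card X) = n + m"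
      using card_row[OF g u(1)] card_row[OF g v(1)] disj XX by (simp add: card_Un_disjoint)
    show ?thesis
    proof (cases "m \<le> n")
      case True
      then show ?thesis using that[of u n m v] u(1) v(1) XX disj cX m by simp
    next
      case False
      then show ?thesis using that[of v m n u] u(1) v(1) XX disj cX n by (simp add: Un_commute Int_commute add.commute)
    qed
  qed
qed

text \<open>Overlaps for \<open>y\<close> are split by the rows in which they start and arrive. A
  nonempty piece expresses \<open>y\<close> through \<open>v - u\<close> and \<open>f\<close>, and
  its size bounds the coefficient of \<open>f\<close>.\<close>

definition crossing :: "'p::prime_card mod_ring \<Rightarrow> 'p mod_ring \<Rightarrow> 'p mod_ring \<Rightarrow> int \<Rightarrow> 'p mod_ring \<Rightarrow> int \<Rightarrow> 'p mod_ring set" where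
  "crossing f y u n v m = {x \<in> seg f u n. x + y \<in> seg f v m}"

lemma crossing_nonemptyD:
  assumes "crossing f y u n v m \<noteq> {}"
  obtains a where "y = pt f (v - u) a" "- n < a" "a < m"
proof -
  obtain i j where ij: "0 \<le> i" "i < n" "0 \<le> j" "j < m" "pt f u i + y = pt f v j"
    using assms by (auto simp: crossing_def seg_def)
  have "y = pt f (v - u) (j - i)" using ij(5) by (simp add: pt_def algebra_simps)
  then show ?thesis using that[of "j - i"] ij by simp
qed

lemma card_crossing_le:
  fixes f y u v :: "'p::prime_card mod_ring"
  assumes p: "53 \<le> CARD('p)" and f: "f \<noteq> 0"
  shows "int (card (crossing f y u n v m)) \<le> max 0 n" "int (card (crossing f y u n v m)) \<le> max 0 m"
    and "crossing f y u n v m \<noteq> {} \<Longrightarrow> y = pt f (v - u) a \<Longrightarrow> \<bar>a\<bar> \<le> 10 \<Longrightarrow> n \<le> 10 \<Longrightarrow> m \<le> 10 \<Longrightarrow>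
      int (card (crossing f y u n v m)) \<le> m - a \<and> int (card (crossing f y u n v m)) \<le> n + a"
proof -
  have seg_le: "card (seg f x l) \<le> nat l" for x l
    using card_image_le[of "{0..<l}" "pt f x"] by (simp add: seg_def)
  have "card (crossing f y u n v m) \<le> card (seg f u n)" by (rule card_mono) (auto simp: crossing_def)
  then show "int (card (crossing f y u n v m)) \<le> max 0 n" using seg_le[of u n] by simp
  have "card (crossing f y u n v m) = card ((+) y ` crossing f y u n v m)" by (simp add: card_image)
  also have "\<dots> \<le> card (seg f v m)" by (rule card_mono) (auto simp: crossing_def add.commute)
  finally show "int (card (crossing f y u n v m)) \<le> max 0 m" using seg_le[of v m] by simp
  show "int (card (crossing f y u n v m)) \<le> m - a \<and> int (card (crossing f y u n v m)) \<le> n + a"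
    if ne: "crossing f y u n v m \<noteq> {}" and y: "y = pt f (v - u) a" and bd: "\<bar>a\<bar> \<le> 10" "n \<le> 10" "m \<le> 10"
  proof -
    have *: "crossing f y u n v m \<subseteq> pt f u ` {max 0 (- a)..<min n (m - a)}"
    proof
      fix x assume "x \<in> crossing f y u n v m"
      then obtain i j where ij: "0 \<le> i" "i < n" "0 \<le> j" "j < m" "x = pt f u i" "pt f u i + y = pt f v j"
        by (auto simp: crossing_def seg_def)
      have "pt f v (i + a) = pt f v j" using ij(6) y by (simp add: pt_def algebra_simps)
      moreover have "\<bar>i + a - j\<bar> < int CARD('p)" using ij bd p by linarith
      ultimately have "i + a = j" using pt_small_eq_iff[OF f] by blast
      then show "x \<in> pt f u ` {max 0 (- a)..<min n (m - a)}" using ij by auto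
    qed
    then have "card (crossing f y u n v m) \<le> card (pt f u ` {max 0 (- a)..<min n (m - a)})" by (rule card_mono[rotated]) simp
    also have "\<dots> \<le> nat (min n (m - a) - max 0 (- a))" using card_image_le[of "{max 0 (- a)..<min n (m - a)}" "pt f u"] by simp
    finally have "card (crossing f y u n v m) \<le> nat (min n (m - a) - max 0 (- a))" .
    moreover have "0 < card (crossing f y u n v m)" using ne by (simp add: card_gt_0_iff)
    ultimately show ?thesis by linarith
  qed
qed

lemma card_Un4_le: "finite A \<Longrightarrow> X \<subseteq> A \<union> B \<union> (C \<union> D) \<Longrightarrow> finite B \<Longrightarrow> finite C \<Longrightarrow> finite D \<Longrightarrow>
    card X \<le> card A + card B + (card C + card D)"
  using card_mono[of "A \<union> B \<union> (C \<union> D)" X] card_Un_le[of "A \<union> B" "C \<union> D"] card_Un_le[of A B] card_Un_le[of C D]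
  by simp

text \<open>Translation by \<open>y\<close> keeps at least \<open>card Y - 3\<close> points in
  \<open>Y\<close>. A crossing from a row to itself makes \<open>y\<close> a multiple of
  \<open>f\<close>. Without one, \<open>y = (v - u) + a f\<close> and
  \<open>y = (u - v) + a' f\<close>, hence \<open>2 y = (a + a') f\<close>, and the sizes of the two
  crossings give \<open>\<bar>a + a'\<bar> \<le> 3\<close>.\<close>

lemma two_rows_almost_periodic:
  fixes Y :: "'p::prime_card mod_ring set"
  assumes p: "53 \<le> CARD('p)" and f: "f \<noteq> 0" and Y: "card Y = 7 \<or> card Y = 8" "card (ends f Y) \<le> 2"
    and y: "card (ends y Y) \<le> 3"
  shows "(\<exists>k. \<bar>k\<bar> \<le> 4 \<and> y = pt f 0 k) \<or> (\<exists>k. \<bar>k\<bar> \<le> 3 \<and> 2 * y = pt f 0 k)"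
proof -
  have Y': "Y \<noteq> {}" "Y \<noteq> UNIV" using Y(1) p by auto
  obtain u n v m where r: "row f Y u n" "m = 0 \<or> row f Y v m" "Y = seg f u n \<union> seg f v m"
    "seg f u n \<inter> seg f v m = {}" "0 \<le> m" "m \<le> n" "int (card Y) = n + m"
    using rows_of_two_ends[OF f Y' Y(2)] .
  let ?c11 = "crossing f y u n u n" and ?c12 = "crossing f y u n v m"
  let ?c21 = "crossing f y v m u n" and ?c22 = "crossing f y v m v m"
  have nm: "n + m = 7 \<or> n + m = 8" "n \<le> 10" "m \<le> 4" "m \<le> 10" "4 \<le> n" using r Y(1) by linarith+
  have "overlap y Y \<subseteq> ?c11 \<union> ?c12 \<union> (?c21 \<union> ?c22)"
    using r(3) by (auto simp: overlap_def crossing_def)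
  then have le: "card (overlap y Y) \<le> card ?c11 + card ?c12 + (card ?c21 + card ?c22)"
    by (intro card_Un4_le) auto
  have ge: "n + m - 3 \<le> int (card (overlap y Y))" using card_overlap_ends[of Y y] y r(7) by simp
  note b = card_crossing_le[OF p f, where y = y]
  have b12: "int (card ?c12) \<le> m" "int (card ?c21) \<le> m" using b(2)[of u n v m] b(1)[of v m u n] r(5) by simp_all
  show ?thesis
  proof (cases "?c11 = {}")
    case ne: False
    obtain k where k: "y = pt f (u - u) k" "- n < k" "k < n" using crossing_nonemptyD[OF ne] .
    show ?thesis
    proof (cases "\<bar>k\<bar> \<le> 4")
      case True
      then show ?thesis using k by auto
    next
      case False
      have c11: "int (card ?c11) \<le> n - k" "int (card ?c11) \<le> n + k" using b(3)[OF ne k(1)] k nm by auto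
      have "?c22 = {}"
      proof (rule ccontr)
        assume "?c22 \<noteq> {}"
        then obtain k' where k': "y = pt f (v - v) k'" "- m < k'" "k' < m" by (rule crossing_nonemptyD)
        then have "pt f 0 k = pt f 0 k'" using k by simp
        moreover have "\<bar>k - k'\<bar> < int CARD('p)" using k k' nm p by linarith
        ultimately have "k = k'" using pt_small_eq_iff[OF f] by blast
        then show False using False k' nm by linarith
      qed
      then have "n + m - 3 \<le> int (card ?c11) + int (card ?c12) + int (card ?c21)" using le ge by simp
      \<comment> \<open>\<open>\<bar>k\<bar> < n\<close> and
        \<open>\<bar>k\<bar> \<le> m + 3\<close> leave only this case. Its crossings force
        \<open>\<bar>a + a'\<bar> \<le> 4\<close>, while \<open>2 k = a + a'\<close> would be 10 in
        absolute value.\<close>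
      then have eqs: "int (card ?c12) = 2" "int (card ?c21) = 2" "n = 6" "m = 2" "\<bar>k\<bar> = 5"
        using c11 b12 nm False k(2,3) by linarith+
      then have ne': "?c12 \<noteq> {}" "?c21 \<noteq> {}" by auto
      obtain a where a: "y = pt f (v - u) a" "- n < a" "a < m" using crossing_nonemptyD[OF ne'(1)] .
      obtain a' where a': "y = pt f (u - v) a'" "- m < a'" "a' < n" using crossing_nonemptyD[OF ne'(2)] .
      have "2 \<le> m - a \<and> 2 \<le> n + a" using b(3)[OF ne'(1) a(1)] a nm eqs by auto
      moreover have "2 \<le> n - a' \<and> 2 \<le> m + a'" using b(3)[OF ne'(2) a'(1)] a' nm eqs by auto
      moreover have "pt f 0 (2 * k) = pt f 0 (a + a')"
      proof -
        have "y + y = pt f 0 (2 * k)" "y + y = pt f 0 (a + a')"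
          subgoal using k(1) by (simp add: pt_def algebra_simps)
          subgoal by (subst (1) a(1), subst a'(1)) (simp add: pt_def algebra_simps)
          done
        then show ?thesis by simp
      qed
      moreover have "\<bar>2 * k - (a + a')\<bar> < int CARD('p)" using eqs a a' p by linarith
      ultimately have "2 * k = a + a'" using pt_small_eq_iff[OF f] by blast
      then show ?thesis using \<open>2 \<le> m - a \<and> 2 \<le> n + a\<close> \<open>2 \<le> n - a' \<and> 2 \<le> m + a'\<close> eqs by linarith
    qed
  next
    case c11: True
    show ?thesis
    proof (cases "?c22 = {}")
      case False
      then obtain k where k: "y = pt f (v - v) k" "- m < k" "k < m" by (rule crossing_nonemptyD)
      then have "\<bar>k\<bar> \<le> 4" using nm by linarith
      then show ?thesis using k by auto
    next
      case True
      then have tot: "n + m - 3 \<le> int (card ?c12) + int (card ?c21)" using c11 le ge by simp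
      then have "0 < int (card ?c12)" "0 < int (card ?c21)" using b12 nm by linarith+
      then have ne': "?c12 \<noteq> {}" "?c21 \<noteq> {}" by auto
      obtain a where a: "y = pt f (v - u) a" "- n < a" "a < m" using crossing_nonemptyD[OF ne'(1)] .
      obtain a' where a': "y = pt f (u - v) a'" "- m < a'" "a' < n" using crossing_nonemptyD[OF ne'(2)] .
      have "int (card ?c12) \<le> m - a \<and> int (card ?c12) \<le> n + a" using b(3)[OF ne'(1) a(1)] a nm by auto
      moreover have "int (card ?c21) \<le> n - a' \<and> int (card ?c21) \<le> m + a'" using b(3)[OF ne'(2) a'(1)] a' nm by auto
      ultimately have "\<bar>a + a'\<bar> \<le> 3" using tot by linarith
      moreover have "2 * y = pt f 0 (a + a')"
        unfolding mult_2 by (subst (1) a(1), subst a'(1)) (simp add: pt_def algebra_simps)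
      ultimately show ?thesis by blast
    qed
  qed
qed

lemma near_ptI:
  assumes "f \<noteq> 0" "X \<subseteq> pt f z ` {l..<l + (int (card X) + 2)}"
  shows "near f X"
proof -
  have "pt f z ` {l..<l + (int (card X) + 2)} \<subseteq> seg f (pt f z l) (int (card X) + 2)"
  proof
    fix x assume "x \<in> pt f z ` {l..<l + (int (card X) + 2)}"
    then obtain i where "l \<le> i" "i < l + (int (card X) + 2)" "x = pt f z i" by auto
    then show "x \<in> seg f (pt f z l) (int (card X) + 2)"
      by (auto simp: seg_def pt_add[symmetric] intro!: image_eqI[of _ _ "i - l"])
  qed
  then show ?thesis unfolding near_def using assms by blast
qed

text \<open>If only \<open>2 y\<close> is a multiple of \<open>f\<close>, half of \<open>f\<close>
  is a common step for \<open>f\<close> and \<open>y\<close>.\<close>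

lemma half_step:
  fixes f :: "'p::prime_card mod_ring"
  assumes "53 \<le> CARD('p)" "f \<noteq> 0"
  obtains f' where "f' \<noteq> 0" "f = 2 * f'" "\<forall>y k. 2 * y = pt f 0 k \<longrightarrow> y = pt f' 0 k"
proof -
  have two: "(2 :: 'p mod_ring) \<noteq> 0" by (rule two_neq_0[OF assms(1)])
  define f' where "f' = f / 2"
  have f: "f = 2 * f'" using two by (simp add: f'_def)
  have "y = pt f' 0 k" if "2 * y = pt f 0 k" for y k
  proof -
    have "2 * y = 2 * pt f' 0 k" using that f by (simp add: pt_def algebra_simps)
    then show ?thesis using two by (metis mult_left_cancel)
  qed
  then show ?thesis using that[of f'] f assms(2) by auto
qed

text \<open>The indices are 0, 1, k, k + 1 or, after halving the step, 0, 2, k, k + 2. The bounds 4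
  and 3 for |k| are what fits into six terms.\<close>

lemma near_parallelogram:
  fixes A :: "'p::prime_card mod_ring set"
  assumes p: "53 \<le> CARD('p)" and f: "f \<noteq> 0" and A: "A = {z, z + f, z + y, z + f + y}" "card A = 4"
    and y: "(\<exists>k. \<bar>k\<bar> \<le> 4 \<and> y = pt f 0 k) \<or> (\<exists>k. \<bar>k\<bar> \<le> 3 \<and> 2 * y = pt f 0 k)"
  shows "\<exists>r. near r A"
  using y
proof
  assume "\<exists>k. \<bar>k\<bar> \<le> 4 \<and> y = pt f 0 k"
  then obtain k where k: "\<bar>k\<bar> \<le> 4" "y = pt f 0 k" by blast
  have "A = pt f z ` {0, 1, k, k + 1}" unfolding A(1) k(2) by (auto simp: pt_def algebra_simps)
  also have "\<dots> \<subseteq> pt f z ` {min 0 k..<min 0 k + (int (card A) + 2)}"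
    by (rule image_mono) (use k(1) A(2) in auto)
  finally show ?thesis using near_ptI[OF f] by blast
next
  assume "\<exists>k. \<bar>k\<bar> \<le> 3 \<and> 2 * y = pt f 0 k"
  then obtain k where k: "\<bar>k\<bar> \<le> 3" "2 * y = pt f 0 k" by blast
  obtain f' where f': "f' \<noteq> 0" "f = 2 * f'" "\<forall>y k. 2 * y = pt f 0 k \<longrightarrow> y = pt f' 0 k"
    by (rule half_step[OF p f])
  have "y = pt f' 0 k" using f'(3) k(2) by blast
  then have "A = pt f' z ` {0, 2, k, k + 2}" unfolding A(1) f'(2) by (auto simp: pt_def algebra_simps)
  also have "\<dots> \<subseteq> pt f' z ` {min 0 k..<min 0 k + (int (card A) + 2)}"
    by (rule image_mono) (use k(1) A(2) in auto)
  finally show ?thesis using near_ptI[OF f'(1)] by blast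
qed

lemma near_of_one_end:
  fixes X :: "'p::prime_card mod_ring set"
  assumes "g \<noteq> 0" "X \<noteq> {}" "X \<noteq> UNIV" "card (ends g X) \<le> 1"
  shows "near g X"
proof -
  have c2: "card (ends g X) \<le> 2" using assms by simp
  obtain u n v m where r: "row g X u n" "m = 0 \<or> row g X v m" "X = seg g u n \<union> seg g v m"
    "seg g u n \<inter> seg g v m = {}" "0 \<le> m" "m \<le> n" "int (card X) = n + m"
    using rows_of_two_ends[OF assms(1-3) c2] .
  have "m = 0"
  proof (rule ccontr)
    assume "m \<noteq> 0"
    then have rm: "row g X v m" using r(2) by simp
    then have "1 \<le> m" "1 \<le> n" using r(1) by (auto simp: row_def)
    then have "pt g u (n - 1) \<in> seg g u n" "pt g v (m - 1) \<in> seg g v m" by (auto simp: seg_def)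
    then have "pt g u (n - 1) \<noteq> pt g v (m - 1)" using r(4) by auto
    then have "2 \<le> card (ends g X)"
      using card_mono[of "ends g X" "{pt g u (n - 1), pt g v (m - 1)}"] row_last_in_ends[OF r(1)] row_last_in_ends[OF rm] by simp
    then show False using assms(4) by simp
  qed
  then have "X \<subseteq> seg g u (int (card X) + 2)" using r(3,7) seg_mono[of n "n + 2" g u] by (auto simp: seg_def)
  then show ?thesis using assms(1) by (auto simp: near_def)
qed

section \<open>Parallelograms and three-term progressions\<close>

lemma ends_Un_translate_subset: "ends g (X \<union> (+) g ` X) \<subseteq> (+) g ` ends g X"
  by (auto simp: ends_def image_iff add.commute)

lemma card_ends_Un_translate_le:
  "finite X \<Longrightarrow> card (ends g (X \<union> (+) g ` X)) \<le> card (ends g X)"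
  using card_mono[OF _ ends_Un_translate_subset[of g X]] by (simp add: card_image ends_def)

text \<open>\<open>A + B\<close> is a translate of \<open>Y + {0, h}\<close> with
  \<open>Y = B + {0, g}\<close>, so \<open>B\<close> has for \<open>g\<close> and \<open>Y\<close>
  has for \<open>h\<close> together at most five ends. One of the two numbers is at most 2; the
  corresponding direction supplies the rows of \<open>Y\<close>, the other one the
  translation.\<close>

lemma parallelogram_case:
  fixes A B :: "'p::prime_card mod_ring set"
  assumes p: "53 \<le> CARD('p)" and g: "g \<noteq> 0" and h: "h \<noteq> 0" and A: "A = {z, z + g, z + h, z + g + h}" "card A = 4"
    and B: "card B = 5" "card (ends g B) \<le> 3" and AB: "card (A + B) \<le> 10"
  shows "\<exists>r. near r A \<or> near r B"
proof (cases "card (ends g B) \<le> 1")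
  case True
  then show ?thesis using near_of_one_end[OF g, of B] B p by fastforce
next
  case False
  define Y where "Y = B \<union> (+) g ` B"
  have cY: "card Y = 5 + card (ends g B)" unfolding Y_def using card_Un_translate[of B g] B by simp
  have "A + B = (+) z ` (Y \<union> (+) h ` Y)"
    unfolding A(1) Y_def by (auto simp: set_plus_def image_iff algebra_simps)
  then have "card (A + B) = card Y + card (ends h Y)" by (simp add: card_image card_Un_translate)
  then have h5: "card (ends g B) + card (ends h Y) \<le> 5" using AB cY by simp
  have gY: "card (ends g Y) \<le> card (ends g B)" unfolding Y_def by (rule card_ends_Un_translate_le) simp
  consider "card (ends g B) = 2" | "card (ends g B) = 3" using False B by linarith
  then show ?thesis
  proof cases
    case 1
    then have "(\<exists>k. \<bar>k\<bar> \<le> 4 \<and> h = pt g 0 k) \<or> (\<exists>k. \<bar>k\<bar> \<le> 3 \<and> 2 * h = pt g 0 k)"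
      using gY cY h5 by (intro two_rows_almost_periodic[OF p g, of Y]) auto
    from near_parallelogram[OF p g A this] show ?thesis by blast
  next
    case 2
    then have "(\<exists>k. \<bar>k\<bar> \<le> 4 \<and> g = pt h 0 k) \<or> (\<exists>k. \<bar>k\<bar> \<le> 3 \<and> 2 * g = pt h 0 k)"
      using gY cY h5 by (intro two_rows_almost_periodic[OF p h, of Y]) auto
    moreover have "A = {z, z + h, z + g, z + h + g}" unfolding A(1) by (auto simp: algebra_simps)
    ultimately show ?thesis using near_parallelogram[OF p h _ A(2)] by blast
  qed
qed

text \<open>Let \<open>Y = B + {0, g}\<close> and \<open>J = B + {0, g, 2 g}\<close>. Few sums force
  \<open>Y\<close> into at most two rows; these contain \<open>B\<close> when shortened and
  \<open>J\<close> when lengthened by one step. Most of \<open>B\<close> is carried into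
  \<open>J\<close> by \<open>w\<close>, and the crossings make \<open>w\<close> or
  \<open>2 w\<close> a small multiple of \<open>g\<close>.\<close>

lemma progression_case:
  fixes A B :: "'p::prime_card mod_ring set"
  assumes p: "53 \<le> CARD('p)" and g: "g \<noteq> 0" and A: "A = {z, z + g, z + 2 * g, z + w}" "card A = 4"
    and B: "card B = 5" "card (ends g B) \<le> 3" and AB: "card (A + B) \<le> 10"
  shows "\<exists>r. near r A \<or> near r B"
proof (cases "card (ends g B) \<le> 1")
  case True
  then show ?thesis using near_of_one_end[OF g, of B] B p by fastforce
next
  case False
  define d where "d = int (card (ends g B))"
  have d: "d = 2 \<or> d = 3" using False B by (auto simp: d_def)
  define Y where "Y = B \<union> (+) g ` B"
  define J where "J = Y \<union> (+) g ` Y"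
  have cY: "int (card Y) = 5 + d" unfolding Y_def using card_Un_translate[of B g] B by (simp add: d_def)
  have gY: "int (card (ends g Y)) \<le> d" unfolding Y_def d_def using card_ends_Un_translate_le[of B g] by simp
  have "A + B = (+) z ` (J \<union> (+) w ` B)"
    unfolding A(1) J_def Y_def by (auto simp: set_plus_def image_iff algebra_simps mult_2)
  then have JB: "card (J \<union> (+) w ` B) \<le> 10" using AB by (simp add: card_image)
  have cJ: "card J = card Y + card (ends g Y)" unfolding J_def by (simp add: card_Un_translate)
  have "card J \<le> card (J \<union> (+) w ` B)" by (rule card_mono) auto
  then have gY2: "card (ends g Y) \<le> 2" using JB cJ cY gY d by linarith
  have Y': "Y \<noteq> {}" "Y \<noteq> UNIV" using cY d p by auto
  obtain u n v m where r: "row g Y u n" "m = 0 \<or> row g Y v m" "Y = seg g u n \<union> seg g v m"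
    "seg g u n \<inter> seg g v m = {}" "0 \<le> m" "m \<le> n" "int (card Y) = n + m"
    using rows_of_two_ends[OF g Y' gY2] .
  have BY: "x \<in> Y \<and> x + g \<in> Y" if "x \<in> B" for x using that by (auto simp: Y_def add.commute)
  have shrink: "x \<in> seg g u' (n' - 1)" if r': "row g Y u' n'" and x: "x \<in> B" "x \<in> seg g u' n'" for u' n' x
  proof -
    obtain i where i: "0 \<le> i" "i < n'" "x = pt g u' i" using x by (auto simp: seg_def)
    have "i \<noteq> n' - 1"
    proof
      assume "i = n' - 1"
      then have "n' = i + 1" by simp
      then have "x + g = pt g u' n'" using i by (simp add: pt_def algebra_simps)
      then show False using BY[OF x(1)] r' by (simp add: row_def)
    qed
    then show ?thesis using i by (auto simp: seg_def)
  qed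
  show ?thesis
  proof (cases "m = 0")
    case True
    then have "B \<subseteq> seg g u (n - 1)" using shrink[OF r(1)] r(3) BY by (auto simp: seg_def)
    moreover have "n - 1 \<le> int (card B) + 2" using True r(7) cY d B by linarith
    ultimately have "near g B" using g seg_mono[of "n - 1" "int (card B) + 2" g u] by (auto simp: near_def)
    then show ?thesis by blast
  next
    case False
    then have rv: "row g Y v m" using r(2) by simp
    have "2 \<le> card (ends g Y)"
    proof -
      have "pt g u (n - 1) \<in> seg g u n" "pt g v (m - 1) \<in> seg g v m" using r(1) rv by (auto simp: seg_def row_def)
      then have "pt g u (n - 1) \<noteq> pt g v (m - 1)" using r(4) by auto
      then show ?thesis
        using card_mono[of "ends g Y" "{pt g u (n - 1), pt g v (m - 1)}"] row_last_in_ends[OF r(1)] row_last_in_ends[OF rv] by simp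
    qed
    then have cJ': "7 + d \<le> int (card J)" using cJ cY by linarith
    have first: "u' \<in> B" and last: "pt g u' (n' - 2) \<in> B" and n2: "2 \<le> n'" if r': "row g Y u' n'" for u' n'
    proof -
      have n1: "1 \<le> n'" and sub: "seg g u' n' \<subseteq> Y" and out: "u' - g \<notin> Y" "pt g u' n' \<notin> Y" using r' by (auto simp: row_def)
      have "pt g u' 0 \<in> seg g u' n'" unfolding seg_def by (rule imageI) (use n1 in simp)
      then have "u' \<in> Y" using sub by auto
      show "u' \<in> B"
      proof (rule ccontr)
        assume "u' \<notin> B"
        then obtain x where "x \<in> B" "u' = g + x" using \<open>u' \<in> Y\<close> by (auto simp: Y_def)
        then show False using out(1) BY by simp
      qed
      have "pt g u' (n' - 1) \<in> Y" using n1 sub by (auto simp: seg_def)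
      moreover have "pt g u' (n' - 1) \<notin> B"
        using BY[of "pt g u' (n' - 1)"] out(2) by (auto simp: pt_def algebra_simps)
      ultimately obtain x where x: "x \<in> B" "pt g u' (n' - 1) = g + x" by (auto simp: Y_def)
      then have xe: "x = pt g u' (n' - 2)" by (simp add: pt_def algebra_simps)
      then show "pt g u' (n' - 2) \<in> B" using x by simp
      show "2 \<le> n'"
      proof (rule ccontr)
        assume "\<not> 2 \<le> n'"
        then have "n' = 1" using n1 by simp
        then have "x = u' - g" using xe by (simp add: pt_def)
        then show False using out(1) BY[OF x(1)] by simp
      qed
    qed
    define n1 where "n1 = n - 1"
    define m1 where "m1 = m - 1"
    have nm: "n1 + m1 = 3 + d" "1 \<le> m1" "m1 \<le> n1" "n1 \<le> 5" "m1 \<le> 3"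
      using r(6,7) cY n2[OF r(1)] n2[OF rv] d by (auto simp: n1_def m1_def)
    have BK: "B \<subseteq> seg g u n1 \<union> seg g v m1"
      using BY r(3) shrink[OF r(1)] shrink[OF rv] by (auto simp: n1_def m1_def)
    have JK: "J \<subseteq> seg g u (n1 + 2) \<union> seg g v (m1 + 2)"
    proof -
      have "(+) g ` seg g x l \<subseteq> seg g x (l + 1)" for x l
      proof -
        have "g + pt g x i = pt g x (i + 1)" for i by (simp add: pt_def algebra_simps)
        then show ?thesis by (auto simp: seg_def)
      qed
      moreover have "seg g x l \<subseteq> seg g x (l + 1)" for x l by (rule seg_mono) simp
      ultimately have "Y \<union> (+) g ` Y \<subseteq> seg g u (n + 1) \<union> seg g v (m + 1)"
        unfolding r(3) image_Un by blast
      then show ?thesis by (simp add: J_def n1_def m1_def add.commute)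
    qed
    define G where "G = {x \<in> B. x + w \<in> J}"
    \<comment> \<open>Of the at most 10 sums \<open>J\<close> takes at least \<open>7 + d\<close>,
      so at most \<open>3 - d\<close> of the five elements of \<open>B\<close> leave
      \<open>J\<close> under \<open>w\<close>.\<close>
    have cG: "2 + d \<le> int (card G)"
    proof -
      have "J \<inter> (+) w ` (B - G) = {}" by (auto simp: G_def add.commute)
      then have "card (J \<union> (+) w ` (B - G)) = card J + card ((+) w ` (B - G))" by (intro card_Un_disjoint) auto
      moreover have "card (J \<union> (+) w ` (B - G)) \<le> card (J \<union> (+) w ` B)" by (rule card_mono) auto
      moreover have "card ((+) w ` (B - G)) = card B - card G" by (simp add: card_image card_Diff_subset G_def)
      ultimately show ?thesis using cJ' JB B by linarith
    qed
    let ?c11 = "crossing g w u n1 u (n1 + 2)" and ?c12 = "crossing g w u n1 v (m1 + 2)"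
    let ?c21 = "crossing g w v m1 u (n1 + 2)" and ?c22 = "crossing g w v m1 v (m1 + 2)"
    have Gsub: "G \<subseteq> ?c11 \<union> ?c12 \<union> (?c21 \<union> ?c22)"
      using BK JK by (auto simp: G_def crossing_def)
    then have le: "card G \<le> card ?c11 + card ?c12 + (card ?c21 + card ?c22)"
      by (intro card_Un4_le) auto
    have near_k: ?thesis if "w = pt g 0 k" "-3 \<le> k" "k \<le> 5" for k
    proof -
      have "A = pt g z ` {0, 1, 2, k}" unfolding A(1) that(1) by (auto simp: pt_def)
      also have "\<dots> \<subseteq> pt g z ` {min 0 k..<min 0 k + (int (card A) + 2)}"
        by (rule image_mono) (use that A(2) in auto)
      finally show ?thesis using near_ptI[OF g] by blast
    qed
    note b = card_crossing_le[OF p g, where y = w]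
    show ?thesis
    proof (cases "?c11 = {}")
      case ne: False
      obtain k where k: "w = pt g (u - u) k" "- n1 < k" "k < n1 + 2" using crossing_nonemptyD[OF ne] .
      show ?thesis
      proof (cases "-3 \<le> k \<and> k \<le> 5")
        case True
        then show ?thesis using near_k[of k] k by simp
      next
        case False
        then have eqs: "n1 = 5" "m1 = 1" "d = 3" "k = -4 \<or> k = 6" using k nm d by linarith+
        then have "G = B" using cG B by (intro card_seteq) (auto simp: G_def)
        then have BJ: "x + w \<in> seg g u 7 \<or> x + w \<in> seg g v 3" if "x \<in> B" for x
          using that JK eqs by (auto simp: G_def)
        have w: "w = of_int k * g" using k by (simp add: pt_def)
        have "v + w \<in> seg g u 7"
        proof (rule ccontr)
          assume "v + w \<notin> seg g u 7"
          then have "v + w \<in> seg g v 3" using BJ[OF first[OF rv]] by blast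
          then obtain i where i: "0 \<le> i" "i < 3" "pt g v k = pt g v i" by (auto simp: seg_def w pt_def)
          then have "k = i" using pt_small_eq_iff[OF g, of k i v] eqs p by auto
          then show False using i eqs by auto
        qed
        then obtain j where j: "0 \<le> j" "j < 7" "pt g v k = pt g u j" by (auto simp: seg_def w pt_def)
        \<comment> \<open>Here all of \<open>B\<close> moves into \<open>J\<close>. The index
          \<open>e\<close> is the end of the long row that \<open>w\<close> pushes out of the first
          segment, while \<open>v\<close> is pushed into it. Adding the two moves gives
          \<open>e + 2 k = j + i\<close>, but the left side is 16 or -8 and the right side lies
          between 0 and 8.\<close>
        define e where "e = (if k = 6 then 4 else 0 :: int)"
        have "pt g u e \<in> B" using first[OF r(1)] last[OF r(1)] eqs by (auto simp: e_def n1_def)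
        then have "pt g u e + w \<in> seg g u 7 \<or> pt g u e + w \<in> seg g v 3" by (rule BJ)
        moreover have uew: "pt g u e + w = pt g u (e + k)" by (simp add: w pt_def algebra_simps)
        moreover have "pt g u (e + k) \<notin> seg g u 7"
        proof
          assume "pt g u (e + k) \<in> seg g u 7"
          then obtain i where i: "0 \<le> i" "i < 7" "pt g u (e + k) = pt g u i" by (auto simp: seg_def)
          then have "e + k = i" using pt_small_eq_iff[OF g, of "e + k" i u] eqs(4) p by (auto simp: e_def)
          then show False using i eqs(4) by (auto simp: e_def)
        qed
        ultimately obtain i where i: "0 \<le> i" "i < 3" "pt g u (e + k) = pt g v i" by (auto simp: seg_def)
        have "pt g u (e + k + k) = pt g u (j + i)"
          using i(3) j(3) by (metis (no_types, opaque_lifting) add.commute pt_add)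
        then have "e + k + k = j + i"
          using pt_small_eq_iff[OF g, of "e + k + k" "j + i" u] eqs(4) p i j by (auto simp: e_def)
        then show ?thesis using i j eqs(4) by (auto simp: e_def)
      qed
    next
      case c11: True
      show ?thesis
      proof (cases "?c22 = {}")
        case False
        then obtain k where k: "w = pt g (v - v) k" "- m1 < k" "k < m1 + 2" by (rule crossing_nonemptyD)
        then show ?thesis using near_k[of k] nm by simp
      next
        case True
        then have tot: "2 + d \<le> int (card ?c12) + int (card ?c21)" using c11 le cG by simp
        have "int (card ?c12) \<le> n1" "int (card ?c12) \<le> m1 + 2" "int (card ?c21) \<le> m1"
          using b(1)[of u n1 v "m1 + 2"] b(2)[of u n1 v "m1 + 2"] b(1)[of v m1 u "n1 + 2"] nm by auto
        then have "0 < int (card ?c12)" "0 < int (card ?c21)" using tot nm d by linarith+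
        then have ne': "?c12 \<noteq> {}" "?c21 \<noteq> {}" by auto
        obtain a where a: "w = pt g (v - u) a" "- n1 < a" "a < m1 + 2" using crossing_nonemptyD[OF ne'(1)] .
        obtain a' where a': "w = pt g (u - v) a'" "- m1 < a'" "a' < n1 + 2" using crossing_nonemptyD[OF ne'(2)] .
        have "int (card ?c12) \<le> m1 + 2 - a \<and> int (card ?c12) \<le> n1 + a" using b(3)[OF ne'(1) a(1)] a nm by auto
        moreover have "int (card ?c21) \<le> n1 + 2 - a' \<and> int (card ?c21) \<le> m1 + a'" using b(3)[OF ne'(2) a'(1)] a' nm by auto
        \<comment> \<open>The sizes give \<open>2 + d \<le> 7 + d - (a + a')\<close> and
          \<open>2 + d \<le> 3 + d + (a + a')\<close>. So 0, 2, 4 and \<open>a + a'\<close> fit into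
          six terms of the halved step.\<close>
        ultimately have s: "-1 \<le> a + a'" "a + a' \<le> 5" using tot nm by linarith+
        have "2 * w = pt g 0 (a + a')"
          unfolding mult_2 by (subst (1) a(1), subst a'(1)) (simp add: pt_def algebra_simps)
        moreover obtain f where f: "f \<noteq> 0" "g = 2 * f" "\<forall>y k. 2 * y = pt g 0 k \<longrightarrow> y = pt f 0 k"
          by (rule half_step[OF p g])
        ultimately have w: "w = pt f 0 (a + a')" by blast
        have "A = pt f z ` {0, 2, 4, a + a'}" unfolding A(1) w f(2) by (auto simp: pt_def algebra_simps)
        also have "\<dots> \<subseteq> pt f z ` {min 0 (a + a')..<min 0 (a + a') + (int (card A) + 2)}"
          by (rule image_mono) (use s A(2) in auto)
        finally show ?thesis using near_ptI[OF f(1)] by blast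
      qed
    qed
  qed
qed

text \<open>A repeated difference has an overlap of exactly two, since one end would make
  \<open>A\<close> a progression. In either shape some overlap of \<open>A\<close> is a pair with
  difference \<open>g\<close>: the overlap for \<open>g\<close> of a three-term progression, or for
  the other side \<open>h\<close> of a parallelogram. This bounds the ends of \<open>B\<close> for
  \<open>g\<close> by 3.\<close>

lemma critical_4_5_False:
  fixes A B :: "'p::prime_card mod_ring set"
  assumes cr: "critical A B" and "card A = 4" "card B = 5"
  shows False
proof -
  note c = critical_basic[OF cr]
  have n: "\<not> near r A" "\<not> near r B" for r
    using critical_not_near[OF cr] critical_not_near[OF critical_commute[OF cr]] by blast+
  have AB: "card (A + B) \<le> 10" using c assms by simp
  obtain g where g: "g \<noteq> 0" "\<not> card (overlap g A) \<le> 1"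
    using critical_4_5_Sidon_False[OF cr assms(2,3)] by blast
  have "\<not> card (ends g A) \<le> 1" using near_of_one_end[OF g(1) c(10,12)] n by blast
  then have "card (overlap g A) = 2" using g(2) card_overlap_ends[of A g] assms by simp
  then obtain z z' where z: "overlap g A = {z, z'}" "z \<noteq> z'" by (auto simp: card_2_iff)
  then have zA: "z \<in> A" "z + g \<in> A" "z' \<in> A" "z' + g \<in> A" by (auto simp: overlap_def)
  have *: False if y: "y \<in> A" "y + g \<in> A" "y + g + g \<in> A" for y
  proof -
    have "y \<in> overlap g A" "y + g \<in> overlap g A" using y by (auto simp: overlap_def)
    then have o: "overlap g A = {y, y + g}" using z g(1) by auto
    have "card (ends (y + g - y) B) \<le> 3" by (rule critical_card_ends_of_pair[OF cr o]) (use g(1) in simp)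
    then have e: "card (ends g B) \<le> 3" by simp
    have "g + g \<noteq> 0" using two_neq_0[OF c(1)] g(1) by (simp add: mult_2[symmetric])
    then have "y + g + g \<noteq> y" by (simp only: add.assoc add_cancel_left_right not_False_eq_True)
    moreover have "card {a, b, c} = 3" if "a \<noteq> b" "c \<noteq> a" "b \<noteq> c" for a b c :: "'p mod_ring" using that by auto
    ultimately have "card {y, y + g, y + g + g} = 3" using g(1) by (metis add_cancel_left_right)
    then have "card (A - {y, y + g, y + g + g}) = 1" using y assms by (subst card_Diff_subset) auto
    then obtain x where x: "A - {y, y + g, y + g + g} = {x}" by (auto simp: card_1_singleton_iff)
    have "A = {y, y + g, y + g + g} \<union> (A - {y, y + g, y + g + g})" using y by auto
    then have AE: "A = {y, y + g, y + g + g, x}" unfolding x by (simp only: Un_insert_left Un_empty_left)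
    have e1: "y + 2 * g = y + g + g" and e2: "y + (x - y) = x" by (simp_all only: mult_2 add.assoc add_diff_eq add_diff_cancel_left')
    have "A = {y, y + g, y + 2 * g, y + (x - y)}" unfolding e1 e2 by (rule AE)
    from progression_case[OF c(1) g(1) this assms(2,3) e AB] show False using n by blast
  qed
  show False
  proof (cases "z' = z + g \<or> z = z' + g")
    case True
    then show False using *[of z] *[of z'] zA by auto
  next
    case False
    define h where "h = z' - z"
    have h: "h \<noteq> 0" "z' = z + h" using z(2) by (simp_all add: h_def)
    have comm: "z + g + h = z + h + g" by (simp add: ac_simps)
    have "z \<noteq> z + g" "z \<noteq> z + h" "z \<noteq> z + g + h" "z + g \<noteq> z + h" "z + g \<noteq> z + g + h" "z + h \<noteq> z + g + h"
      using g(1) h False by (simp, simp, metis comm, metis, simp, simp add: comm)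
    moreover have "card {a, b, c, d} = 4" if "a \<noteq> b" "a \<noteq> c" "a \<noteq> d" "b \<noteq> c" "b \<noteq> d" "c \<noteq> d"
      for a b c d :: "'p mod_ring" using that by auto
    ultimately have "card {z, z + g, z + h, z + g + h} = 4" by metis
    moreover have "{z, z + g, z + h, z + g + h} \<subseteq> A" using zA h by (auto simp: algebra_simps)
    ultimately have A: "A = {z, z + g, z + h, z + g + h}" using assms by (intro card_seteq[symmetric]) auto
    have oh: "{z, z + g} \<subseteq> overlap h A" unfolding A by (auto simp: overlap_def)
    have "\<not> card (ends h A) \<le> 1" using near_of_one_end[OF h(1) c(10,12)] n by blast
    then have "card (overlap h A) \<le> card {z, z + g}" using card_overlap_ends[of A h] assms g(1) by simp
    then have "{z, z + g} = overlap h A" using oh by (intro card_seteq) auto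
    then have "card (ends (z + g - z) B) \<le> 3"
      using critical_card_ends_of_pair[OF cr, of h z "z + g"] g(1) by simp
    then have "card (ends g B) \<le> 3" by simp
    from parallelogram_case[OF c(1) g(1) h(1) A assms(2,3) this AB] show False using n by blast
  qed
qed

section \<open>From minimal counterexamples to the theorem\<close>

lemma no_critical: "\<not> critical A B"
proof
  assume cr: "critical A B"
  show False
  proof (cases "card A \<le> card B")
    case True
    then show False using critical_cards[OF cr] critical_4_5_False[OF cr] by blast
  next
    case False
    then show False
      using critical_cards[OF critical_commute[OF cr]] critical_4_5_False[OF critical_commute[OF cr]] by simp
  qed
qed

text \<open>Since \<open>card X + card Y < 2 p + 1\<close>, the weight \<open>wt\<close> is monotone in the lexicographic order
  on excess and total size.\<close>

lemma good_of_small_pair: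
  fixes A B :: "'p::prime_card mod_ring set"
  assumes p: "53 \<le> CARD('p)" and "small_pair A B"
  shows "good A B"
proof (rule ccontr)
  assume "\<not> good A B"
  define P where "P = (\<lambda>(X, Y). small_pair X Y \<and> \<not> good X (Y :: 'p mod_ring set))"
  define wt where "wt = (\<lambda>(X, Y). nat ((excess X Y + 1) * (2 * int CARD('p) + 1)) + (card X + card (Y :: 'p mod_ring set)))"
  have "P (A, B)" using assms \<open>\<not> good A B\<close> by (simp add: P_def)
  then obtain S where S: "P S" "\<And>T. P T \<Longrightarrow> wt S \<le> wt T"
    using ex_has_least_nat[of P "(A, B)" wt] by blast
  obtain A' B' where AB': "S = (A', B')" by (cases S)
  have "critical A' B'"
    unfolding critical_def
  proof (intro conjI allI impI)
    fix X Y :: "'p mod_ring set"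
    assume XY: "small_pair X Y"
      and less: "excess X Y < excess A' B' \<or> (excess X Y = excess A' B' \<and> card X + card Y < card A' + card B')"
    show "good X Y"
    proof (rule ccontr)
      assume "\<not> good X Y"
      then have "wt (A', B') \<le> wt (X, Y)" using S(2)[of "(X, Y)"] XY AB' by (simp add: P_def)
      moreover have "wt (X, Y) < wt (A', B')"
      proof -
        have XYn: "X \<noteq> {}" "Y \<noteq> {}" "X + Y \<noteq> UNIV" using XY by (auto simp: small_pair_def)
        \<comment> \<open>The shift by 1 in \<open>wt\<close> relies on this bound; for a smaller
          excess \<open>nat\<close> would truncate.\<close>
        have "-1 \<le> excess X Y" using Cauchy_Davenport[OF XYn] by (simp add: excess_def)
        have cXY: "card X + card Y \<le> 2 * CARD('p)" using card_Compl_mod_ring[of X] card_Compl_mod_ring[of Y] by linarith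
        from less show ?thesis
        proof
          assume "excess X Y < excess A' B'"
          then have "(excess X Y + 1 + 1) * (2 * int CARD('p) + 1) \<le> (excess A' B' + 1) * (2 * int CARD('p) + 1)"
            by (intro mult_right_mono) auto
          moreover have "0 \<le> (excess X Y + 1) * (2 * int CARD('p) + 1)" using \<open>-1 \<le> excess X Y\<close> by simp
          ultimately show ?thesis using cXY by (simp add: wt_def distrib_right)
        next
          assume "excess X Y = excess A' B' \<and> card X + card Y < card A' + card B'"
          then show ?thesis by (simp add: wt_def)
        qed
      qed
      ultimately show False by simp
    qed
  qed (use p S(1) AB' in \<open>auto simp: P_def\<close>)
  then show False using no_critical by blast
qed

lemma ap_length_le_of_near:
  assumes "near r X"
  shows "ap_length r X \<le> enat (card X + 2)"
proof -
  obtain x where x: "X \<subseteq> seg r x (int (card X) + 2)" using assms by (auto simp: near_def)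
  have *: "seg r x (int (card X) + 2) = {x + of_nat i * r | i. i < card X + 2}"
  proof (intro subset_antisym subsetI)
    fix y assume "y \<in> seg r x (int (card X) + 2)"
    then obtain i where "0 \<le> i" "i < int (card X) + 2" "y = x + of_int i * r" by (auto simp: seg_def pt_def)
    then have "nat i < card X + 2" "y = x + of_nat (nat i) * r" by auto
    then show "y \<in> {x + of_nat i * r | i. i < card X + 2}" by blast
  next
    fix y assume "y \<in> {x + of_nat i * r | i. i < card X + 2}"
    then obtain i where "i < card X + 2" "y = pt r x (int i)" by (auto simp: pt_def)
    then show "y \<in> seg r x (int (card X) + 2)" by (auto simp: seg_def)
  qed
  have "is_AP r (seg r x (int (card X) + 2))" unfolding is_AP_def * by blast
  then have "ap_length r X \<le> enat (card (seg r x (int (card X) + 2)))"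
    unfolding ap_length_def using x by (intro INF_lower) auto
  also have "card (seg r x (int (card X) + 2)) \<le> card X + 2"
    using card_image_le[of "{0..<int (card X) + 2}" "pt r x"] by (simp add: seg_def)
  finally show ?thesis by simp
qed

theorem theorem1p4:
  fixes A B :: "'p::prime_card mod_ring set"
  assumes "CARD('p) \<ge> 53"
    and "card A \<ge> 4"
    and "card B \<ge> 5"
    and "card (A + B) \<le> card A + card B + 1"
    and "card A + card B + 1 \<le> CARD('p) - 5"
  shows "\<exists>r :: 'p mod_ring.
           ap_length r A \<le> enat (card A + 2) \<and> ap_length r B \<le> enat (card B + 2)"
proof -
  \<comment> \<open>At least five elements lie outside \<open>A + B\<close>, so each pair of sizes
    adds up to at least 9.\<close>
  have "small_pair A B"
    using assms card_Compl_mod_ring[of "A + B"] by (auto simp: small_pair_def)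
  then show ?thesis
    using good_of_small_pair[OF assms(1)] ap_length_le_of_near unfolding good_def by blast
qed

end
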